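(* Let $\Delta_{S^7}$ denote the Laplace–Beltrami operator of $S^7$ with respect to the usual (round) Riemannian structure and let $\Delta_{sR}=\sum_{a=2}^7X_a^2$. Then, for $t\ge 0$, $$e^{-t\Delta_{S^7}}=e^{-t(\Delta_{sR}+X_1^2)}=e^{-t\Delta_{sR}}\,e^{-tX_1^2}$$ as operators on $L^2(S^7)$, where, for each of the operators $L=\Delta_{S^7},\ \Delta_{sR}+X_1^2,\ \Delta_{sR},\ X_1^2$, the symbol $e^{-tL}$ denotes the semigroup of operators on $L^2(S^7)$ whose infinitesimal generator is $L$.
   Context: On $S^7\subset\mathbb{R}^8$ with coordinates $x=(x_0,\ldots,x_7)$, consider the vector fields (orthonormal frame of $TS^7$ for the round metric), written as the coefficient vectors with respect to $(\partial_{x_0},\ldots,\partial_{x_7})$: $X_1=(-x_1,x_0,-x_3,x_2,-x_5,x_4,-x_7,x_6)$, $X_2=(-x_2,x_3,x_0,-x_1,-x_6,x_7,x_4,-x_5)$, $X_3=(-x_3,-x_2,x_1,x_0,x_7,x_6,-x_5,-x_4)$, $X_4=(-x_4,x_5,x_6,-x_7,x_0,-x_1,-x_2,x_3)$, $X_5=(-x_5,-x_4,-x_7,-x_6,x_1,x_0,x_3,x_2)$, $X_6=(-x_6,x_7,-x_4,x_5,x_2,-x_3,x_0,-x_1)$, $X_7=(-x_7,-x_6,x_5,x_4,-x_3,-x_2,x_1,x_0)$. The Laplace–Beltrami operator is taken with the sign convention $\Delta_{S^7}f=\mathrm{div}(\nabla f)$ (nonpositive operator). $L^2(S^7)$ is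 taken with respect to the Riemannian volume of the round $S^7$ (Popp's volume up to a constant). Each operator $L$ above is a nonpositive symmetric operator on $C^\infty(S^7)$ and is identified with its closure in $L^2(S^7)$. Notational convention: $e^{-tL}$, $t\ge0$, stands for the strongly continuous contraction semigroup with infinitesimal generator $L$ (i.e. $u(t)=e^{-tL}f$ solves $\partial_tu=Lu$, $u(0)=f$), despite the minus sign in the notation. *)

theory Defs
  imports "HOL-Analysis.Analysis"
begin

section \<open>Calculus on the unit sphere of a Euclidean space\<close>

text \<open>
  Functions and vector fields on the sphere are represented by functions on the ambient space;
  only their values on \<^term>\<open>sphere 0 1\<close> are ever used.  The derivative of such a function is
  taken within the sphere: it is uniquely determined on tangent vectors (and only there),
  and below it is applied to tangent vectors only.
\<close>

definition sphere_deriv ::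
  "('a::euclidean_space \<Rightarrow> 'b::real_normed_vector) \<Rightarrow> 'a \<Rightarrow> 'a \<Rightarrow> 'b"
  where "sphere_deriv f x v = frechet_derivative f (at x within sphere 0 1) v"

definition vf_app ::
  "('a::euclidean_space \<Rightarrow> 'a) \<Rightarrow> ('a \<Rightarrow> 'b::real_normed_vector) \<Rightarrow> 'a \<Rightarrow> 'b"
  where "vf_app X f x = sphere_deriv f x (X x)"

primrec Ck_on ::
  "nat \<Rightarrow> ('a::real_normed_vector \<Rightarrow> 'b::real_normed_vector) \<Rightarrow> 'a set \<Rightarrow> bool"
  where
    "Ck_on 0 f U \<longleftrightarrow> continuous_on U f"
  | "Ck_on (Suc k) f U \<longleftrightarrow>
       f differentiable_on U \<and> (\<forall>v. Ck_on k (\<lambda>x. frechet_derivative f (at x) v) U)"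

definition smooth_on_sphere :: "('a::euclidean_space \<Rightarrow> 'b::real_normed_vector) \<Rightarrow> bool"
  where "smooth_on_sphere f \<longleftrightarrow>
    (\<exists>U g. open U \<and> sphere 0 1 \<subseteq> U \<and> (\<forall>k. Ck_on k g U) \<and> (\<forall>x\<in>sphere 0 1. g x = f x))"

text \<open>The Riemannian metric is the restriction of the ambient inner product to the tangent
  spaces \<^term>\<open>sphere_tangent x\<close>.\<close>

definition sphere_tangent :: "'a::euclidean_space \<Rightarrow> 'a set"
  where "sphere_tangent x = {v. v \<bullet> x = 0}"

definition tangent_proj :: "'a::euclidean_space \<Rightarrow> 'a \<Rightarrow> 'a"
  where "tangent_proj x v = v - (v \<bullet> x) *\<^sub>R x"

definition sphere_grad :: "('a::euclidean_space \<Rightarrow> real) \<Rightarrow> 'a \<Rightarrow> 'a"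
  where "sphere_grad f x =
    (THE g. g \<in> sphere_tangent x \<and> (\<forall>v\<in>sphere_tangent x. g \<bullet> v = sphere_deriv f x v))"

text \<open>The Levi-Civita connection of the induced metric.\<close>

definition sphere_cov :: "('a::euclidean_space \<Rightarrow> 'a) \<Rightarrow> 'a \<Rightarrow> 'a \<Rightarrow> 'a"
  where "sphere_cov Y x v = tangent_proj x (sphere_deriv Y x v)"

text \<open>The trace of the endomorphism \<^term>\<open>sphere_cov Y x\<close> of the tangent space at \<^term>\<open>x\<close>,
  computed on the ambient space after extending the endomorphism by \<^term>\<open>0\<close> to the normal line.\<close>

definition sphere_div :: "('a::euclidean_space \<Rightarrow> 'a) \<Rightarrow> 'a \<Rightarrow> real"
  where "sphere_div Y x = (\<Sum>b\<in>Basis. sphere_cov Y x (tangent_proj x b) \<bullet> b)"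

text \<open>For vector-valued functions (in particular complex-valued ones) the operator acts on
  each real component.\<close>

definition laplace_beltrami ::
  "('a::euclidean_space \<Rightarrow> 'b::euclidean_space) \<Rightarrow> 'a \<Rightarrow> 'b"
  where "laplace_beltrami f x =
    (\<Sum>b\<in>Basis. sphere_div (sphere_grad (\<lambda>y. f y \<bullet> b)) x *\<^sub>R b)"


section \<open>The Hilbert space of square integrable functions on the sphere\<close>

text \<open>The Riemannian volume of the unit sphere: the surface area of a Borel set \<open>A\<close> is the
  dimension of the ambient space times the Lebesgue measure of the cone
  \<open>{r a | 0 < r \<le> 1, a \<in> A}\<close> over it (polar coordinates).\<close>

definition sphere_volume :: "'a::euclidean_space measure"
  where "sphere_volume = scale_measure (of_nat DIM('a))
    (distr (restrict_space lborel (cball 0 1 - {0})) (restrict_space borel (sphere 0 1)) sgn)"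

definition sphere_sq_integrable :: "('a::euclidean_space \<Rightarrow> 'b::euclidean_space) \<Rightarrow> bool"
  where "sphere_sq_integrable f \<longleftrightarrow>
    f \<in> borel_measurable sphere_volume \<and> integrable sphere_volume (\<lambda>x. (norm (f x))\<^sup>2)"

lemma space_sphere_volume [simp]:
  "space (sphere_volume :: 'a::euclidean_space measure) = sphere 0 1"
  by (simp add: sphere_volume_def space_scale_measure space_restrict_space)

lemma sets_sphere_volume [simp, measurable_cong]:
  "sets (sphere_volume :: 'a::euclidean_space measure) = sets (restrict_space borel (sphere 0 1))"
  by (simp add: sphere_volume_def)

lemma emeasure_sphere_volume:
  fixes A :: "'a::euclidean_space set"
  assumes "A \<in> sets borel" "A \<subseteq> sphere 0 1"
  shows "emeasure sphere_volume A =
    of_nat DIM('a) * emeasure lborel {x \<in> cball 0 1 - {0}. sgn x \<in> A}"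
proof -
  let ?B = "cball 0 1 - {0::'a}"
  have "sgn \<in> borel_measurable (restrict_space borel ?B)"
    unfolding sgn_div_norm
    by (intro borel_measurable_continuous_on_restrict continuous_intros) auto
  then have "sgn \<in> measurable (restrict_space lborel ?B) (borel :: 'a measure)"
    by (simp cong: measurable_cong_sets add: sets_restrict_space)
  then have m: "sgn \<in> measurable (restrict_space lborel ?B) (restrict_space borel (sphere (0::'a) 1))"
    by (intro measurable_restrict_space2) (auto simp: space_restrict_space norm_sgn)
  have A: "A \<in> sets (restrict_space borel (sphere 0 1))"
    using assms by (subst sets_restrict_space_iff) auto
  have eq: "sgn -` A \<inter> ?B = {x \<in> ?B. sgn x \<in> A}"
    by blast
  have "emeasure (restrict_space lborel ?B) {x \<in> ?B. sgn x \<in> A} =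
      emeasure lborel {x \<in> ?B. sgn x \<in> A}"
    by (rule emeasure_restrict_space) auto
  then show ?thesis
    unfolding sphere_volume_def emeasure_scale_measure emeasure_distr[OF m A]
    by (simp only: space_restrict_space space_lborel space_borel eq Int_UNIV_right)
qed

lemma sphere_sq_integrable_add:
  assumes "sphere_sq_integrable f" "sphere_sq_integrable g"
  shows "sphere_sq_integrable (\<lambda>x. f x + g x)"
proof -
  have fg [measurable]: "f \<in> borel_measurable sphere_volume" "g \<in> borel_measurable sphere_volume"
    and i: "integrable sphere_volume (\<lambda>x. (norm (f x))\<^sup>2)"
      "integrable sphere_volume (\<lambda>x. (norm (g x))\<^sup>2)"
    using assms by (auto simp: sphere_sq_integrable_def)
  have "integrable sphere_volume (\<lambda>x. (norm (f x + g x))\<^sup>2)"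
  proof (rule Bochner_Integration.integrable_bound)
    show "integrable sphere_volume (\<lambda>x. 2 * (norm (f x))\<^sup>2 + 2 * (norm (g x))\<^sup>2)"
      using i by simp
    have "(norm (f x + g x))\<^sup>2 \<le> 2 * (norm (f x))\<^sup>2 + 2 * (norm (g x))\<^sup>2" for x
    proof -
      have "0 \<le> (norm (f x - g x))\<^sup>2" by simp
      then show ?thesis
        unfolding power2_norm_eq_inner by (simp add: inner_add inner_diff inner_commute)
    qed
    then show "AE x in sphere_volume. norm ((norm (f x + g x))\<^sup>2)
        \<le> norm (2 * (norm (f x))\<^sup>2 + 2 * (norm (g x))\<^sup>2)"
      by (intro AE_I2) (smt (verit) real_norm_def zero_le_power2)
  qed simp
  then show ?thesis by (simp add: sphere_sq_integrable_def)
qed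

lemma sphere_sq_integrable_scaleR:
  assumes "sphere_sq_integrable f"
  shows "sphere_sq_integrable (\<lambda>x. c *\<^sub>R f x)"
  using assms by (auto simp: sphere_sq_integrable_def power_mult_distrib)

lemma sphere_sq_integrable_uminus:
  assumes "sphere_sq_integrable f"
  shows "sphere_sq_integrable (\<lambda>x. - f x)"
  using sphere_sq_integrable_scaleR[OF assms, of "- 1"] by simp

lemma sphere_sq_integrable_diff:
  assumes "sphere_sq_integrable f" "sphere_sq_integrable g"
  shows "sphere_sq_integrable (\<lambda>x. f x - g x)"
  using sphere_sq_integrable_add[OF assms(1) sphere_sq_integrable_uminus[OF assms(2)]] by simp

lemma sphere_sq_integrable_zero: "sphere_sq_integrable (\<lambda>x. 0)"
  by (simp add: sphere_sq_integrable_def)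

lemma sphere_integrable_inner:
  assumes "sphere_sq_integrable f" "sphere_sq_integrable g"
  shows "integrable sphere_volume (\<lambda>x. f x \<bullet> g x)"
proof -
  have "integrable sphere_volume
      (\<lambda>x. ((norm (f x + g x))\<^sup>2 - (norm (f x))\<^sup>2 - (norm (g x))\<^sup>2) / 2)"
    using assms sphere_sq_integrable_add[OF assms] by (simp add: sphere_sq_integrable_def)
  moreover have "((norm (f x + g x))\<^sup>2 - (norm (f x))\<^sup>2 - (norm (g x))\<^sup>2) / 2 = f x \<bullet> g x" for x
    unfolding power2_norm_eq_inner by (simp add: inner_add inner_commute)
  ultimately show ?thesis by simp
qed

text \<open>Square integrable functions modulo equality almost everywhere.\<close>

quotient_type (overloaded) ('a, 'b) sphere_L2 =
  "'a::euclidean_space \<Rightarrow> 'b::euclidean_space" / partial: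
  "\<lambda>f g. sphere_sq_integrable f \<and> sphere_sq_integrable g \<and> (AE x in sphere_volume. f x = g x)"
  morphisms rep_sphere_L2 sphere_L2_of
proof (rule part_equivpI)
  show "\<exists>f::'a \<Rightarrow> 'b. sphere_sq_integrable f \<and> sphere_sq_integrable f \<and>
      (AE x in sphere_volume. f x = f x)"
    using sphere_sq_integrable_zero by auto
  show "symp (\<lambda>f g :: 'a \<Rightarrow> 'b. sphere_sq_integrable f \<and> sphere_sq_integrable g \<and>
      (AE x in sphere_volume. f x = g x))"
    by (auto simp: symp_def elim: AE_mp)
  show "transp (\<lambda>f g :: 'a \<Rightarrow> 'b. sphere_sq_integrable f \<and> sphere_sq_integrable g \<and>
      (AE x in sphere_volume. f x = g x))"
    by (auto simp: transp_def elim: AE_mp)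
qed

instantiation sphere_L2 :: (euclidean_space, euclidean_space) real_inner
begin

lift_definition zero_sphere_L2 :: "('a, 'b) sphere_L2" is "\<lambda>x. 0"
  by (simp add: sphere_sq_integrable_zero)

lift_definition plus_sphere_L2 :: "('a, 'b) sphere_L2 \<Rightarrow> ('a, 'b) sphere_L2 \<Rightarrow> ('a, 'b) sphere_L2"
  is "\<lambda>f g x. f x + g x"
  by (auto simp: sphere_sq_integrable_add)

lift_definition uminus_sphere_L2 :: "('a, 'b) sphere_L2 \<Rightarrow> ('a, 'b) sphere_L2"
  is "\<lambda>f x. - f x"
  by (auto simp: sphere_sq_integrable_uminus)

lift_definition minus_sphere_L2 :: "('a, 'b) sphere_L2 \<Rightarrow> ('a, 'b) sphere_L2 \<Rightarrow> ('a, 'b) sphere_L2"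
  is "\<lambda>f g x. f x - g x"
  by (auto simp: sphere_sq_integrable_diff)

lift_definition scaleR_sphere_L2 :: "real \<Rightarrow> ('a, 'b) sphere_L2 \<Rightarrow> ('a, 'b) sphere_L2"
  is "\<lambda>c f x. c *\<^sub>R f x"
  by (auto simp: sphere_sq_integrable_scaleR)

lift_definition inner_sphere_L2 :: "('a, 'b) sphere_L2 \<Rightarrow> ('a, 'b) sphere_L2 \<Rightarrow> real"
  is "\<lambda>f g. integral\<^sup>L sphere_volume (\<lambda>x. f x \<bullet> g x)"
proof goal_cases
  case (1 f f' g g')
  then have "integrable sphere_volume (\<lambda>x. f x \<bullet> g x)" "integrable sphere_volume (\<lambda>x. f' x \<bullet> g' x)"
    by (auto intro: sphere_integrable_inner)
  then show ?case
    using 1 by (intro integral_cong_AE) auto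
qed

definition norm_sphere_L2 :: "('a, 'b) sphere_L2 \<Rightarrow> real"
  where "norm_sphere_L2 f = sqrt (f \<bullet> f)"

definition sgn_sphere_L2 :: "('a, 'b) sphere_L2 \<Rightarrow> ('a, 'b) sphere_L2"
  where "sgn_sphere_L2 f = scaleR (inverse (norm f)) f"

definition dist_sphere_L2 :: "('a, 'b) sphere_L2 \<Rightarrow> ('a, 'b) sphere_L2 \<Rightarrow> real"
  where "dist_sphere_L2 f g = norm (f - g)"

definition uniformity_sphere_L2 :: "(('a, 'b) sphere_L2 \<times> ('a, 'b) sphere_L2) filter"
  where "uniformity_sphere_L2 = (INF e\<in>{0<..}. principal {(f, g). dist f g < e})"

definition open_sphere_L2 :: "('a, 'b) sphere_L2 set \<Rightarrow> bool"
  where "open_sphere_L2 U \<longleftrightarrow> (\<forall>x\<in>U. \<forall>\<^sub>F (x', y) in uniformity. x' = x \<longrightarrow> y \<in> U)"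

instance
proof
  fix f g h :: "('a, 'b) sphere_L2" and c d :: real and U :: "('a, 'b) sphere_L2 set"
  show "f + g + h = f + (g + h)"
    by transfer (auto simp: sphere_sq_integrable_add add.assoc)
  show "f + g = g + f"
    by transfer (auto simp: sphere_sq_integrable_add add.commute)
  show "0 + f = f"
    by transfer auto
  show "- f + f = 0"
    by transfer (auto simp: sphere_sq_integrable_zero)
  show "f - g = f + - g"
    by transfer (auto simp: sphere_sq_integrable_diff)
  show "c *\<^sub>R (f + g) = c *\<^sub>R f + c *\<^sub>R g"
    by transfer (auto simp: sphere_sq_integrable_add sphere_sq_integrable_scaleR scaleR_add_right)
  show "(c + d) *\<^sub>R f = c *\<^sub>R f + d *\<^sub>R f"
    by transfer (auto simp: sphere_sq_integrable_add sphere_sq_integrable_scaleR scaleR_add_left)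
  show "c *\<^sub>R d *\<^sub>R f = (c * d) *\<^sub>R f"
    by transfer (auto simp: sphere_sq_integrable_scaleR)
  show "1 *\<^sub>R f = f"
    by transfer auto
  show "sgn f = inverse (norm f) *\<^sub>R f"
    by (simp add: sgn_sphere_L2_def)
  show "dist f g = norm (f - g)"
    by (simp add: dist_sphere_L2_def)
  show "(uniformity :: (('a, 'b) sphere_L2 \<times> ('a, 'b) sphere_L2) filter) =
      (INF e\<in>{0<..}. principal {(f, g). dist f g < e})"
    by (simp add: uniformity_sphere_L2_def)
  show "open U \<longleftrightarrow> (\<forall>x\<in>U. \<forall>\<^sub>F (x', y) in uniformity. x' = x \<longrightarrow> y \<in> U)"
    by (simp add: open_sphere_L2_def)
  show "f \<bullet> g = g \<bullet> f"
    by transfer (simp add: inner_commute)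
  show "(f + g) \<bullet> h = f \<bullet> h + g \<bullet> h"
    by transfer (simp add: inner_add_left sphere_integrable_inner)
  show "c *\<^sub>R f \<bullet> g = c * (f \<bullet> g)"
    by transfer simp
  show "0 \<le> f \<bullet> f"
    by transfer (simp add: integral_nonneg_AE)
  show "f \<bullet> f = 0 \<longleftrightarrow> f = 0"
  proof (transfer, goal_cases)
    case (1 f)
    then have "integrable sphere_volume (\<lambda>x. f x \<bullet> f x)"
      by (auto intro: sphere_integrable_inner)
    then have "integral\<^sup>L sphere_volume (\<lambda>x. f x \<bullet> f x) = 0 \<longleftrightarrow>
        (AE x in sphere_volume. f x \<bullet> f x = 0)"
      by (intro integral_nonneg_eq_0_iff_AE) auto
    then show ?case
      using 1 by (auto simp: sphere_sq_integrable_zero)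
  qed
  show "norm f = sqrt (f \<bullet> f)"
    by (simp add: norm_sphere_L2_def)
qed

end


section \<open>Semigroups and their generators\<close>

definition contraction_semigroup :: "(real \<Rightarrow> 'h::real_normed_vector \<Rightarrow> 'h) \<Rightarrow> bool"
  where "contraction_semigroup T \<longleftrightarrow>
    (\<forall>t\<ge>0. bounded_linear (T t)) \<and>
    (\<forall>t\<ge>0. \<forall>u. norm (T t u) \<le> norm u) \<and>
    T 0 = id \<and>
    (\<forall>s\<ge>0. \<forall>t\<ge>0. T (s + t) = T s \<circ> T t) \<and>
    (\<forall>u. ((\<lambda>t. T t u) \<longlongrightarrow> u) (at_right 0))"

text \<open>Unbounded operators are represented by their graphs.\<close>

definition inf_generator :: "(real \<Rightarrow> 'h::real_normed_vector \<Rightarrow> 'h) \<Rightarrow> ('h \<times> 'h) set"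
  where "inf_generator T = {(u, w). ((\<lambda>t. (T t u - u) /\<^sub>R t) \<longlongrightarrow> w) (at_right 0)}"

definition generates_semigroup ::
  "('h::real_normed_vector \<times> 'h) set \<Rightarrow> (real \<Rightarrow> 'h \<Rightarrow> 'h) \<Rightarrow> bool"
  where "generates_semigroup A T \<longleftrightarrow> contraction_semigroup T \<and> inf_generator T = A"

text \<open>The value at time \<open>t \<ge> 0\<close> of the semigroup generated by \<open>A\<close>, i.e. the solution operator of
  \<open>u' = A u\<close>.  The description concerns a single time, because the values of a semigroup \<open>T\<close> at
  negative times are not determined by its generator.\<close>

definition semigroup_of :: "('h::real_normed_vector \<times> 'h) set \<Rightarrow> real \<Rightarrow> 'h \<Rightarrow> 'h"
  where "semigroup_of A t = (THE S. \<exists>T. generates_semigroup A T \<and> T t = S)"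

text \<open>The closure in \<open>L\<^sup>2\<close> of an operator given on smooth functions on the sphere.\<close>

definition L2_closure ::
  "(('a::euclidean_space \<Rightarrow> 'b::euclidean_space) \<Rightarrow> 'a \<Rightarrow> 'b)
    \<Rightarrow> (('a, 'b) sphere_L2 \<times> ('a, 'b) sphere_L2) set"
  where "L2_closure L = closure {(sphere_L2_of f, sphere_L2_of (L f)) | f. smooth_on_sphere f}"

definition generated_semigroup ::
  "(('a::euclidean_space \<Rightarrow> 'b::euclidean_space) \<Rightarrow> 'a \<Rightarrow> 'b)
    \<Rightarrow> real \<Rightarrow> ('a, 'b) sphere_L2 \<Rightarrow> ('a, 'b) sphere_L2"
  where "generated_semigroup L t = semigroup_of (L2_closure L) t"


section \<open>The vector fields on the seven-sphere\<close>

text \<open>The coordinates \<open>x\<^sub>0, \<dots>, x\<^sub>7\<close> are indexed by the elements \<open>0, \<dots>, 7\<close> of the type \<^typ>\<open>8\<close>.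
  The library function \<^const>\<open>vector\<close> is not used, since it starts counting at \<open>1\<close>.\<close>

definition of_coords :: "real list \<Rightarrow> real ^ 8"
  where "of_coords cs = (\<Sum>k<8. (cs ! k) *\<^sub>R axis (of_nat k) 1)"

definition X :: "nat \<Rightarrow> real ^ 8 \<Rightarrow> real ^ 8"
  where "X a x =
    (let x0 = x $ 0; x1 = x $ 1; x2 = x $ 2; x3 = x $ 3;
         x4 = x $ 4; x5 = x $ 5; x6 = x $ 6; x7 = x $ 7
     in of_coords
         ([[-x1,  x0, -x3,  x2, -x5,  x4, -x7,  x6],
           [-x2,  x3,  x0, -x1, -x6,  x7,  x4, -x5],
           [-x3, -x2,  x1,  x0,  x7,  x6, -x5, -x4],
           [-x4,  x5,  x6, -x7,  x0, -x1, -x2,  x3],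
           [-x5, -x4, -x7, -x6,  x1,  x0,  x3,  x2],
           [-x6,  x7, -x4,  x5,  x2, -x3,  x0, -x1],
           [-x7, -x6,  x5,  x4, -x3, -x2,  x1,  x0]] ! (a - 1)))"

definition X_sq :: "nat \<Rightarrow> (real ^ 8 \<Rightarrow> 'b::real_normed_vector) \<Rightarrow> real ^ 8 \<Rightarrow> 'b"
  where "X_sq a f = vf_app (X a) (vf_app (X a) f)"

definition sub_laplacian :: "(real ^ 8 \<Rightarrow> 'b::real_normed_vector) \<Rightarrow> real ^ 8 \<Rightarrow> 'b"
  where "sub_laplacian f x = (\<Sum>a = 2..7. X_sq a f x)"

end

theory Submission
  imports Defs
begin

text \<open>
  Write \<open>L\<close> for any of the four operators.  On smooth functions it is a sum of squares of frame fields,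
  for the Laplace--Beltrami operator because the gradient is \<open>\<Sum>\<^sub>a (X\<^sub>a f) X\<^sub>a\<close> and every \<open>X\<^sub>a\<close> is
  a skew-symmetric linear field.  The flow of \<open>X\<^sub>a\<close> consists of rotations, which preserve the volume,
  so \<open>X\<^sub>a\<close> is skew-symmetric in \<open>L\<^sup>2\<close>; it also preserves the finite dimensional spaces of polynomials
  of bounded degree.  Rotations preserve the Dirichlet form, hence \<open>X\<^sub>1\<close> commutes with the
  Laplace--Beltrami operator, and \<open>X\<^sub>1\<^sup>2\<close> commutes with \<open>\<Delta>\<^sub>s\<^sub>R\<close>.  Thus there is an orthonormal
  basis of \<open>L\<^sup>2\<close> consisting of polynomials that are joint eigenvectors of \<open>X\<^sub>1\<^sup>2\<close> and \<open>\<Delta>\<^sub>s\<^sub>R\<close>.  In this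
  basis all four closures are diagonal with nonpositive eigenvalues, all semigroups are diagonal,
  and the claim is the functional equation of the exponential.
\<close>

subsection \<open>Diagonal operators\<close>

text \<open>Distinct frame fields do not commute: their coefficient matrices anticommute, so
  brackets with \<open>X 1\<close> cannot be made to vanish term by term. Only the full sum of
  squares is rotation invariant; the sub-Laplacian inherits its commutation with the square of
  \<open>X 1\<close> by subtracting that square. The commutation is proved only after pairing with
  smooth functions in L2, which avoids third derivatives on the sphere.

  Polynomial spaces stand in for regularity theory and for the spectral theory of unbounded
  operators. They are finite dimensional, invariant under every frame field, and their union is
  dense, so eigenvectors come from maximizing a quadratic form. These eigenvectors are smooth and
  hence lie in the domain before closures are taken, which is why each closure is the maximal
  diagonal operator. Since \<open>semigroup_of\<close> is a definite description, uniqueness of the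
  semigroup has to be proved too; it is obtained on eigenvectors and extended by density.\<close>

locale total_orthonormal =
  fixes e :: "nat \<Rightarrow> 'h::{real_inner, banach}"
  assumes orthogonal: "i \<noteq> j \<Longrightarrow> e i \<bullet> e j = 0"
    and normalized: "e i = 0 \<or> norm (e i) = 1"
    and total: "(\<And>k. u \<bullet> e k = 0) \<Longrightarrow> u = 0"
begin

text \<open>For unbounded \<open>m\<close> the series may diverge, and \<open>suminf\<close> is then
  arbitrary. The operator is applied only with multipliers of absolute value at most 1: those of the
  semigroup and those of its difference quotient.\<close>

definition diag :: "(nat \<Rightarrow> real) \<Rightarrow> 'h \<Rightarrow> 'h"
  where "diag m u = (\<Sum>k. (m k * (u \<bullet> e k)) *\<^sub>R e k)"

text \<open>Both sides vanish when \<open>e k = 0\<close>. Zero entries are permitted so that a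
  countable orthonormal set can be enumerated with gaps in the index.\<close>

lemma inner_e: "u \<bullet> e k * (e k \<bullet> e k) = u \<bullet> e k"
  using normalized[of k] by (auto simp: dot_square_norm)

lemma coeffs_eqI: "(\<And>k. u \<bullet> e k = v \<bullet> e k) \<Longrightarrow> u = v"
  using total[of "u - v"] by (simp add: inner_diff_left)

lemma inner_sum_e:
  assumes "finite A"
  shows "(\<Sum>k\<in>A. (m k * (u \<bullet> e k)) *\<^sub>R e k) \<bullet> e j = (if j \<in> A then m j * (u \<bullet> e j) else 0)"
proof -
  have "(\<Sum>k\<in>A. (m k * (u \<bullet> e k)) *\<^sub>R e k) \<bullet> e j = (\<Sum>k\<in>A. if k = j then m j * (u \<bullet> e j) else 0)"
    unfolding inner_sum_left using inner_e orthogonal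
    by (intro sum.cong) auto
  then show ?thesis
    using assms by simp
qed

lemma norm_sum_e:
  assumes "finite A"
  shows "(norm (\<Sum>k\<in>A. (m k * (u \<bullet> e k)) *\<^sub>R e k))\<^sup>2 = (\<Sum>k\<in>A. (m k * (u \<bullet> e k))\<^sup>2)"
proof -
  have "(norm (\<Sum>k\<in>A. (m k * (u \<bullet> e k)) *\<^sub>R e k))\<^sup>2 =
      (\<Sum>j\<in>A. (m j * (u \<bullet> e j)) * ((\<Sum>k\<in>A. (m k * (u \<bullet> e k)) *\<^sub>R e k) \<bullet> e j))"
    unfolding power2_norm_eq_inner by (subst inner_sum_right) simp
  also have "\<dots> = (\<Sum>k\<in>A. (m k * (u \<bullet> e k))\<^sup>2)"
    using assms by (intro sum.cong) (simp_all add: inner_sum_e power2_eq_square)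
  finally show ?thesis .
qed

lemma Bessel:
  assumes "finite A"
  shows "(\<Sum>k\<in>A. (u \<bullet> e k)\<^sup>2) \<le> (norm u)\<^sup>2"
proof -
  let ?p = "\<Sum>k\<in>A. (1 * (u \<bullet> e k)) *\<^sub>R e k"
  have "u \<bullet> ?p = (\<Sum>k\<in>A. (u \<bullet> e k)\<^sup>2)"
    by (simp add: inner_sum_right power2_eq_square)
  moreover have "?p \<bullet> ?p = (\<Sum>k\<in>A. (u \<bullet> e k)\<^sup>2)"
    using norm_sum_e[OF assms, of "\<lambda>_. 1" u] by (simp only: power2_norm_eq_inner mult_1)
  moreover have "0 \<le> (u - ?p) \<bullet> (u - ?p)"
    by simp
  ultimately show ?thesis
    by (simp add: inner_diff_left inner_diff_right inner_commute power2_norm_eq_inner)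
qed

lemma summable_coeffs: "summable (\<lambda>k. (u \<bullet> e k)\<^sup>2)"
  by (rule bounded_imp_summable[of _ "(norm u)\<^sup>2"])
    (use Bessel[of "{..n}" u for n] in auto)

lemma mult_coeff_le:
  assumes "\<bar>m k\<bar> \<le> 1"
  shows "(m k * (u \<bullet> e k))\<^sup>2 \<le> (u \<bullet> e k)\<^sup>2"
proof -
  have "(m k)\<^sup>2 \<le> 1"
    using assms by (simp add: abs_square_le_1)
  then show ?thesis
    by (simp add: power_mult_distrib mult_left_le_one_le)
qed

text \<open>By orthogonality the squared norm of a block of the series is a sum of squares,
  dominated by the same block of the convergent Bessel series; completeness of the space does the
  rest.\<close>

lemma diag_summable:
  assumes "\<And>k. \<bar>m k\<bar> \<le> 1"
  shows "summable (\<lambda>k. (m k * (u \<bullet> e k)) *\<^sub>R e k)"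
proof (subst summable_Cauchy, intro allI impI)
  fix r :: real
  assume r: "0 < r"
  then have "0 < r\<^sup>2"
    by simp
  then obtain N where N: "norm (sum (\<lambda>k. (u \<bullet> e k)\<^sup>2) {i..<j}) < r\<^sup>2" if "N \<le> i" for i j
    using summable_coeffs[of u] unfolding summable_Cauchy by meson
  have "norm (\<Sum>k = i..<j. (m k * (u \<bullet> e k)) *\<^sub>R e k) < r" if "N \<le> i" for i j
  proof -
    have "(norm (\<Sum>k = i..<j. (m k * (u \<bullet> e k)) *\<^sub>R e k))\<^sup>2 \<le> sum (\<lambda>k. (u \<bullet> e k)\<^sup>2) {i..<j}"
      by (simp only: norm_sum_e finite_atLeastLessThan) (intro sum_mono mult_coeff_le assms)
    also have "\<dots> < r\<^sup>2"
      using N[OF that, of j] by simp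
    finally show ?thesis
      using r power_less_imp_less_base by fastforce
  qed
  then show "\<exists>N. \<forall>i\<ge>N. \<forall>j. norm (\<Sum>k = i..<j. (m k * (u \<bullet> e k)) *\<^sub>R e k) < r"
    by blast
qed

lemma diag_coeff:
  assumes "\<And>k. \<bar>m k\<bar> \<le> 1"
  shows "diag m u \<bullet> e j = m j * (u \<bullet> e j)"
proof -
  have "(\<lambda>n. (\<Sum>k<n. (m k * (u \<bullet> e k)) *\<^sub>R e k) \<bullet> e j) \<longlonglongrightarrow> diag m u \<bullet> e j"
    unfolding diag_def by (intro tendsto_inner summable_LIMSEQ diag_summable assms tendsto_const)
  moreover have "(\<lambda>n. (\<Sum>k<n. (m k * (u \<bullet> e k)) *\<^sub>R e k) \<bullet> e j) \<longlonglongrightarrow> m j * (u \<bullet> e j)"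
    by (rule tendsto_eventually)
      (auto simp: eventually_sequentially inner_sum_e intro!: exI[of _ "Suc j"])
  ultimately show ?thesis
    by (rule LIMSEQ_unique)
qed

lemma diag_one: "diag (\<lambda>_. 1) u = u"
  by (rule coeffs_eqI) (simp add: diag_coeff)

lemma expansion: "(\<lambda>n. \<Sum>k<n. (u \<bullet> e k) *\<^sub>R e k) \<longlonglongrightarrow> u"
  using summable_LIMSEQ[OF diag_summable[of "\<lambda>_. 1" u]] diag_one[of u]
  by (simp add: diag_def)

lemma norm_diag_le:
  assumes "\<And>k. \<bar>m k\<bar> \<le> 1"
  shows "norm (diag m u) \<le> norm u"
proof (rule Lim_bounded)
  show "(\<lambda>n. norm (\<Sum>k<n. (m k * (u \<bullet> e k)) *\<^sub>R e k)) \<longlonglongrightarrow> norm (diag m u)"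
    unfolding diag_def by (intro tendsto_norm summable_LIMSEQ diag_summable assms)
  show "\<forall>n\<ge>0. norm (\<Sum>k<n. (m k * (u \<bullet> e k)) *\<^sub>R e k) \<le> norm u"
  proof (intro allI impI)
    fix n
    have "(norm (\<Sum>k<n. (m k * (u \<bullet> e k)) *\<^sub>R e k))\<^sup>2 \<le> (\<Sum>k<n. (u \<bullet> e k)\<^sup>2)"
      by (simp only: norm_sum_e finite_lessThan) (intro sum_mono mult_coeff_le assms)
    also have "\<dots> \<le> (norm u)\<^sup>2"
      by (rule Bessel) simp
    finally show "norm (\<Sum>k<n. (m k * (u \<bullet> e k)) *\<^sub>R e k) \<le> norm u"
      by (rule power2_le_imp_le) simp
  qed
qed

lemma linear_diag:
  assumes "\<And>k. \<bar>m k\<bar> \<le> 1"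
  shows "linear (diag m)"
  by (rule linearI; rule coeffs_eqI)
    (simp_all add: diag_coeff assms inner_add_left algebra_simps)

lemma bounded_linear_diag:
  assumes "\<And>k. \<bar>m k\<bar> \<le> 1"
  shows "bounded_linear (diag m)"
  by (rule bounded_linear_intro[of _ 1])
    (simp_all add: linear_add[OF linear_diag[OF assms]] linear_scale[OF linear_diag[OF assms]]
      norm_diag_le[OF assms])

text \<open>A dominated convergence theorem for diagonal operators: the uniform bound controls the
  tail of the expansion of \<open>u\<close>, and on a finite partial sum convergence of each
  multiplier is enough.\<close>

lemma diag_tendsto:
  assumes lim: "\<And>k. ((\<lambda>t. m t k) \<longlongrightarrow> 1) F"
    and bound: "\<forall>\<^sub>F t in F. \<forall>k. \<bar>m t k\<bar> \<le> 1"
  shows "((\<lambda>t. diag (m t) u) \<longlongrightarrow> u) F"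
proof (rule tendstoI)
  fix r :: real
  assume r: "0 < r"
  \<comment> \<open>One third of \<open>r\<close> pays for \<open>u - v\<close>, one third for its
    image under the contraction, and one third for the finite sum \<open>v\<close>.\<close>
  then have "\<forall>\<^sub>F n in sequentially. dist (\<Sum>k<n. (u \<bullet> e k) *\<^sub>R e k) u < r / 3"
    using expansion[of u] by (intro tendstoD) auto
  then obtain n where n: "dist (\<Sum>k<n. (u \<bullet> e k) *\<^sub>R e k) u < r / 3"
    using eventually_happens' trivial_limit_sequentially by blast
  define v where "v = (\<Sum>k<n. (u \<bullet> e k) *\<^sub>R e k)"
  have v: "v \<bullet> e j = (if j < n then u \<bullet> e j else 0)" for j
    using inner_sum_e[of "{..<n}" "\<lambda>_. 1" u j] by (simp add: v_def)
  have uv: "norm (u - v) < r / 3"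
    using n by (simp add: v_def dist_norm norm_minus_commute)
  have dv: "diag m v = (\<Sum>k<n. (m k * (u \<bullet> e k)) *\<^sub>R e k)" if "\<And>k. \<bar>m k\<bar> \<le> 1" for m
    by (rule coeffs_eqI) (simp add: inner_sum_e diag_coeff that v)
  have "((\<lambda>t. \<Sum>k<n. (m t k * (u \<bullet> e k)) *\<^sub>R e k) \<longlongrightarrow> (\<Sum>k<n. (1 * (u \<bullet> e k)) *\<^sub>R e k)) F"
    by (intro tendsto_intros lim)
  then have "\<forall>\<^sub>F t in F. dist (\<Sum>k<n. (m t k * (u \<bullet> e k)) *\<^sub>R e k) v < r / 3"
    using r unfolding v_def by (intro tendstoD) auto
  with bound show "\<forall>\<^sub>F t in F. dist (diag (m t) u) u < r"
  proof eventually_elim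
    case (elim t)
    have "diag (m t) u - u = diag (m t) (u - v) + (diag (m t) v - v) - (u - v)"
      using linear_diff[OF linear_diag] elim(1) by (simp add: algebra_simps)
    then have "norm (diag (m t) u - u) \<le> norm (diag (m t) (u - v)) + norm (diag (m t) v - v) + norm (u - v)"
      by (metis norm_triangle_ineq norm_triangle_ineq4 add_right_mono order_trans)
    moreover have "norm (diag (m t) (u - v)) \<le> norm (u - v)"
      using elim(1) by (intro norm_diag_le) auto
    moreover have "norm (diag (m t) v - v) < r / 3"
      using elim by (simp add: dv dist_norm)
    ultimately show ?case
      using uv by (simp add: dist_norm)
  qed
qed

end


subsection \<open>Uniqueness of semigroups\<close>

text \<open>The generator controls the orbit only to first order at time 0. Cutting the time
  \<open>t\<close> into n equal steps turns this into a telescoping sum of n defects, each of order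
  o(1/n), and contractivity keeps the defects from growing.\<close>

lemma semigroup_eigenvector:
  fixes S :: "real \<Rightarrow> 'h::real_normed_vector \<Rightarrow> 'h"
  assumes S: "contraction_semigroup S" and v: "(v, - l *\<^sub>R v) \<in> inf_generator S" and t: "0 \<le> t"
  shows "S t v = exp (- l * t) *\<^sub>R v"
proof (cases "t = 0")
  case True
  then show ?thesis
    using S by (simp add: contraction_semigroup_def)
next
  case False
  then have t: "0 < t"
    using t by simp
  have lin: "linear (S s)" if "0 \<le> s" for s
    using S that by (auto simp: contraction_semigroup_def intro: bounded_linear.linear)
  \<comment> \<open>The defect of a single step of length \<open>h\<close>; it would vanish if
    \<open>S h v\<close> were already the exponential.\<close>
  define d where "d h = exp (l * h) *\<^sub>R S h v - v" for h
  have tel: "exp (l * (real n * h)) *\<^sub>R S (real n * h) v - v =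
      (\<Sum>k<n. exp (l * (real k * h)) *\<^sub>R S (real k * h) (d h))" if h: "0 \<le> h" for n h
  proof (induction n)
    case 0
    then show ?case
      using S by (simp add: contraction_semigroup_def)
  next
    case (Suc n)
    have "S (real (Suc n) * h) v = S (real n * h) (S h v)"
    proof -
      have "S (real n * h + h) = S (real n * h) \<circ> S h"
        using S h by (simp add: contraction_semigroup_def)
      moreover have "real (Suc n) * h = real n * h + h"
        by (simp add: algebra_simps)
      ultimately show ?thesis
        by simp
    qed
    moreover have "exp (l * (real (Suc n) * h)) = exp (l * (real n * h)) * exp (l * h)"
      by (simp add: exp_add[symmetric] algebra_simps)
    ultimately have "exp (l * (real (Suc n) * h)) *\<^sub>R S (real (Suc n) * h) v =
        exp (l * (real n * h)) *\<^sub>R S (real n * h) (d h) + exp (l * (real n * h)) *\<^sub>R S (real n * h) v"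
      using h by (simp add: d_def linear_diff[OF lin] linear_scale[OF lin] algebra_simps)
    then show ?case
      using Suc.IH by (simp add: algebra_simps)
  qed
  have gen: "((\<lambda>h. (S h v - v) /\<^sub>R h) \<longlongrightarrow> - l *\<^sub>R v) (at_right 0)"
    using v by (simp add: inf_generator_def)
  have e: "((\<lambda>h. (exp (l * h) - 1) / h) \<longlongrightarrow> l) (at_right 0)"
  proof -
    have "((\<lambda>h. exp (l * h)) has_real_derivative l) (at 0)"
      by (auto intro!: derivative_eq_intros)
    then have "((\<lambda>h. (exp (l * h) - 1) / h) \<longlongrightarrow> l) (at 0)"
      by (simp add: has_field_derivative_iff)
    then show ?thesis
      by (rule filterlim_mono) (auto simp: at_within_le_at)
  qed
  have "((\<lambda>h. exp (l * h) *\<^sub>R ((S h v - v) /\<^sub>R h) + ((exp (l * h) - 1) / h) *\<^sub>R v) \<longlongrightarrow>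
      exp (l * 0) *\<^sub>R (- l *\<^sub>R v) + l *\<^sub>R v) (at_right 0)"
    by (intro tendsto_intros gen e)
  then have "((\<lambda>h. d h /\<^sub>R h) \<longlongrightarrow> 0) (at_right 0)"
    by (simp add: d_def divide_inverse algebra_simps)
  then have dh: "((\<lambda>h. norm (d h) / h) \<longlongrightarrow> 0) (at_right 0)"
    by (rule Lim_transform_eventually[OF tendsto_norm_zero], intro eventually_at_rightI[of 0 1])
      (auto simp: divide_inverse mult.commute)
  have "((\<lambda>n. t / real (Suc n)) \<longlongrightarrow> 0) sequentially"
    by (intro LIMSEQ_Suc[OF lim_const_over_n])
  then have "filterlim (\<lambda>n. t / real (Suc n)) (at_right 0) sequentially"
    using t by (auto simp: filterlim_at)
  from filterlim_compose[OF dh this]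
  have "(\<lambda>n. exp (\<bar>l\<bar> * t) * t * (norm (d (t / real (Suc n))) / (t / real (Suc n)))) \<longlonglongrightarrow> exp (\<bar>l\<bar> * t) * t * 0"
    by (intro tendsto_mult tendsto_const)
  then have lim: "(\<lambda>n. exp (\<bar>l\<bar> * t) * t * (norm (d (t / real (Suc n))) / (t / real (Suc n)))) \<longlonglongrightarrow> 0"
    by simp
  have bound: "norm (exp (l * t) *\<^sub>R S t v - v) \<le> exp (\<bar>l\<bar> * t) * t * (norm (d (t / real (Suc n))) / (t / real (Suc n)))" for n
  proof -
    define h where "h = t / real (Suc n)"
    have h: "0 \<le> h" "real (Suc n) * h = t"
      using t by (simp_all add: h_def)
    have "norm (exp (l * t) *\<^sub>R S t v - v) \<le> (\<Sum>k<Suc n. norm (exp (l * (real k * h)) *\<^sub>R S (real k * h) (d h)))"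
      using tel[OF h(1), of "Suc n"] unfolding h(2) by (simp only: norm_sum)
    also have "\<dots> \<le> (\<Sum>k<Suc n. exp (\<bar>l\<bar> * t) * norm (d h))"
    proof (rule sum_mono)
      fix k assume "k \<in> {..<Suc n}"
      then have k: "real k * h \<le> t" "0 \<le> real k * h"
        using h by (auto simp flip: h(2) intro!: mult_right_mono)
      \<comment> \<open>The sign of \<open>l\<close> is not known here, so the exponential weights
        are bounded through the absolute value.\<close>
      then have "l * (real k * h) \<le> \<bar>l\<bar> * t"
        by (intro mult_mono) auto
      moreover have "norm (S (real k * h) (d h)) \<le> norm (d h)"
        using S k by (simp add: contraction_semigroup_def)
      ultimately show "norm (exp (l * (real k * h)) *\<^sub>R S (real k * h) (d h)) \<le> exp (\<bar>l\<bar> * t) * norm (d h)"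
        by (simp add: mult_mono)
    qed
    also have "\<dots> = exp (\<bar>l\<bar> * t) * t * (norm (d h) / h)"
      using t by (simp add: h_def field_simps)
    finally show ?thesis
      by (simp add: h_def)
  qed
  have "norm (exp (l * t) *\<^sub>R S t v - v) \<le> 0"
    using lim by (rule LIMSEQ_le_const) (use bound in auto)
  then have "exp (l * t) *\<^sub>R S t v = v"
    by simp
  then have "exp (- l * t) *\<^sub>R v = (exp (- l * t) * exp (l * t)) *\<^sub>R S t v"
    by (metis scaleR_scaleR)
  then show ?thesis
    by (simp add: exp_add[symmetric])
qed


subsection \<open>Diagonal semigroups\<close>

locale diagonal_generator = total_orthonormal e for e :: "nat \<Rightarrow> 'h::{real_inner, banach}" +
  fixes l :: "nat \<Rightarrow> real"
  assumes l_nonneg: "0 \<le> l k"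
begin

text \<open>The maximal diagonal operator with eigenvalues \<open>- l k\<close>. The domain
  condition is implicit: a vector \<open>w\<close> with the prescribed coefficients must exist in
  the space.\<close>

definition gen :: "('h \<times> 'h) set"
  where "gen = {(u, w). \<forall>k. w \<bullet> e k = - l k * (u \<bullet> e k)}"

definition sg :: "real \<Rightarrow> 'h \<Rightarrow> 'h"
  where "sg t = diag (\<lambda>k. exp (- l k * t))"

lemma multiplier_le: "0 \<le> t \<Longrightarrow> \<bar>exp (- l k * t)\<bar> \<le> 1"
  using l_nonneg[of k] by simp

lemma sg_coeff: "0 \<le> t \<Longrightarrow> sg t u \<bullet> e k = exp (- l k * t) * (u \<bullet> e k)"
  unfolding sg_def by (rule diag_coeff[OF multiplier_le])

lemma contraction_semigroup_sg: "contraction_semigroup sg"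
  unfolding contraction_semigroup_def
proof (intro conjI allI impI)
  show "bounded_linear (sg t)" if "0 \<le> t" for t
    unfolding sg_def by (rule bounded_linear_diag[OF multiplier_le[OF that]])
  show "norm (sg t u) \<le> norm u" if "0 \<le> t" for t u
    unfolding sg_def by (rule norm_diag_le[OF multiplier_le[OF that]])
  show "sg 0 = id"
    by (auto simp: sg_def diag_one)
  show "sg (s + t) = sg s \<circ> sg t" if "0 \<le> s" "0 \<le> t" for s t
    using that by (intro ext coeffs_eqI) (simp add: sg_coeff distrib_left exp_add exp_diff exp_minus field_simps)
  show "((\<lambda>t. sg t u) \<longlongrightarrow> u) (at_right 0)" for u
    unfolding sg_def
  proof (rule diag_tendsto)
    show "((\<lambda>t. exp (- l k * t)) \<longlongrightarrow> 1) (at_right 0)" for k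
      by (auto intro!: tendsto_eq_intros)
    show "\<forall>\<^sub>F t in at_right 0. \<forall>k. \<bar>exp (- l k * t)\<bar> \<le> 1"
      by (rule eventually_at_rightI[of 0 1]) (use multiplier_le in auto)
  qed
qed

text \<open>The difference quotient of the semigroup at \<open>u\<close> is a diagonal operator applied to
  the candidate for the derivative, with multipliers that stay in the unit interval.\<close>

lemma inf_generator_sg: "inf_generator sg = gen"
proof (intro set_eqI iffI; clarify)
  fix u w
  assume "(u, w) \<in> inf_generator sg"
  then have *: "((\<lambda>t. (sg t u - u) /\<^sub>R t) \<longlongrightarrow> w) (at_right 0)"
    by (simp add: inf_generator_def)
  have "w \<bullet> e k = - l k * (u \<bullet> e k)" for k
  proof (rule tendsto_unique[OF trivial_limit_at_right_real])
    show "((\<lambda>t. ((sg t u - u) /\<^sub>R t) \<bullet> e k) \<longlongrightarrow> w \<bullet> e k) (at_right 0)"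
      by (intro tendsto_intros *)
    have "((\<lambda>t. exp (- l k * t)) has_real_derivative - l k) (at 0)"
      by (auto intro!: derivative_eq_intros)
    then have "((\<lambda>t. (exp (- l k * t) - 1) / t) \<longlongrightarrow> - l k) (at_right 0)"
      by (simp add: has_field_derivative_iff filterlim_at_split)
    then have "((\<lambda>t. (exp (- l k * t) - 1) / t * (u \<bullet> e k)) \<longlongrightarrow> - l k * (u \<bullet> e k)) (at_right 0)"
      by (intro tendsto_intros)
    then show "((\<lambda>t. ((sg t u - u) /\<^sub>R t) \<bullet> e k) \<longlongrightarrow> - l k * (u \<bullet> e k)) (at_right 0)"
      by (rule Lim_transform_eventually, intro eventually_at_rightI[of 0 1])
        (auto simp: sg_coeff inner_diff_left field_simps)
  qed
  then show "(u, w) \<in> gen"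
    by (simp add: gen_def)
next
  fix u w
  assume "(u, w) \<in> gen"
  then have w: "w \<bullet> e k = - l k * (u \<bullet> e k)" for k
    by (simp add: gen_def)
  \<comment> \<open>Chosen so that the difference quotient of \<open>sg\<close> at \<open>u\<close>
    is \<open>diag (m t) w\<close>. Where \<open>l k = 0\<close> the quotient is replaced by its
    limit 1; the coefficient of \<open>w\<close> vanishes there.\<close>
  define m where "m t k = (if l k = 0 then 1 else (1 - exp (- l k * t)) / (l k * t))" for t k
  have m_le: "\<bar>m t k\<bar> \<le> 1" if "0 < t" for t k
  proof (cases "l k = 0")
    case False
    then have "0 < l k * t"
      using l_nonneg[of k] that by simp
    moreover have "1 - exp (- l k * t) \<le> l k * t"
      using exp_ge_add_one_self[of "- l k * t"] by simp
    ultimately show ?thesis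
      using False that by (simp add: m_def)
  qed (simp add: m_def)
  have "((\<lambda>t. diag (m t) w) \<longlongrightarrow> w) (at_right 0)"
  proof (rule diag_tendsto)
    show "\<forall>\<^sub>F t in at_right 0. \<forall>k. \<bar>m t k\<bar> \<le> 1"
      by (rule eventually_at_rightI[of 0 1]) (use m_le in auto)
    show "((\<lambda>t. m t k) \<longlongrightarrow> 1) (at_right 0)" for k
    proof (cases "l k = 0")
      case False
      have "((\<lambda>t. exp (- l k * t)) has_real_derivative - l k) (at 0)"
        by (auto intro!: derivative_eq_intros)
      then have "((\<lambda>t. (exp (- l k * t) - 1) / t) \<longlongrightarrow> - l k) (at_right 0)"
        by (simp add: has_field_derivative_iff filterlim_at_split)
      then have "((\<lambda>t. - (1 / l k) * ((exp (- l k * t) - 1) / t)) \<longlongrightarrow> - (1 / l k) * - l k) (at_right 0)"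
        by (intro tendsto_intros)
      moreover have "m t k = - (1 / l k) * ((exp (- l k * t) - 1) / t)" for t
        using False by (cases "t = 0") (simp_all add: m_def field_simps)
      ultimately show ?thesis
        using False by simp
    qed (simp add: m_def)
  qed
  then have "((\<lambda>t. (sg t u - u) /\<^sub>R t) \<longlongrightarrow> w) (at_right 0)"
  proof (rule Lim_transform_eventually, intro eventually_at_rightI[of 0 1])
    fix t :: real
    assume "t \<in> {0<..<1}"
    then have t: "0 < t"
      by simp
    show "diag (m t) w = (sg t u - u) /\<^sub>R t"
      using t by (intro coeffs_eqI)
        (auto simp: diag_coeff[OF m_le[OF t]] w sg_coeff inner_diff_left m_def field_simps)
  qed simp
  then show "(u, w) \<in> inf_generator sg"
    by (simp add: inf_generator_def)
qed

lemma generates_sg: "generates_semigroup gen sg"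
  by (simp add: generates_semigroup_def contraction_semigroup_sg inf_generator_sg)

lemma e_in_gen: "(e k, - l k *\<^sub>R e k) \<in> gen"
proof -
  have "(- l k *\<^sub>R e k) \<bullet> e j = - l j * (e k \<bullet> e j)" for j
    using orthogonal[of k j] by (cases "j = k") auto
  then show ?thesis
    by (simp add: gen_def)
qed

text \<open>Every vector \<open>e k\<close> lies in the domain of the generator and is an
  eigenvector, so both semigroups act on it by the same exponential; bounded operators that agree on
  the partial sums of the expansions agree everywhere.\<close>

lemma generates_unique:
  assumes S: "generates_semigroup gen S" and t: "0 \<le> t"
  shows "S t = sg t"
proof
  fix u
  have bl: "bounded_linear (S t)" "bounded_linear (sg t)"
    using S contraction_semigroup_sg t by (auto simp: generates_semigroup_def contraction_semigroup_def)
  have e: "R t (e k) = exp (- l k * t) *\<^sub>R e k" if "generates_semigroup gen R" for R k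
    using that t e_in_gen[of k] by (intro semigroup_eigenvector) (auto simp: generates_semigroup_def)
  have R: "(\<lambda>n. R t (\<Sum>k<n. (u \<bullet> e k) *\<^sub>R e k)) = (\<lambda>n. \<Sum>k<n. (u \<bullet> e k) *\<^sub>R (exp (- l k * t) *\<^sub>R e k))"
    if "generates_semigroup gen R" for R
  proof -
    have "linear (R t)"
      using that t by (auto simp: generates_semigroup_def contraction_semigroup_def intro: bounded_linear.linear)
    then show ?thesis
      by (simp add: linear_sum linear_scale e[OF that])
  qed
  have "(\<lambda>n. S t (\<Sum>k<n. (u \<bullet> e k) *\<^sub>R e k)) = (\<lambda>n. sg t (\<Sum>k<n. (u \<bullet> e k) *\<^sub>R e k))"
    unfolding R[OF S] R[OF generates_sg] by (rule refl)
  moreover have "(\<lambda>n. S t (\<Sum>k<n. (u \<bullet> e k) *\<^sub>R e k)) \<longlonglongrightarrow> S t u"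
    by (intro bounded_linear.tendsto[OF bl(1)] expansion)
  moreover have "(\<lambda>n. sg t (\<Sum>k<n. (u \<bullet> e k) *\<^sub>R e k)) \<longlonglongrightarrow> sg t u"
    by (intro bounded_linear.tendsto[OF bl(2)] expansion)
  ultimately show "S t u = sg t u"
    by (auto intro: LIMSEQ_unique)
qed

lemma semigroup_of_gen: "0 \<le> t \<Longrightarrow> semigroup_of gen t = sg t"
  unfolding semigroup_of_def
proof (rule the_equality)
  show "\<exists>T. generates_semigroup gen T \<and> T t = sg t"
    using generates_sg by blast
  show "S = sg t" if "0 \<le> t" "\<exists>T. generates_semigroup gen T \<and> T t = S" for S
    using that generates_unique by blast
qed

text \<open>\<open>semigroup_of gen\<close> and \<open>sg\<close> are known to agree only for
  nonnegative times. That suffices, since the generator and strong continuity look only at a right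
  neighbourhood of 0.\<close>

lemma generates_semigroup_of: "generates_semigroup gen (semigroup_of gen)"
proof -
  have "inf_generator (semigroup_of gen) = inf_generator sg"
  proof -
    have "((\<lambda>t. (semigroup_of gen t u - u) /\<^sub>R t) \<longlongrightarrow> w) (at_right 0) \<longleftrightarrow>
        ((\<lambda>t. (sg t u - u) /\<^sub>R t) \<longlongrightarrow> w) (at_right 0)" for u w
      by (rule filterlim_cong[OF refl refl], rule eventually_at_rightI[of 0 1])
        (auto simp: semigroup_of_gen)
    then show ?thesis
      by (simp add: inf_generator_def)
  qed
  moreover have "((\<lambda>t. semigroup_of gen t u) \<longlongrightarrow> u) (at_right 0) \<longleftrightarrow> ((\<lambda>t. sg t u) \<longlongrightarrow> u) (at_right 0)" for u
    by (rule filterlim_cong[OF refl refl], rule eventually_at_rightI[of 0 1])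
      (auto simp: semigroup_of_gen)
  ultimately show ?thesis
    using generates_sg
    unfolding generates_semigroup_def contraction_semigroup_def by (auto simp: semigroup_of_gen)
qed

lemma closed_gen: "closed gen"
proof -
  have "gen = (\<Inter>k. {p. snd p \<bullet> e k = - l k * (fst p \<bullet> e k)})"
    by (auto simp: gen_def)
  then show ?thesis
    by (auto intro!: closed_INT closed_Collect_eq continuous_intros)
qed

text \<open>The eigenvectors span a core: the expansions of \<open>u\<close> and \<open>w\<close>
  converge simultaneously, and because their coefficients differ by the factor \<open>- l k\<close>,
  each pair of partial sums is a linear combination of eigenpairs in \<open>G\<close>.\<close>

lemma closure_eq_gen:
  assumes G: "subspace G" and eG: "\<And>k. (e k, - l k *\<^sub>R e k) \<in> G" and sub: "G \<subseteq> gen"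
  shows "closure G = gen"
proof
  show "closure G \<subseteq> gen"
    using sub closed_gen by (rule closure_minimal)
  show "gen \<subseteq> closure G"
  proof clarify
    fix u w
    assume "(u, w) \<in> gen"
    then have w: "w \<bullet> e k = - l k * (u \<bullet> e k)" for k
      by (simp add: gen_def)
    have eq: "(\<Sum>k<n. (u \<bullet> e k) *\<^sub>R e k, \<Sum>k<n. (w \<bullet> e k) *\<^sub>R e k) =
        (\<Sum>k<n. (u \<bullet> e k) *\<^sub>R (e k, - l k *\<^sub>R e k))" for n
      by (simp add: sum_prod w mult.commute)
    have "(\<Sum>k<n. (u \<bullet> e k) *\<^sub>R e k, \<Sum>k<n. (w \<bullet> e k) *\<^sub>R e k) \<in> G" for n
      unfolding eq by (intro subspace_sum[OF G] subspace_scale[OF G] eG)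
    moreover have "(\<lambda>n. (\<Sum>k<n. (u \<bullet> e k) *\<^sub>R e k, \<Sum>k<n. (w \<bullet> e k) *\<^sub>R e k)) \<longlonglongrightarrow> (u, w)"
      by (intro tendsto_Pair expansion)
    ultimately show "(u, w) \<in> closure G"
      unfolding closure_sequential by (intro exI[of _ "\<lambda>n. (\<Sum>k<n. (u \<bullet> e k) *\<^sub>R e k, \<Sum>k<n. (w \<bullet> e k) *\<^sub>R e k)"] conjI allI)
  qed
qed

end


subsection \<open>Joint eigenvectors of commuting symmetric operators\<close>

text \<open>Linearity is required on \<open>W\<close> only, because the operators in question are
  arbitrary outside the classes of smooth functions.\<close>

definition symmetric_on :: "'h::real_inner set \<Rightarrow> ('h \<Rightarrow> 'h) \<Rightarrow> bool"
  where "symmetric_on W f \<longleftrightarrow>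
    (\<forall>x\<in>W. f x \<in> W) \<and> (\<forall>x\<in>W. \<forall>y\<in>W. f (x + y) = f x + f y) \<and>
    (\<forall>x\<in>W. \<forall>c. f (c *\<^sub>R x) = c *\<^sub>R f x) \<and> (\<forall>x\<in>W. \<forall>y\<in>W. f x \<bullet> y = x \<bullet> f y)"

definition orthonormal :: "'h::real_inner set \<Rightarrow> bool"
  where "orthonormal B \<longleftrightarrow> pairwise orthogonal B \<and> (\<forall>b\<in>B. norm b = 1)"

section \<open>Finite orthonormal sets and the subspaces they span\<close>

lemma orthonormal_sum_inner:
  assumes "orthonormal B" "finite B" "b \<in> B"
  shows "(\<Sum>c\<in>B. a c *\<^sub>R c) \<bullet> b = a b"
proof -
  have "(\<Sum>c\<in>B. a c *\<^sub>R c) \<bullet> b = (\<Sum>c\<in>B. if c = b then a b else 0)"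
    unfolding inner_sum_left
  proof (rule sum.cong[OF refl])
    fix c assume "c \<in> B"
    then show "(a c *\<^sub>R c) \<bullet> b = (if c = b then a b else 0)"
      using assms by (auto simp: orthonormal_def pairwise_def orthogonal_def dot_square_norm)
  qed
  then show ?thesis
    using assms by simp
qed

lemma orthonormal_expansion:
  assumes "orthonormal B" "finite B" "w \<in> span B"
  shows "w = (\<Sum>c\<in>B. (w \<bullet> c) *\<^sub>R c)"
  using orthonormal_basis_expand[of B w] assms by (simp add: orthonormal_def)

lemma orthonormal_independent: "orthonormal B \<Longrightarrow> independent B"
  unfolding orthonormal_def by (intro pairwise_orthogonal_independent) auto

lemma orthonormal_basis_of_subspace:
  fixes W :: "'h::real_inner set"
  assumes W: "subspace W" and S: "finite S" "W \<subseteq> span S"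
  obtains C where "finite C" "orthonormal C" "span C = W"
proof -
  obtain B where B: "B \<subseteq> W" "independent B" "W \<subseteq> span B"
    using maximal_independent_subset .
  then have "finite B"
    using independent_span_bound[OF S(1)] S by blast
  then obtain C where C: "finite C" "span C = span B" "pairwise orthogonal C"
    using basis_orthogonal by blast
  have CW: "span C = W"
    using B C W by (metis span_minimal subset_antisym)
  \<comment> \<open>The orthogonal set may contain the zero vector, which is dropped before
    normalizing.\<close>
  define D where "D = (\<lambda>c. c /\<^sub>R norm c) ` (C - {0})"
  have "orthonormal D"
    using C(3) by (auto simp: orthonormal_def D_def pairwise_def orthogonal_def)
  moreover have "span D = span C"
  proof
    show "span D \<subseteq> span C"
      by (rule span_minimal) (auto simp: D_def intro: span_scale span_base)
    have "c \<in> span D" if "c \<in> C" for c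
    proof (cases "c = 0")
      case False
      then have "c /\<^sub>R norm c \<in> span D"
        using that by (auto simp: D_def intro: span_base)
      from span_scale[OF this, of "norm c"] False show ?thesis
        by simp
    qed (simp add: span_zero)
    then show "span C \<subseteq> span D"
      by (intro span_minimal) auto
  qed
  ultimately show ?thesis
    using that[of D] C CW by (simp add: D_def)
qed

text \<open>In an infinite dimensional space closed bounded sets need not be compact. Here
  compactness comes from the coefficient cube, of which this set is a continuous image, one
  coordinate at a time.\<close>

lemma compact_coefficient_box:
  fixes C :: "'h::real_normed_vector set"
  assumes "finite C"
  shows "compact {\<Sum>c\<in>C. a c *\<^sub>R c | a. \<forall>c\<in>C. \<bar>a c\<bar> \<le> (1::real)}"
  using assms
proof (induction C)
  case empty
  then show ?case
    by simp
next
  case (insert c C)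
  let ?K = "\<lambda>C. {\<Sum>c\<in>C. a c *\<^sub>R c | a. \<forall>c\<in>C. \<bar>a c\<bar> \<le> (1::real)}"
  have "?K (insert c C) = (\<lambda>(t, v). t *\<^sub>R c + v) ` ({-1..1} \<times> ?K C)"
  proof (intro equalityI subsetI)
    fix x assume "x \<in> ?K (insert c C)"
    then obtain a where a: "\<forall>d\<in>insert c C. \<bar>a d\<bar> \<le> 1" "x = (\<Sum>d\<in>insert c C. a d *\<^sub>R d)"
      by blast
    then have "x = (\<lambda>(t, v). t *\<^sub>R c + v) (a c, \<Sum>d\<in>C. a d *\<^sub>R d)"
      using insert by simp
    moreover have "(a c, \<Sum>d\<in>C. a d *\<^sub>R d) \<in> {-1..1} \<times> ?K C"
      using a(1) by (auto simp: abs_le_iff)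
    ultimately show "x \<in> (\<lambda>(t, v). t *\<^sub>R c + v) ` ({-1..1} \<times> ?K C)"
      by blast
  next
    fix x assume "x \<in> (\<lambda>(t, v). t *\<^sub>R c + v) ` ({-1..1} \<times> ?K C)"
    then obtain t a where a: "t \<in> {-1..1}" "\<forall>d\<in>C. \<bar>a d\<bar> \<le> 1" "x = t *\<^sub>R c + (\<Sum>d\<in>C. a d *\<^sub>R d)"
      by auto
    have "(\<Sum>d\<in>C. (a(c := t)) d *\<^sub>R d) = (\<Sum>d\<in>C. a d *\<^sub>R d)"
      using insert by (intro sum.cong) auto
    then have "x = (\<Sum>d\<in>insert c C. (a(c := t)) d *\<^sub>R d)"
      using insert a(3) by simp
    moreover have "\<forall>d\<in>insert c C. \<bar>(a(c := t)) d\<bar> \<le> 1"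
      using a by (auto simp: abs_le_iff)
    ultimately show "x \<in> ?K (insert c C)"
      by blast
  qed
  moreover have "compact ((\<lambda>(t, v). t *\<^sub>R c + v) ` ({-1..1::real} \<times> ?K C))"
    unfolding case_prod_unfold
    by (intro compact_continuous_image compact_Times insert.IH continuous_intros) auto
  ultimately show ?case
    by simp
qed

text \<open>The first-order condition at a maximum: divide by \<open>s\<close> and let
  \<open>s\<close> tend to 0 from the right and from the left.\<close>

lemma quadratic_nonpos_imp_linear_zero:
  fixes a b :: real
  assumes "\<And>s. s * a + s\<^sup>2 * b \<le> 0"
  shows "a = 0"
proof -
  have le: "x \<le> 0" if x: "\<And>s. 0 < s \<Longrightarrow> x + s * b \<le> 0" for x
  proof (rule tendsto_upperbound)
    show "((\<lambda>s. x + s * b) \<longlongrightarrow> x) (at_right 0)"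
      by (auto intro!: tendsto_eq_intros)
    show "\<forall>\<^sub>F s in at_right 0. x + s * b \<le> 0"
      by (rule eventually_at_rightI[of 0 1]) (use x in auto)
  qed simp
  have "a \<le> 0"
  proof (rule le)
    fix s :: real assume "0 < s"
    moreover have "s * (a + s * b) \<le> 0"
      using assms[of s] by (simp add: power2_eq_square algebra_simps)
    ultimately show "a + s * b \<le> 0"
      by (simp add: mult_le_0_iff)
  qed
  moreover have "- a \<le> 0"
  proof (rule le)
    fix s :: real assume "0 < s"
    moreover have "s * (- a + s * b) \<le> 0"
      using assms[of "- s"] by (simp add: power2_eq_square algebra_simps)
    ultimately show "- a + s * b \<le> 0"
      by (simp add: mult_le_0_iff)
  qed
  ultimately show ?thesis
    by simp
qed

text \<open>A maximizer of the Rayleigh quotient is an eigenvector.\<close>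

lemma symmetric_on_eigenvector:
  fixes W :: "'h::real_inner set"
  assumes W: "subspace W" "W \<noteq> {0}" and S: "finite S" "W \<subseteq> span S" and f: "symmetric_on W f"
  obtains w l where "w \<in> W" "norm w = 1" "f w = l *\<^sub>R w"
proof -
  obtain C where C: "finite C" "orthonormal C" "span C = W"
    using orthonormal_basis_of_subspace[OF W(1) S] .
  have CW: "C \<subseteq> W"
    using C(3) span_superset by blast
  have fW: "f x \<in> W" "f (x + y) = f x + f y" "f (c *\<^sub>R x) = c *\<^sub>R f x" "f x \<bullet> y = x \<bullet> f y"
    if "x \<in> W" "y \<in> W" for x y c
    using f that by (auto simp: symmetric_on_def)
  have f0: "f 0 = 0"
    using fW(3)[of 0 0 0] subspace_0[OF W(1)] by simp
  have f_sum: "f (\<Sum>c\<in>D. a c *\<^sub>R c) = (\<Sum>c\<in>D. a c *\<^sub>R f c)" if "finite D" "D \<subseteq> W" for D a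
    using that
  proof (induction D)
    case (insert c D)
    have "(\<Sum>c\<in>D. a c *\<^sub>R c) \<in> W" "a c *\<^sub>R c \<in> W" "c \<in> W"
      using insert.prems by (auto intro!: subspace_sum subspace_scale W)
    then show ?case
      using insert by (simp add: fW)
  qed (simp add: f0)
  \<comment> \<open>This is the unit sphere of \<open>W\<close>: by Cauchy-Schwarz the coefficients
    of a unit vector lie in the box, and so the unit sphere is compact.\<close>
  define K where "K = {\<Sum>c\<in>C. a c *\<^sub>R c | a. \<forall>c\<in>C. \<bar>a c\<bar> \<le> (1::real)} \<inter> {w. norm w = 1}"
  have K: "w \<in> K \<longleftrightarrow> w \<in> W \<and> norm w = 1" for w
  proof
    assume "w \<in> K"
    then show "w \<in> W \<and> norm w = 1"
      using CW W(1) by (auto simp: K_def intro!: subspace_sum subspace_scale)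
  next
    assume w: "w \<in> W \<and> norm w = 1"
    then have "w = (\<Sum>c\<in>C. (w \<bullet> c) *\<^sub>R c)"
      using C orthonormal_expansion by blast
    moreover have "\<bar>w \<bullet> c\<bar> \<le> 1" if "c \<in> C" for c
      using Cauchy_Schwarz_ineq2[of w c] w C(2) that by (auto simp: orthonormal_def)
    ultimately show "w \<in> K"
      using w unfolding K_def by auto
  qed
  have "compact K"
    unfolding K_def by (intro compact_Int_closed compact_coefficient_box C closed_Collect_eq continuous_intros)
  moreover have "continuous_on K (\<lambda>w. f w \<bullet> w)"
  proof -
    have "continuous_on K (\<lambda>w. (\<Sum>c\<in>C. (w \<bullet> c) *\<^sub>R f c) \<bullet> w)"
      by (intro continuous_intros)
    moreover have "f w = (\<Sum>c\<in>C. (w \<bullet> c) *\<^sub>R f c)" if "w \<in> K" for w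
      using f_sum[OF C(1) CW, of "\<lambda>c. w \<bullet> c"] orthonormal_expansion[OF C(2,1)] that C(3) K by metis
    ultimately show ?thesis
      by (simp cong: continuous_on_cong)
  qed
  moreover have "K \<noteq> {}"
  proof -
    obtain w where "w \<in> W" "w \<noteq> 0"
      using W subspace_0 by blast
    then have "w /\<^sub>R norm w \<in> K"
      using W(1) by (simp add: K subspace_scale)
    then show ?thesis
      by blast
  qed
  ultimately obtain v where v: "v \<in> K" "\<And>w. w \<in> K \<Longrightarrow> f w \<bullet> w \<le> f v \<bullet> v"
    using continuous_attains_sup[of K "\<lambda>w. f w \<bullet> w"] by auto
  then have vW: "v \<in> W" and v1: "v \<bullet> v = 1"
    by (simp_all add: K dot_square_norm)
  define l where "l = f v \<bullet> v"
  have max: "f w \<bullet> w \<le> l * (w \<bullet> w)" if "w \<in> W" for w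
  proof (cases "w = 0")
    case False
    have "w /\<^sub>R norm w \<in> K"
      using that W(1) False by (simp add: K subspace_scale)
    then have "f (w /\<^sub>R norm w) \<bullet> (w /\<^sub>R norm w) \<le> l"
      unfolding l_def by (rule v)
    then have "(f w \<bullet> w) / (norm w * norm w) \<le> l"
      using that by (simp add: fW divide_simps)
    then show ?thesis
      using False by (simp add: divide_simps dot_square_norm power2_eq_square)
  qed (simp add: f0)
  \<comment> \<open>The residual of the eigenvector equation is itself the test direction: varying
    \<open>v\<close> along \<open>h\<close> gives the first-order term
    \<open>2 * (h \<bullet> h)\<close>, which must vanish.\<close>
  define h where "h = f v - l *\<^sub>R v"
  have hW: "h \<in> W"
    unfolding h_def using vW by (intro subspace_diff subspace_scale W fW)
  have "2 * (h \<bullet> h) = 0"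
  proof (rule quadratic_nonpos_imp_linear_zero)
    fix s :: real
    have sW: "v + s *\<^sub>R h \<in> W" "s *\<^sub>R h \<in> W"
      using vW hW by (auto intro!: subspace_add subspace_scale W)
    have "f (v + s *\<^sub>R h) \<bullet> (v + s *\<^sub>R h) \<le> l * ((v + s *\<^sub>R h) \<bullet> (v + s *\<^sub>R h))"
      by (rule max[OF sW(1)])
    moreover have "f (v + s *\<^sub>R h) \<bullet> (v + s *\<^sub>R h) = l + 2 * s * (f v \<bullet> h) + s\<^sup>2 * (f h \<bullet> h)"
      using vW hW sW fW(4)[OF hW vW]
      by (simp add: fW inner_add_left inner_add_right l_def power2_eq_square algebra_simps inner_commute)
    moreover have "(v + s *\<^sub>R h) \<bullet> (v + s *\<^sub>R h) = 1 + 2 * s * (v \<bullet> h) + s\<^sup>2 * (h \<bullet> h)"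
      by (simp add: inner_add_left inner_add_right v1 power2_eq_square algebra_simps inner_commute)
    ultimately have "l + 2 * s * (f v \<bullet> h) + s\<^sup>2 * (f h \<bullet> h) \<le> l * (1 + 2 * s * (v \<bullet> h) + s\<^sup>2 * (h \<bullet> h))"
      by simp
    moreover have "2 * s * (h \<bullet> h) = 2 * s * (f v \<bullet> h) - 2 * s * l * (v \<bullet> h)"
    proof -
      have "h \<bullet> h = f v \<bullet> h - l * (v \<bullet> h)"
        by (simp add: h_def inner_diff_left)
      then show ?thesis
        by (simp only: right_diff_distrib mult.assoc)
    qed
    ultimately show "s * (2 * (h \<bullet> h)) + s\<^sup>2 * (f h \<bullet> h - l * (h \<bullet> h)) \<le> 0"
      by (simp add: algebra_simps)
  qed
  then have "f v = l *\<^sub>R v"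
    by (simp add: h_def)
  then show ?thesis
    using v(1) that[of v l] by (simp add: K)
qed

section \<open>Simultaneous diagonalization\<close>

lemma symmetric_on_subset:
  assumes "symmetric_on V f" "W \<subseteq> V" "\<And>x. x \<in> W \<Longrightarrow> f x \<in> W"
  shows "symmetric_on W f"
  using assms unfolding symmetric_on_def by (meson subsetD)

text \<open>An eigenspace of \<open>f\<close> is invariant under every operator commuting with
  \<open>f\<close>, so \<open>g\<close> restricts to it and has an eigenvector there.\<close>

lemma joint_eigenvector:
  fixes W :: "'h::real_inner set"
  assumes W: "subspace W" "W \<noteq> {0}" and S: "finite S" "W \<subseteq> span S"
    and f: "symmetric_on W f" and g: "symmetric_on W g"
    and comm: "\<And>x. x \<in> W \<Longrightarrow> f (g x) = g (f x)"
  obtains w l m where "w \<in> W" "norm w = 1" "f w = l *\<^sub>R w" "g w = m *\<^sub>R w"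
proof -
  obtain v l where v: "v \<in> W" "norm v = 1" "f v = l *\<^sub>R v"
    using symmetric_on_eigenvector[OF W S f] .
  let ?W = "{x \<in> W. f x = l *\<^sub>R x}"
  have f': "f (x + y) = f x + f y" "f (c *\<^sub>R x) = c *\<^sub>R f x" if "x \<in> W" "y \<in> W" for x y c
    using f that by (auto simp: symmetric_on_def)
  have "subspace ?W"
    using W(1) f' unfolding subspace_def
    by (auto simp: scaleR_add_right) (metis scaleR_zero_left)
  moreover have "?W \<noteq> {0}"
    using v by force
  moreover have "?W \<subseteq> span S"
    using S by auto
  moreover have "symmetric_on ?W g"
  proof (rule symmetric_on_subset[OF g])
    fix x assume x: "x \<in> ?W"
    then have "f (g x) = g (l *\<^sub>R x)"
      using comm by simp
    with x g show "g x \<in> ?W"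
      by (simp add: symmetric_on_def)
  qed auto
  ultimately obtain w m where "w \<in> ?W" "norm w = 1" "g w = m *\<^sub>R w"
    by (rule symmetric_on_eigenvector[OF _ _ S(1)])
  with that show ?thesis
    by blast
qed

text \<open>Starting from a given \<open>B\<close> instead of the empty set allows the bases of
  nested spaces to be nested as well. The orthogonal complement of \<open>B\<close> in
  \<open>V\<close> is invariant because \<open>B\<close> consists of eigenvectors of symmetric
  operators.\<close>

lemma joint_eigenbasis_extend:
  fixes V :: "'h::real_inner set"
  assumes V: "subspace V" and S: "finite S" "V \<subseteq> span S"
    and f: "symmetric_on V f" and g: "symmetric_on V g"
    and comm: "\<And>x. x \<in> V \<Longrightarrow> f (g x) = g (f x)"
    and B: "finite B" "B \<subseteq> V" "orthonormal B" "\<forall>b\<in>B. (\<exists>l. f b = l *\<^sub>R b) \<and> (\<exists>m. g b = m *\<^sub>R b)"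
  shows "\<exists>B'. B \<subseteq> B' \<and> finite B' \<and> orthonormal B' \<and> span B' = V \<and>
    (\<forall>b\<in>B'. (\<exists>l. f b = l *\<^sub>R b) \<and> (\<exists>m. g b = m *\<^sub>R b))"
  using B
\<comment> \<open>Orthonormal subsets of \<open>span S\<close> are independent, so their size is
  bounded by \<open>card S\<close> and each added vector lowers the measure.\<close>
proof (induction "card S - card B" arbitrary: B rule: less_induct)
  case less
  show ?case
  proof (cases "V \<subseteq> span B")
    case True
    then have "span B = V"
      using span_minimal[OF less.prems(2) V] by blast
    then show ?thesis
      using less.prems by (intro exI[of _ B]) simp
  next
    case False
    then obtain v where v: "v \<in> V" "v \<notin> span B"
      by blast
    define W where "W = {x \<in> V. \<forall>b\<in>B. x \<bullet> b = 0}"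
    define p where "p = (\<Sum>c\<in>B. (v \<bullet> c) *\<^sub>R c)"
    have p: "p \<in> span B" "p \<in> V"
      unfolding p_def using less.prems(2)
      by (auto intro!: span_sum span_scale subspace_sum[OF V] subspace_scale[OF V] intro: span_base)
    have "v - p \<in> W"
      using v p less.prems V
      by (auto simp: W_def inner_diff_left p_def orthonormal_sum_inner subspace_diff)
    moreover have "v - p \<noteq> 0"
      using v p by auto
    ultimately have "W \<noteq> {0}"
      by blast
    moreover have "subspace W"
      using V by (auto simp: W_def subspace_def inner_add_left)
    moreover have "W \<subseteq> span S" "W \<subseteq> V"
      using S by (auto simp: W_def)
    moreover have sym: "symmetric_on W k" if k: "symmetric_on V k" "\<forall>b\<in>B. \<exists>l. k b = l *\<^sub>R b" for k
    proof (rule symmetric_on_subset[OF k(1) \<open>W \<subseteq> V\<close>])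
      fix x assume x: "x \<in> W"
      have "k x \<bullet> b = 0" if b: "b \<in> B" for b
      proof -
        obtain l where "k b = l *\<^sub>R b"
          using k b by blast
        moreover have "k x \<bullet> b = x \<bullet> k b"
          using k(1) x b less.prems by (auto simp: W_def symmetric_on_def)
        ultimately show ?thesis
          using x b by (simp add: W_def)
      qed
      with x k(1) show "k x \<in> W"
        by (simp add: W_def symmetric_on_def)
    qed
    moreover have "symmetric_on W f" "symmetric_on W g"
      using sym f g less.prems by blast+
    ultimately obtain w l m where w: "w \<in> W" "norm w = 1" "f w = l *\<^sub>R w" "g w = m *\<^sub>R w"
      using joint_eigenvector[of W S f g] S comm by blast
    have w': "w \<in> V" "w \<notin> B" "\<forall>b\<in>B. w \<bullet> b = 0"
      using w(1,2) by (auto simp: W_def)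
    have o: "orthonormal (insert w B)"
      using less.prems(3) w w'
      by (auto simp: orthonormal_def pairwise_insert orthogonal_def inner_commute)
    have "card (insert w B) \<le> card S"
      using independent_span_bound[OF S(1) orthonormal_independent[OF o]] w' less.prems S
      by auto
    then have "card S - card (insert w B) < card S - card B"
      using w' less.prems by simp
    from less.hyps[OF this _ _ o] obtain B' where "insert w B \<subseteq> B'" "finite B'" "orthonormal B'"
      "span B' = V" "\<forall>b\<in>B'. (\<exists>l. f b = l *\<^sub>R b) \<and> (\<exists>m. g b = m *\<^sub>R b)"
      using less.prems w w' by auto
    then show ?thesis
      by blast
  qed
qed

lemma joint_eigenbasis:
  fixes V :: "nat \<Rightarrow> 'h::{real_inner, banach} set"
  assumes V: "\<And>n. subspace (V n)" "\<And>n. V n \<subseteq> V (Suc n)"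
    and S: "\<And>n. finite (S n)" "\<And>n. V n \<subseteq> span (S n)"
    and f: "\<And>n. symmetric_on (V n) f" and g: "\<And>n. symmetric_on (V n) g"
    and comm: "\<And>n x. x \<in> V n \<Longrightarrow> f (g x) = g (f x)"
    and total: "\<And>u. (\<And>n v. v \<in> V n \<Longrightarrow> u \<bullet> v = 0) \<Longrightarrow> u = 0"
  obtains e l m where "total_orthonormal e" "\<And>k. e k \<in> (\<Union>n. V n)"
    "\<And>k. f (e k) = l k *\<^sub>R e k" "\<And>k. g (e k) = m k *\<^sub>R e k"
proof -
  let ?P = "\<lambda>n B. finite B \<and> orthonormal B \<and> span B = V n \<and>
    (\<forall>b\<in>B. (\<exists>l. f b = l *\<^sub>R b) \<and> (\<exists>m. g b = m *\<^sub>R b))"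
  have extend: "\<exists>B'. ?P n B' \<and> B \<subseteq> B'" if "finite B" "B \<subseteq> V n" "orthonormal B"
      "\<forall>b\<in>B. (\<exists>l. f b = l *\<^sub>R b) \<and> (\<exists>m. g b = m *\<^sub>R b)" for n B
  proof -
    have "\<exists>B'. B \<subseteq> B' \<and> finite B' \<and> orthonormal B' \<and> span B' = V n \<and>
        (\<forall>b\<in>B'. (\<exists>l. f b = l *\<^sub>R b) \<and> (\<exists>m. g b = m *\<^sub>R b))"
      by (rule joint_eigenbasis_extend[OF V(1) S f g _ that]) (rule comm)
    then show ?thesis
      by (elim ex_forward conjE) (intro conjI; assumption)
  qed
  \<comment> \<open>Dependent choice makes the bases increasing; any two vectors of their union then
    lie in a common basis, so the union is orthonormal.\<close>
  have "\<exists>B. \<forall>n. ?P n (B n) \<and> B n \<subseteq> B (Suc n)"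
  proof (rule dependent_nat_choice)
    show "\<exists>B. ?P 0 B"
      using extend[of "{}" 0] by (auto simp: orthonormal_def)
    show "\<exists>B'. ?P (Suc n) B' \<and> B \<subseteq> B'" if B: "?P n B" for n B
    proof -
      have "B \<subseteq> V (Suc n)"
        using B V(2) span_superset by blast
      then show ?thesis
        using extend[of B "Suc n"] B by blast
    qed
  qed
  then obtain B where B: "\<And>n. ?P n (B n)" and BSuc: "\<And>n. B n \<subseteq> B (Suc n)"
    by blast
  have mono: "B i \<subseteq> B j" if "i \<le> j" for i j
    using BSuc that by (rule lift_Suc_mono_le)
  define E where "E = (\<Union>n. B n)"
  have "countable E"
    unfolding E_def using B by (auto intro: countable_finite)
  have E_norm: "norm b = 1" if "b \<in> E" for b
    using B that by (auto simp: E_def orthonormal_def)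
  have E_orth: "b \<bullet> c = 0" if "b \<in> E" "c \<in> E" "b \<noteq> c" for b c
  proof -
    obtain i j where "b \<in> B i" "c \<in> B j"
      using \<open>b \<in> E\<close> \<open>c \<in> E\<close> by (auto simp: E_def)
    then have "b \<in> B (max i j)" "c \<in> B (max i j)"
      using mono[of i "max i j"] mono[of j "max i j"] by auto
    then show ?thesis
      using B[of "max i j"] that by (auto simp: orthonormal_def pairwise_def orthogonal_def)
  qed
  \<comment> \<open>Indices that enumerate no element of \<open>E\<close> are sent to the zero
    vector, so no case distinction on the size of \<open>E\<close> is needed.\<close>
  define e where "e k = (if k \<in> to_nat_on E ` E then inv_into E (to_nat_on E) k else 0)" for k
  have inj: "inj_on (to_nat_on E) E"
    using \<open>countable E\<close> by (rule inj_on_to_nat_on)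
  have e_E: "e (to_nat_on E b) = b" if "b \<in> E" for b
    using that inj by (simp add: e_def)
  have e_cases: "e k = 0 \<or> (e k \<in> E \<and> k = to_nat_on E (e k))" for k
    by (auto simp: e_def inv_into_into f_inv_into_f)
  have "total_orthonormal e"
  proof
    show "e i \<bullet> e j = 0" if "i \<noteq> j" for i j
      using e_cases[of i] e_cases[of j] E_orth that by (metis inner_zero_left inner_zero_right)
    show "e i = 0 \<or> norm (e i) = 1" for i
      using e_cases[of i] E_norm by blast
    show "u = 0" if u: "\<And>k. u \<bullet> e k = 0" for u
    proof (rule total)
      fix n v assume "v \<in> V n"
      then have "v \<in> span (B n)"
        using B[of n] by blast
      moreover have "orthogonal u b" if "b \<in> B n" for b
      proof -
        have "b \<in> E"
          using that by (auto simp: E_def)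
        then show ?thesis
          using u[of "to_nat_on E b"] by (simp add: e_E orthogonal_def)
      qed
      ultimately show "u \<bullet> v = 0"
        using orthogonal_to_span orthogonal_def by blast
    qed
  qed
  moreover have "e k \<in> (\<Union>n. V n)" for k
    using e_cases[of k]
  proof
    assume "e k = 0"
    then show ?thesis
      using subspace_0[OF V(1)] by simp
  next
    assume "e k \<in> E \<and> k = to_nat_on E (e k)"
    then show ?thesis
      using B span_superset unfolding E_def by blast
  qed
  moreover have "\<exists>l. h (e k) = l *\<^sub>R e k" if h: "\<And>n. symmetric_on (V n) h"
      "\<And>n b. b \<in> B n \<Longrightarrow> \<exists>l. h b = l *\<^sub>R b" for h k
    using e_cases[of k]
  proof
    assume "e k = 0"
    moreover have "h (0 *\<^sub>R 0) = 0 *\<^sub>R h 0"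
      using h(1)[of 0] subspace_0[OF V(1)] unfolding symmetric_on_def by blast
    ultimately show ?thesis
      by simp
  next
    assume "e k \<in> E \<and> k = to_nat_on E (e k)"
    then show ?thesis
      using h(2) unfolding E_def by blast
  qed
  then have "\<forall>k. \<exists>l. f (e k) = l *\<^sub>R e k" "\<forall>k. \<exists>m. g (e k) = m *\<^sub>R e k"
    using f g B by blast+
  then obtain l m where "\<And>k. f (e k) = l k *\<^sub>R e k" "\<And>k. g (e k) = m k *\<^sub>R e k"
    by metis
  ultimately show ?thesis
    using that by blast
qed


subsection \<open>The orthonormal frame\<close>

lemma exhaust_8: "x = 0 \<or> x = 1 \<or> x = 2 \<or> x = 3 \<or> x = 4 \<or> x = 5 \<or> x = 6 \<or> x = 7" for x :: 8
proof (induct x)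
  case (of_int z)
  then have "0 \<le> z" "z < 8"
    by simp_all
  then have "z = 0 \<or> z = 1 \<or> z = 2 \<or> z = 3 \<or> z = 4 \<or> z = 5 \<or> z = 6 \<or> z = 7"
    by arith
  then show ?case
    by auto
qed

lemma UNIV_8: "UNIV = {0, 1, 2, 3, 4, 5, 6, 7::8}"
  using exhaust_8 by auto

lemma sum_8: "sum f (UNIV::8 set) = f 0 + f 1 + f 2 + f 3 + f 4 + f 5 + f 6 + f 7"
  unfolding UNIV_8 by (simp add: ac_simps)

lemma inner_vec_8:
  "x \<bullet> y = x $ 0 * y $ 0 + x $ 1 * y $ 1 + x $ 2 * y $ 2 + x $ 3 * y $ 3
    + x $ 4 * y $ 4 + x $ 5 * y $ 5 + x $ 6 * y $ 6 + x $ 7 * y $ 7"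
  for x y :: "real ^ 8"
  by (simp add: inner_vec_def sum_8)

lemma of_coords_nth:
  "of_coords [c0, c1, c2, c3, c4, c5, c6, c7] $ 0 = c0"
  "of_coords [c0, c1, c2, c3, c4, c5, c6, c7] $ 1 = c1"
  "of_coords [c0, c1, c2, c3, c4, c5, c6, c7] $ 2 = c2"
  "of_coords [c0, c1, c2, c3, c4, c5, c6, c7] $ 3 = c3"
  "of_coords [c0, c1, c2, c3, c4, c5, c6, c7] $ 4 = c4"
  "of_coords [c0, c1, c2, c3, c4, c5, c6, c7] $ 5 = c5"
  "of_coords [c0, c1, c2, c3, c4, c5, c6, c7] $ 6 = c6"
  "of_coords [c0, c1, c2, c3, c4, c5, c6, c7] $ 7 = c7"
  by (simp_all add: of_coords_def axis_def lessThan_nat_numeral lessThan_Suc eval_nat_numeral)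

lemma frame_index_cases:
  assumes "a \<in> {1..7::nat}"
  obtains "a = 1" | "a = 2" | "a = 3" | "a = 4" | "a = 5" | "a = 6" | "a = 7"
  using assms by fastforce

text \<open>A family of quadratic identities in the eight coordinates, valid off the sphere as well.
  Together with skew-symmetry they say that distinct coefficient matrices anticommute and each
  squares to -1: a Clifford module structure.\<close>

lemma X_inner_X:
  assumes "a \<in> {1..7}" "b \<in> {1..7}"
  shows "X a x \<bullet> X b x = (if a = b then x \<bullet> x else 0)"
  using assms
  by (elim frame_index_cases)
    (simp_all add: X_def Let_def inner_vec_8 of_coords_nth algebra_simps)

lemma X_inner_X_same:
  assumes "a \<in> {1..7}"
  shows "X a x \<bullet> X a y = x \<bullet> y"
  using assms
  by (rule frame_index_cases) (simp_all add: X_def Let_def inner_vec_8 of_coords_nth algebra_simps)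

lemma X_skew:
  assumes "a \<in> {1..7}"
  shows "X a x \<bullet> y = - (x \<bullet> X a y)"
  using assms
  by (rule frame_index_cases) (simp_all add: X_def Let_def inner_vec_8 of_coords_nth algebra_simps)

text \<open>Read off from skew-symmetry: a map with an everywhere defined adjoint is linear.\<close>

lemma linear_X:
  assumes "a \<in> {1..7}"
  shows "linear (X a)"
proof (rule linearI; rule vector_eq_rdot[THEN iffD1]; rule allI)
  show "X a (x + y) \<bullet> z = (X a x + X a y) \<bullet> z" for x y z
    by (simp add: X_skew[OF assms] inner_add_left)
  show "X a (r *\<^sub>R x) \<bullet> z = (r *\<^sub>R X a x) \<bullet> z" for r x z
    by (simp add: X_skew[OF assms])
qed

lemma X_tangent: "a \<in> {1..7} \<Longrightarrow> X a x \<bullet> x = 0"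
  using X_skew[of a x x] by (simp add: inner_commute)

lemma norm_X: "a \<in> {1..7} \<Longrightarrow> norm (X a x) = norm x"
  by (simp add: norm_eq_sqrt_inner X_inner_X)

lemma X_X:
  assumes "a \<in> {1..7}"
  shows "X a (X a x) = - x"
proof (rule vector_eq_rdot[THEN iffD1], rule allI)
  show "X a (X a x) \<bullet> y = - x \<bullet> y" for y
    by (simp add: X_skew[OF assms, of "X a x"] X_inner_X_same[OF assms])
qed

text \<open>The point \<open>x\<close> and its seven frame vectors are eight orthonormal vectors in
  dimension eight, hence a basis.\<close>

lemma frame_expansion:
  assumes "norm x = 1"
  shows "v = (v \<bullet> x) *\<^sub>R x + (\<Sum>a = 1..7. (v \<bullet> X a x) *\<^sub>R X a x)"
proof -
  have xx: "x \<bullet> x = 1"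
    using assms by (simp add: dot_square_norm)
  define B where "B = insert x ((\<lambda>a. X a x) ` {1..7})"
  have inj: "inj_on (\<lambda>a. X a x) {1..7}"
    by (rule inj_onI) (metis X_inner_X xx zero_neq_one)
  have notin: "x \<notin> (\<lambda>a. X a x) ` {1..7}"
    using X_tangent[of _ x] xx by (metis imageE zero_neq_one)
  have tang: "X a x \<bullet> x = 0" "x \<bullet> X a x = 0" if "a \<in> {1..7}" for a
    using X_tangent[OF that] by (simp_all add: inner_commute)
  have "pairwise orthogonal ((\<lambda>a. X a x) ` {1..7})"
    unfolding pairwise_image
    by (rule pairwiseI) (metis X_inner_X orthogonal_def)
  then have o: "pairwise orthogonal B"
    using tang by (auto simp: B_def pairwise_insert orthogonal_def)
  have n: "norm b = 1" if "b \<in> B" for b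
    using assms that norm_X by (auto simp: B_def)
  have "independent B"
    using o n[of 0] by (intro pairwise_orthogonal_independent) auto
  moreover have "card B = DIM(real ^ 8)"
    using inj notin by (simp add: B_def card_image)
  ultimately have "span B = UNIV"
    using card_ge_dim_independent[of B UNIV] by auto
  then have "(\<Sum>b\<in>B. (v \<bullet> b) *\<^sub>R b) = v"
    using o n by (intro orthonormal_basis_expand) (auto simp: B_def)
  moreover have "(\<Sum>b\<in>B. (v \<bullet> b) *\<^sub>R b) = (v \<bullet> x) *\<^sub>R x + (\<Sum>a = 1..7. (v \<bullet> X a x) *\<^sub>R X a x)"
    using notin sum.reindex[OF inj, of "\<lambda>b. (v \<bullet> b) *\<^sub>R b"] by (simp add: B_def)
  ultimately show ?thesis
    by simp
qed


subsection \<open>Integration over the sphere\<close>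

lemma finite_measure_sphere_volume: "finite_measure (sphere_volume :: 'a::euclidean_space measure)"
proof
  have "emeasure lborel {x \<in> cball 0 1 - {0}. sgn x \<in> sphere (0::'a) 1} \<le> emeasure lborel (cball (0::'a) 1)"
    by (intro emeasure_mono) auto
  also have "\<dots> < \<infinity>"
    by (rule emeasure_bounded_finite) simp
  finally have "emeasure (sphere_volume :: 'a measure) (sphere 0 1) < \<infinity>"
    by (subst emeasure_sphere_volume) (auto simp: ennreal_mult_less_top of_nat_less_top)
  then show "emeasure (sphere_volume :: 'a measure) (space sphere_volume) \<noteq> \<infinity>"
    by simp
qed

interpretation sphere: finite_measure "sphere_volume :: 'a::euclidean_space measure"
  by (rule finite_measure_sphere_volume)

lemma sphere_measurable_continuous:
  fixes f :: "'a::euclidean_space \<Rightarrow> 'b::topological_space"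
  assumes "continuous_on (sphere 0 1) f"
  shows "f \<in> borel_measurable sphere_volume"
  using borel_measurable_continuous_on_restrict[OF assms]
  by (simp cong: measurable_cong_sets)

lemma sphere_continuous_bounded:
  fixes f :: "'a::euclidean_space \<Rightarrow> 'b::real_normed_vector"
  assumes "continuous_on (sphere 0 1) f"
  obtains K where "0 \<le> K" "\<And>x. x \<in> sphere 0 1 \<Longrightarrow> norm (f x) \<le> K"
proof -
  have "bounded (f ` sphere 0 1)"
    using assms compact_continuous_image compact_imp_bounded compact_sphere by blast
  then obtain K where "\<forall>y\<in>f ` sphere 0 1. norm y \<le> K"
    unfolding bounded_iff by blast
  then have "norm (f x) \<le> max 0 K" if "x \<in> sphere 0 1" for x
    using that by (simp add: le_max_iff_disj)
  with that[of "max 0 K"] show ?thesis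
    by simp
qed

lemma sphere_integrable_continuous:
  fixes f :: "'a::euclidean_space \<Rightarrow> 'b::{banach, second_countable_topology}"
  assumes "continuous_on (sphere 0 1) f"
  shows "integrable sphere_volume f"
proof -
  obtain K where "\<And>x. x \<in> sphere 0 1 \<Longrightarrow> norm (f x) \<le> K"
    using sphere_continuous_bounded[OF assms] by metis
  then show ?thesis
    by (intro sphere.integrable_const_bound[of _ K] sphere_measurable_continuous assms AE_I2) simp
qed

lemma sphere_sq_integrable_continuous:
  fixes f :: "'a::euclidean_space \<Rightarrow> 'b::euclidean_space"
  assumes "continuous_on (sphere 0 1) f"
  shows "sphere_sq_integrable f"
  unfolding sphere_sq_integrable_def
  by (intro conjI sphere_measurable_continuous sphere_integrable_continuous continuous_intros assms)

lemma orthogonal_transformation_sgn: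
  assumes "orthogonal_transformation R"
  shows "sgn (R x) = R (sgn x)"
  using assms
  by (simp add: sgn_div_norm orthogonal_transformation_norm
      linear_scale[OF orthogonal_transformation_linear])

text \<open>An orthogonal map commutes with \<open>sgn\<close> and preserves norms, so it carries
  the cone over the preimage of \<open>A\<close> onto the cone over \<open>A\<close>; Lebesgue
  measure of these cones is invariant.\<close>

lemma distr_sphere_volume_orthogonal:
  fixes R :: "real ^ 'n::{finite, wellorder} \<Rightarrow> real ^ 'n::{finite, wellorder}"
  assumes R: "orthogonal_transformation R"
  shows "distr sphere_volume sphere_volume R = sphere_volume"
    and "R \<in> measurable sphere_volume sphere_volume"
proof -
  have cont: "continuous_on S R" for S
    using orthogonal_transformation_linear[OF R] by (simp add: linear_continuous_on linear_conv_bounded_linear)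
  have nR: "norm (R x) = norm x" for x
    using R by (rule orthogonal_transformation_norm)
  have "R \<in> measurable (restrict_space borel (sphere 0 1)) (restrict_space borel (sphere 0 1))"
    by (intro measurable_restrict_space2 borel_measurable_continuous_on_restrict cont)
      (auto simp: space_restrict_space nR)
  then show Rm: "R \<in> measurable sphere_volume sphere_volume"
    by (simp cong: measurable_cong_sets)
  show "distr sphere_volume sphere_volume R = sphere_volume"
  proof (rule measure_eqI)
    fix A assume "A \<in> sets (distr sphere_volume sphere_volume R :: (real ^ 'n::{finite, wellorder}) measure)"
    then have A: "A \<in> sets sphere_volume"
      by simp
    then have A': "A \<in> sets borel" "A \<subseteq> sphere 0 1"
      by (auto simp: sets_restrict_space_iff)
    define C where "C A = {x \<in> cball 0 1 - {0::real ^ 'n::{finite, wellorder}}. sgn x \<in> A}" for A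
    have C_borel: "C A \<in> sets borel" if "A \<in> sets borel" for A
    proof -
      have "sgn \<in> borel_measurable (restrict_space borel (cball 0 1 - {0::real ^ 'n::{finite, wellorder}}))"
        unfolding sgn_div_norm
        by (intro borel_measurable_continuous_on_restrict continuous_intros) auto
      then have "sgn -` A \<inter> space (restrict_space borel (cball 0 1 - {0::real ^ 'n::{finite, wellorder}}))
          \<in> sets (restrict_space borel (cball 0 1 - {0}))"
        using that by (rule measurable_sets)
      moreover have "sgn -` A \<inter> space (restrict_space borel (cball 0 1 - {0::real ^ 'n::{finite, wellorder}})) = C A"
        by (auto simp: C_def space_restrict_space)
      ultimately show ?thesis
        by (simp add: sets_restrict_space_iff)
    qed
    have C_meas: "C A \<in> lmeasurable" if "A \<in> sets borel" for A
    proof (rule bounded_set_imp_lmeasurable)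
      show "bounded (C A)"
        by (rule bounded_subset[OF bounded_cball[of 0 1]]) (auto simp: C_def)
      show "C A \<in> sets lebesgue"
        using C_borel[OF that] by (simp add: sets_completionI_sets)
    qed
    let ?B = "R -` A \<inter> sphere 0 1"
    have "?B \<in> sets sphere_volume"
      using measurable_sets[OF Rm A] by simp
    then have B: "?B \<in> sets borel"
      by (auto simp: sets_restrict_space_iff)
    have "R ` C ?B = C A"
    proof (intro equalityI subsetI)
      fix y assume "y \<in> C A"
      moreover obtain x where "y = R x"
        using orthogonal_transformation_surj[OF R] by (metis surjD)
      ultimately show "y \<in> R ` C ?B"
        using nR[of x] by (auto simp: C_def orthogonal_transformation_sgn[OF R] norm_sgn)
    next
      fix y assume "y \<in> R ` C ?B"
      then obtain x where x: "x \<in> C ?B" "y = R x"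
        by blast
      then show "y \<in> C A"
        using nR[of x] by (auto simp: C_def orthogonal_transformation_sgn[OF R])
    qed
    then have "measure lebesgue (C A) = measure lebesgue (C ?B)"
      using measure_orthogonal_image[OF R C_meas[OF B]] by simp
    moreover have "emeasure lborel (C D) = measure lebesgue (C D)" if "D \<in> sets borel" for D
    proof -
      have "emeasure lborel (C D) = emeasure lebesgue (C D)"
        using C_borel[OF that] by simp
      then show ?thesis
        using emeasure_eq_measure2[OF C_meas[OF that]] by simp
    qed
    ultimately have "emeasure lborel (C A) = emeasure lborel (C ?B)"
      using A' B by simp
    moreover have "emeasure sphere_volume D = of_nat DIM(real ^ 'n::{finite, wellorder}) * emeasure lborel (C D)"
      if "D \<in> sets borel" "D \<subseteq> sphere 0 1" for D
      unfolding C_def using that by (rule emeasure_sphere_volume)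
    ultimately show "emeasure (distr sphere_volume sphere_volume R) A = emeasure sphere_volume A"
      using A A' B by (simp add: emeasure_distr[OF Rm])
  qed simp
qed

lemma sphere_integral_orthogonal:
  fixes R :: "real ^ 'n::{finite, wellorder} \<Rightarrow> real ^ 'n::{finite, wellorder}" and f :: "real ^ 'n::{finite, wellorder} \<Rightarrow> 'b::{banach, second_countable_topology}"
  assumes R: "orthogonal_transformation R" and f: "f \<in> borel_measurable sphere_volume"
  shows "(\<integral>x. f (R x) \<partial>sphere_volume) = (\<integral>x. f x \<partial>sphere_volume)"
  using integral_distr[OF distr_sphere_volume_orthogonal(2)[OF R] f]
  by (simp add: distr_sphere_volume_orthogonal(1)[OF R])


subsection \<open>Polynomials are total\<close>

text \<open>Stone-Weierstrass gives a polynomial within \<open>d\<close> of \<open>g\<close> on the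
  sphere, so the integral is at most \<open>d\<close> times the L1 norm of \<open>w\<close>, for
  every positive \<open>d\<close>.\<close>

lemma sphere_integral_continuous_eq_0:
  fixes w :: "'a::euclidean_space \<Rightarrow> real"
  assumes w: "integrable sphere_volume w"
    and p: "\<And>p. real_polynomial_function p \<Longrightarrow> (\<integral>x. w x * p x \<partial>sphere_volume) = 0"
    and g: "continuous_on (sphere 0 1) g"
  shows "(\<integral>x. w x * g x \<partial>sphere_volume) = 0"
proof -
  have int: "integrable sphere_volume (\<lambda>x. w x * h x)" if h: "continuous_on (sphere 0 1) h" for h
  proof -
    obtain K where "\<And>x. x \<in> sphere 0 1 \<Longrightarrow> norm (h x) \<le> K"
      using sphere_continuous_bounded[OF h] by metis
    note K = this
    show ?thesis
    proof (rule Bochner_Integration.integrable_bound)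
      show "integrable sphere_volume (\<lambda>x. K * w x)"
        using w by simp
      show "(\<lambda>x. w x * h x) \<in> borel_measurable sphere_volume"
        by (rule borel_measurable_times[OF borel_measurable_integrable[OF w] sphere_measurable_continuous[OF h]])
      show "AE x in sphere_volume. norm (w x * h x) \<le> norm (K * w x)"
      proof (rule AE_I2)
        fix x :: 'a assume "x \<in> space sphere_volume"
        then have "\<bar>h x\<bar> \<le> \<bar>K\<bar>"
          using K[of x] by simp
        then have "\<bar>w x\<bar> * \<bar>h x\<bar> \<le> \<bar>w x\<bar> * \<bar>K\<bar>"
          by (rule mult_left_mono) simp
        then show "norm (w x * h x) \<le> norm (K * w x)"
          by (simp add: abs_mult mult.commute)
      qed
    qed
  qed
  have bound: "\<bar>\<integral>x. w x * g x \<partial>sphere_volume\<bar> \<le> d * (\<integral>x. \<bar>w x\<bar> \<partial>sphere_volume)" if d: "0 < d" for d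
  proof -
    obtain q where q: "real_polynomial_function q" "\<And>x. x \<in> sphere 0 1 \<Longrightarrow> \<bar>g x - q x\<bar> < d"
      using Stone_Weierstrass_real_polynomial_function[OF compact_sphere g d] by metis
    have qc: "continuous_on (sphere 0 1) q"
      using q(1) by (simp add: continuous_on_polymonial_function real_polynomial_function_eq)
    have "(\<integral>x. w x * g x \<partial>sphere_volume) = (\<integral>x. w x * g x - w x * q x \<partial>sphere_volume)"
      using p[OF q(1)] int[OF g] int[OF qc] by simp
    also have "\<bar>\<dots>\<bar> \<le> (\<integral>x. d * \<bar>w x\<bar> \<partial>sphere_volume)"
    proof (rule order_trans[OF integral_abs_bound], rule integral_mono)
      show "\<bar>w x * g x - w x * q x\<bar> \<le> d * \<bar>w x\<bar>" if "x \<in> space sphere_volume" for x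
      proof -
        have "\<bar>w x\<bar> * \<bar>g x - q x\<bar> \<le> \<bar>w x\<bar> * d"
          using q(2)[of x] that by (intro mult_left_mono) auto
        moreover have "w x * g x - w x * q x = w x * (g x - q x)"
          by (simp add: right_diff_distrib)
        ultimately show ?thesis
          by (simp only: abs_mult mult.commute[of d])
      qed
    qed (use int[OF g] int[OF qc] w in auto)
    finally show ?thesis
      by simp
  qed
  have "((\<lambda>d. d * (\<integral>x. \<bar>w x\<bar> \<partial>sphere_volume)) \<longlongrightarrow> 0) (at_right 0)"
    by (auto intro!: tendsto_eq_intros)
  then have "\<bar>\<integral>x. w x * g x \<partial>sphere_volume\<bar> \<le> 0"
    by (rule tendsto_lowerbound) (use bound in \<open>auto intro!: eventually_at_rightI[of 0 1]\<close>)
  then show ?thesis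
    by simp
qed

text \<open>The vanishing spreads from continuous functions to indicators of closed sets by
  dominated convergence, and from there to all Borel sets; a density whose integrals over all
  measurable sets vanish is zero almost everywhere.\<close>

lemma AE_sphere_eq_0:
  fixes w :: "'a::euclidean_space \<Rightarrow> real"
  assumes w: "integrable sphere_volume w"
    and g: "\<And>g. continuous_on (sphere 0 1) g \<Longrightarrow> (\<integral>x. w x * g x \<partial>sphere_volume) = 0"
  shows "AE x in sphere_volume. w x = 0"
proof -
  have ind [measurable]: "(indicator B :: 'a \<Rightarrow> real) \<in> borel_measurable (sphere_volume :: 'a measure)"
    if "B \<in> sets borel" for B :: "'a set"
  proof -
    have "(indicator B :: 'a \<Rightarrow> real) \<in> borel_measurable (restrict_space borel (sphere 0 1))"
      using that by (intro measurable_restrict_space1) auto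
    then show ?thesis
      by (simp cong: measurable_cong_sets)
  qed
  have int: "integrable sphere_volume (\<lambda>x. indicator B x *\<^sub>R w x)" if "B \<in> sets borel" for B :: "'a set"
  proof (rule Bochner_Integration.integrable_bound[OF w])
    show "(\<lambda>x. indicator B x *\<^sub>R w x) \<in> borel_measurable sphere_volume"
      using w ind[OF that] by (intro borel_measurable_scaleR) auto
  qed (auto simp: indicator_def)
  have closed: "(\<integral>x. indicator C x *\<^sub>R w x \<partial>sphere_volume) = 0" if C: "closed C" for C
  proof (cases "C = {}")
    case False
    \<comment> \<open>Continuous cut-offs that equal 1 on \<open>C\<close> and are eventually 0 at
      each point outside, because a closed set has positive distance from such a point.\<close>
    define h where "h n x = max 0 (1 - real n * infdist x C)" for n x
    have "(\<lambda>n. \<integral>x. w x * h n x \<partial>sphere_volume) \<longlonglongrightarrow> (\<integral>x. indicator C x *\<^sub>R w x \<partial>sphere_volume)"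
    proof (rule integral_dominated_convergence)
      show "integrable sphere_volume (\<lambda>x. \<bar>w x\<bar>)"
        using w by simp
      show "(\<lambda>x. indicator C x *\<^sub>R w x) \<in> borel_measurable sphere_volume"
        using int[of C] C by auto
      have "continuous_on (sphere 0 1) (h n)" for n
        unfolding h_def by (intro continuous_intros)
      then show "(\<lambda>x. w x * h n x) \<in> borel_measurable sphere_volume" for n
        by (intro borel_measurable_times borel_measurable_integrable[OF w] sphere_measurable_continuous)
      show "AE x in sphere_volume. norm (w x * h n x) \<le> \<bar>w x\<bar>" for n
        by (intro AE_I2) (auto simp: abs_mult h_def infdist_nonneg mult_left_le)
      show "AE x in sphere_volume. (\<lambda>n. w x * h n x) \<longlonglongrightarrow> indicator C x *\<^sub>R w x"
      proof (rule AE_I2)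
        fix x
        have "(\<lambda>n. h n x) \<longlonglongrightarrow> indicator C x"
        proof (cases "x \<in> C")
          case True
          then show ?thesis
            by (simp add: h_def)
        next
          case xC: False
          then have pos: "0 < infdist x C"
            using C False infdist_pos_not_in_closed by blast
          obtain N where N: "1 < real N * infdist x C"
            using reals_Archimedean3[OF pos] by blast
          have "h n x = 0" if "N \<le> n" for n
          proof -
            have "real N * infdist x C \<le> real n * infdist x C"
              using that pos by (intro mult_right_mono) auto
            then show ?thesis
              using N by (simp add: h_def)
          qed
          then have "\<forall>\<^sub>F n in sequentially. h n x = indicator C x"
            using xC by (auto simp: eventually_sequentially)
          then show ?thesis
            by (rule tendsto_eventually)
        qed
        then have "(\<lambda>n. w x * h n x) \<longlonglongrightarrow> w x * indicator C x"
          by (intro tendsto_intros)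
        then show "(\<lambda>n. w x * h n x) \<longlonglongrightarrow> indicator C x *\<^sub>R w x"
          by (simp add: mult.commute)
      qed
    qed
    moreover have "(\<integral>x. w x * h n x \<partial>sphere_volume) = 0" for n
      unfolding h_def by (intro g continuous_intros)
    ultimately show ?thesis
      by (simp add: LIMSEQ_const_iff)
  qed simp
  have borel: "(\<integral>x. indicator B x *\<^sub>R w x \<partial>sphere_volume) = 0" if "B \<in> sets borel" for B :: "'a set"
  proof -
    \<comment> \<open>Dynkin's argument is run on integrals, since \<open>w\<close> may change sign
      and does not define a measure.\<close>
    have "Int_stable (Collect closed :: 'a set set)"
      by (auto simp: Int_stable_def)
    moreover have "(Collect closed :: 'a set set) \<subseteq> Pow UNIV"
      by simp
    moreover have "B \<in> sigma_sets UNIV (Collect closed)"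
      using that by (simp add: borel_eq_closed)
    ultimately show ?thesis
    proof (induction rule: sigma_sets_induct_disjoint)
      case (basic A)
      then show ?case
        using closed[of A] by simp
    next
      case empty
      then show ?case
        by simp
    next
      case (compl A)
      then have A: "A \<in> sets borel"
        by (simp add: borel_eq_closed)
      have "(\<integral>x. indicator (UNIV - A) x *\<^sub>R w x \<partial>sphere_volume) =
          (\<integral>x. indicator UNIV x *\<^sub>R w x - indicator A x *\<^sub>R w x \<partial>sphere_volume)"
        by (intro Bochner_Integration.integral_cong) (auto simp: indicator_def)
      also have "\<dots> = 0"
        using compl.IH int[OF A] int[of UNIV] closed[of UNIV] by simp
      finally show ?case .
    next
      case (union A)
      then have A: "A i \<in> sets borel" for i
        by (auto simp: borel_eq_closed)
      have "(\<lambda>n. \<integral>x. (\<Sum>i<n. indicator (A i) x *\<^sub>R w x) \<partial>sphere_volume) \<longlonglongrightarrow>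
          (\<integral>x. indicator (\<Union>i. A i) x *\<^sub>R w x \<partial>sphere_volume)"
      proof (rule integral_dominated_convergence)
        show "integrable sphere_volume (\<lambda>x. \<bar>w x\<bar>)"
          using w by simp
        show "(\<lambda>x. indicator (\<Union>i. A i) x *\<^sub>R w x) \<in> borel_measurable sphere_volume"
          using int[of "\<Union>i. A i"] A by auto
        show "(\<lambda>x. \<Sum>i<n. indicator (A i) x *\<^sub>R w x) \<in> borel_measurable sphere_volume" for n
          by (intro borel_measurable_sum borel_measurable_integrable int A)
        have sum: "(\<Sum>i<n. indicator (A i) x *\<^sub>R w x) = indicator (\<Union>i<n. A i) x *\<^sub>R w x" for n x
        proof -
          have "disjoint_family_on A {..<n}"
            using union.hyps(1) by (rule disjoint_family_on_mono[rotated]) simp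
          then have "(indicator (\<Union>i<n. A i) x :: real) = (\<Sum>i<n. indicator (A i) x)"
            by (simp add: indicator_UN_disjoint)
          then show ?thesis
            by (simp only: scaleR_sum_left)
        qed
        show "AE x in sphere_volume. norm (\<Sum>i<n. indicator (A i) x *\<^sub>R w x) \<le> \<bar>w x\<bar>" for n
          unfolding sum by (intro AE_I2) (auto simp: indicator_def)
        show "AE x in sphere_volume. (\<lambda>n. \<Sum>i<n. indicator (A i) x *\<^sub>R w x) \<longlonglongrightarrow>
            indicator (\<Union>i. A i) x *\<^sub>R w x"
          unfolding sum by (intro AE_I2 tendsto_intros LIMSEQ_indicator_UN)
      qed
      moreover have "(\<integral>x. (\<Sum>i<n. indicator (A i) x *\<^sub>R w x) \<partial>sphere_volume) = 0" for n
        by (subst Bochner_Integration.integral_sum) (simp_all only: int[OF A] union.IH sum.neutral_const)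
      ultimately show ?case
        by (simp add: LIMSEQ_const_iff)
    qed
  qed
  show ?thesis
  proof (rule density_unique_real[OF w])
    fix A :: "'a set" assume "A \<in> sets sphere_volume"
    then have "A \<in> sets borel"
      by (simp add: sets_restrict_space_iff)
    then show "(\<integral>x\<in>A. w x \<partial>sphere_volume) = (\<integral>x\<in>A. 0 \<partial>sphere_volume)"
      using borel by (simp add: set_lebesgue_integral_def)
  qed simp
qed


lemma AE_sphere_eq_0_polynomial:
  fixes u :: "'a::euclidean_space \<Rightarrow> 'b::euclidean_space"
  assumes u: "sphere_sq_integrable u"
    and p: "\<And>p b. real_polynomial_function p \<Longrightarrow> b \<in> Basis \<Longrightarrow> (\<integral>x. u x \<bullet> (p x *\<^sub>R b) \<partial>sphere_volume) = 0"
  shows "AE x in sphere_volume. u x = 0"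
proof -
  have "AE x in sphere_volume. u x \<bullet> b = 0" if b: "b \<in> Basis" for b
  proof (rule AE_sphere_eq_0)
    show w: "integrable sphere_volume (\<lambda>x. u x \<bullet> b)"
      by (intro sphere_integrable_inner u sphere_sq_integrable_continuous continuous_intros)
    show "(\<integral>x. u x \<bullet> b * g x \<partial>sphere_volume) = 0" if "continuous_on (sphere 0 1) g" for g
      using w _ that by (rule sphere_integral_continuous_eq_0) (use p[OF _ b] in \<open>simp add: mult.commute\<close>)
  qed
  then have "AE x in sphere_volume. \<forall>b\<in>Basis. u x \<bullet> b = 0"
    by (intro AE_finite_allI) auto
  then show ?thesis
    by (auto simp: euclidean_all_zero_iff)
qed


subsection \<open>Square integrable functions form a Hilbert space\<close>

lemma sphere_sq_integrable_rep: "sphere_sq_integrable (rep_sphere_L2 u)"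
  using Quotient3_rep_reflp[OF Quotient3_sphere_L2, of u] by simp

lemma sphere_L2_of_rep [simp]: "sphere_L2_of (rep_sphere_L2 u) = u"
  using Quotient3_abs_rep[OF Quotient3_sphere_L2] .

lemma sphere_L2_of_eq_iff:
  assumes "sphere_sq_integrable f" "sphere_sq_integrable g"
  shows "sphere_L2_of f = sphere_L2_of g \<longleftrightarrow> (AE x in sphere_volume. f x = g x)"
  using Quotient3_rel[OF Quotient3_sphere_L2, of f g] assms by auto

lemma sphere_L2_cases:
  obtains f where "sphere_sq_integrable f" "u = sphere_L2_of f"
  using sphere_sq_integrable_rep[of u] sphere_L2_of_rep[of u] by metis

text \<open>The measure space is the sphere itself, so values off the sphere affect neither
  measurability nor integrals. This is what allows identities proved only on the sphere to be used
  in L2.\<close>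

lemma sphere_L2_of_cong:
  assumes "\<And>x. x \<in> sphere 0 1 \<Longrightarrow> f x = g x" "sphere_sq_integrable g"
  shows "sphere_L2_of f = sphere_L2_of g"
proof -
  have "f \<in> borel_measurable sphere_volume"
    using assms by (subst measurable_cong[of _ _ g]) (auto simp: sphere_sq_integrable_def)
  moreover have "integrable sphere_volume (\<lambda>x. (norm (f x))\<^sup>2)"
    using assms by (subst Bochner_Integration.integrable_cong[of _ sphere_volume _ "\<lambda>x. (norm (g x))\<^sup>2"])
      (auto simp: sphere_sq_integrable_def)
  ultimately show ?thesis
    using assms by (subst sphere_L2_of_eq_iff) (auto simp: sphere_sq_integrable_def intro: AE_I2)
qed

lemma
  assumes "sphere_sq_integrable f" "sphere_sq_integrable g"
  shows sphere_L2_of_add: "sphere_L2_of (\<lambda>x. f x + g x) = sphere_L2_of f + sphere_L2_of g"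
    and sphere_L2_of_diff: "sphere_L2_of (\<lambda>x. f x - g x) = sphere_L2_of f - sphere_L2_of g"
    and sphere_L2_of_inner: "sphere_L2_of f \<bullet> sphere_L2_of g = (\<integral>x. f x \<bullet> g x \<partial>sphere_volume)"
  using assms
  by (simp_all add: plus_sphere_L2.abs_eq minus_sphere_L2.abs_eq inner_sphere_L2.abs_eq eq_onp_def)

lemma sphere_L2_of_scaleR:
  "sphere_sq_integrable f \<Longrightarrow> sphere_L2_of (\<lambda>x. c *\<^sub>R f x) = c *\<^sub>R sphere_L2_of f"
  by (simp add: scaleR_sphere_L2.abs_eq)

lemma sphere_L2_of_norm:
  assumes "sphere_sq_integrable f"
  shows "(norm (sphere_L2_of f))\<^sup>2 = (\<integral>x. (norm (f x))\<^sup>2 \<partial>sphere_volume)"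
  using assms by (simp add: power2_norm_eq_inner sphere_L2_of_inner)

lemma sphere_L2_eqI_polynomial:
  fixes u :: "('a::euclidean_space, 'b::euclidean_space) sphere_L2"
  assumes "\<And>p b. real_polynomial_function p \<Longrightarrow> b \<in> Basis \<Longrightarrow> u \<bullet> sphere_L2_of (\<lambda>x. p x *\<^sub>R b) = 0"
  shows "u = 0"
proof -
  obtain f where f: "sphere_sq_integrable f" "u = sphere_L2_of f"
    by (rule sphere_L2_cases)
  have "AE x in sphere_volume. f x = 0"
  proof (rule AE_sphere_eq_0_polynomial[OF f(1)])
    fix p :: "'a \<Rightarrow> real" and b :: 'b
    assume p: "real_polynomial_function p" and b: "b \<in> Basis"
    have "sphere_sq_integrable (\<lambda>x. p x *\<^sub>R b)"
      using p by (intro sphere_sq_integrable_continuous continuous_intros)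
        (simp add: continuous_on_polymonial_function real_polynomial_function_eq)
    then show "(\<integral>x. f x \<bullet> (p x *\<^sub>R b) \<partial>sphere_volume) = 0"
      using assms[OF p b] f by (simp add: sphere_L2_of_inner)
  qed
  then have "sphere_L2_of f = sphere_L2_of (\<lambda>x. 0)"
    by (simp add: sphere_L2_of_eq_iff f sphere_sq_integrable_zero)
  then show ?thesis
    by (simp add: f zero_sphere_L2_def)
qed

text \<open>Cauchy-Schwarz against the constant function 1, which is square integrable because the
  sphere has finite volume. In the completeness proof it makes the increments of the subsequence
  summable in L1.\<close>

lemma sphere_L1_le_L2:
  fixes f :: "'a::euclidean_space \<Rightarrow> 'b::euclidean_space"
  assumes f: "sphere_sq_integrable f"
  shows "(\<integral>\<^sup>+x. ennreal (norm (f x)) \<partial>sphere_volume) \<le>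
    ennreal (norm (sphere_L2_of f) * norm (sphere_L2_of (\<lambda>_. 1) :: ('a, real) sphere_L2))"
proof -
  have nf: "sphere_sq_integrable (\<lambda>x. norm (f x))"
    using f by (auto simp: sphere_sq_integrable_def)
  have one: "sphere_sq_integrable (\<lambda>_::'a. 1::real)"
    by (intro sphere_sq_integrable_continuous continuous_intros)
  have int: "integrable sphere_volume (\<lambda>x. norm (f x))"
    using sphere_integrable_inner[OF nf one] by simp
  have "(norm (sphere_L2_of (\<lambda>x. norm (f x))))\<^sup>2 = (norm (sphere_L2_of f))\<^sup>2"
    by (simp add: sphere_L2_of_norm f nf)
  then have "norm (sphere_L2_of (\<lambda>x. norm (f x))) = norm (sphere_L2_of f)"
    by simp
  moreover have "(\<integral>x. norm (f x) \<partial>sphere_volume) = sphere_L2_of (\<lambda>x. norm (f x)) \<bullet> sphere_L2_of (\<lambda>_. 1)"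
    by (simp add: sphere_L2_of_inner nf one)
  moreover have "\<dots> \<le> norm (sphere_L2_of (\<lambda>x. norm (f x))) * norm (sphere_L2_of (\<lambda>_. 1) :: ('a, real) sphere_L2)"
    by (rule norm_cauchy_schwarz)
  ultimately show ?thesis
    by (simp add: nn_integral_eq_integral[OF int] ennreal_leI)
qed

text \<open>A rapidly converging subsequence converges almost everywhere, and Fatou's lemma
  identifies its pointwise limit as the limit in the mean.\<close>

lemma sphere_L2_complete:
  fixes U :: "nat \<Rightarrow> ('a::euclidean_space, 'b::euclidean_space) sphere_L2"
  assumes U: "Cauchy U"
  shows "convergent U"
proof -
  have "\<forall>k. \<exists>N. \<forall>m\<ge>N. \<forall>n\<ge>N. norm (U m - U n) < (1/2) ^ k"
    using U unfolding Cauchy_iff by simp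
  then obtain N where N: "\<And>k m n. N k \<le> m \<Longrightarrow> N k \<le> n \<Longrightarrow> norm (U m - U n) < (1/2) ^ k"
    by metis
  \<comment> \<open>The sum dominates every earlier threshold \<open>N i\<close>, and the summand
    \<open>k\<close> makes the sequence strictly increasing.\<close>
  define r where "r k = k + (\<Sum>i\<le>k. N i)" for k
  have rN: "N k \<le> r m" if "k \<le> m" for k m
  proof -
    have "N k \<le> (\<Sum>i\<le>m. N i)"
      using that by (intro member_le_sum) auto
    then show ?thesis
      by (simp add: r_def)
  qed
  have r: "strict_mono r"
    by (rule strict_monoI_Suc) (simp add: r_def)
  define f where "f k = rep_sphere_L2 (U (r k))" for k
  have f: "sphere_sq_integrable (f k)" and Uf: "U (r k) = sphere_L2_of (f k)" for k
    by (simp_all add: f_def sphere_sq_integrable_rep)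
  have fm [measurable]: "f k \<in> borel_measurable sphere_volume" for k
    using f[of k] by (simp add: sphere_sq_integrable_def)
  have fd: "norm (sphere_L2_of (\<lambda>x. f m x - f k x)) < (1/2) ^ k" if "k \<le> m" for k m
    using N[OF rN[OF that] rN[OF order_refl]] by (simp add: Uf sphere_L2_of_diff f)
  define c where "c = norm (sphere_L2_of (\<lambda>_. 1) :: ('a, real) sphere_L2)"
  have "(\<integral>\<^sup>+x. (\<Sum>k. ennreal (norm (f (Suc k) x - f k x))) \<partial>sphere_volume) =
      (\<Sum>k. \<integral>\<^sup>+x. ennreal (norm (f (Suc k) x - f k x)) \<partial>sphere_volume)"
    by (rule nn_integral_suminf) measurable
  also have "\<dots> \<le> (\<Sum>k. ennreal ((1/2) ^ k * c))"
  proof (rule suminf_le)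
    fix k
    have "(\<integral>\<^sup>+x. ennreal (norm (f (Suc k) x - f k x)) \<partial>sphere_volume) \<le>
        ennreal (norm (sphere_L2_of (\<lambda>x. f (Suc k) x - f k x)) * c)"
      unfolding c_def by (intro sphere_L1_le_L2 sphere_sq_integrable_diff f)
    also have "\<dots> \<le> ennreal ((1/2) ^ k * c)"
      using fd[of k "Suc k"] by (intro ennreal_leI mult_right_mono) (auto simp: c_def)
    finally show "(\<integral>\<^sup>+x. ennreal (norm (f (Suc k) x - f k x)) \<partial>sphere_volume) \<le> ennreal ((1/2) ^ k * c)" .
  qed auto
  also have "\<dots> < \<infinity>"
  proof -
    have "summable (\<lambda>k. (1/2::real) ^ k * c)"
      by (intro summable_mult2 summable_geometric) simp
    then have "(\<Sum>k. ennreal ((1/2) ^ k * c)) = ennreal (\<Sum>k. (1/2) ^ k * c)"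
      by (intro suminf_ennreal2) (auto simp: c_def)
    then show ?thesis
      by simp
  qed
  finally have "AE x in sphere_volume. (\<Sum>k. ennreal (norm (f (Suc k) x - f k x))) \<noteq> \<infinity>"
    by (intro nn_integral_PInf_AE) auto
  then have conv: "AE x in sphere_volume. convergent (\<lambda>k. f k x)"
  proof eventually_elim
    case (elim x)
    then have "summable (\<lambda>k. norm (f (Suc k) x - f k x))"
      by (intro summable_suminf_not_top) auto
    then have "summable (\<lambda>k. f (Suc k) x - f k x)"
      by (rule summable_norm_cancel)
    then have "convergent (\<lambda>n. \<Sum>k<n. f (Suc k) x - f k x)"
      by (simp add: summable_iff_convergent)
    then have "convergent (\<lambda>n. f n x - f 0 x)"
      using sum_lessThan_telescope[of "\<lambda>k. f k x"] by simp
    then have "convergent (\<lambda>n. (f n x - f 0 x) + f 0 x)"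
      by (intro convergent_add convergent_const)
    then show ?case
      by simp
  qed
  \<comment> \<open>At points of divergence \<open>lim\<close> is arbitrary; by \<open>conv\<close>
    they form a null set.\<close>
  define g where "g x = lim (\<lambda>k. f k x)" for x
  have gm [measurable]: "g \<in> borel_measurable sphere_volume"
    unfolding g_def by measurable
  have diff: "sphere_sq_integrable (\<lambda>x. g x - f k x)" (is ?int)
    and diff_le: "norm (sphere_L2_of (\<lambda>x. g x - f k x)) \<le> (1/2) ^ k" (is ?le) for k
  proof -
    have "(\<integral>\<^sup>+x. ennreal ((norm (g x - f k x))\<^sup>2) \<partial>sphere_volume) \<le>
        (\<integral>\<^sup>+x. liminf (\<lambda>m. ennreal ((norm (f m x - f k x))\<^sup>2)) \<partial>sphere_volume)"
    proof (rule nn_integral_mono_AE)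
      show "AE x in sphere_volume. ennreal ((norm (g x - f k x))\<^sup>2) \<le>
          liminf (\<lambda>m. ennreal ((norm (f m x - f k x))\<^sup>2))"
        using conv
      proof eventually_elim
        case (elim x)
        then have "(\<lambda>m. f m x) \<longlonglongrightarrow> g x"
          by (simp add: g_def convergent_LIMSEQ_iff)
        then have "(\<lambda>m. ennreal ((norm (f m x - f k x))\<^sup>2)) \<longlonglongrightarrow> ennreal ((norm (g x - f k x))\<^sup>2)"
          by (intro tendsto_intros tendsto_ennrealI)
        then show ?case
          by (intro eq_refl lim_imp_Liminf[symmetric]) simp_all
      qed
    qed
    also have "\<dots> \<le> liminf (\<lambda>m. \<integral>\<^sup>+x. ennreal ((norm (f m x - f k x))\<^sup>2) \<partial>sphere_volume)"
      by (rule nn_integral_liminf) measurable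
    also have "\<dots> \<le> ennreal (((1/2) ^ k)\<^sup>2)"
    proof (rule Liminf_le)
      show "\<forall>\<^sub>F m in sequentially. (\<integral>\<^sup>+x. ennreal ((norm (f m x - f k x))\<^sup>2) \<partial>sphere_volume) \<le> ennreal (((1/2) ^ k)\<^sup>2)"
        unfolding eventually_sequentially
      proof (intro exI allI impI)
        fix m assume m: "k \<le> m"
        have sq: "sphere_sq_integrable (\<lambda>x. f m x - f k x)"
          by (intro sphere_sq_integrable_diff f)
        then have "(\<integral>\<^sup>+x. ennreal ((norm (f m x - f k x))\<^sup>2) \<partial>sphere_volume) =
            ennreal ((norm (sphere_L2_of (\<lambda>x. f m x - f k x)))\<^sup>2)"
          by (simp add: sphere_L2_of_norm nn_integral_eq_integral sphere_sq_integrable_def)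
        also have "\<dots> \<le> ennreal (((1/2) ^ k)\<^sup>2)"
          using fd[OF m] by (intro ennreal_leI power_mono) auto
        finally show "(\<integral>\<^sup>+x. ennreal ((norm (f m x - f k x))\<^sup>2) \<partial>sphere_volume) \<le> ennreal (((1/2) ^ k)\<^sup>2)" .
      qed
    qed simp
    finally have le: "(\<integral>\<^sup>+x. ennreal ((norm (g x - f k x))\<^sup>2) \<partial>sphere_volume) \<le> ennreal (((1/2) ^ k)\<^sup>2)" .
    have "integrable sphere_volume (\<lambda>x. (norm (g x - f k x))\<^sup>2)"
      by (rule integrableI_bounded) (use le in \<open>auto intro: le_less_trans simp: ennreal_less_top\<close>)
    then show int: ?int
      by (simp add: sphere_sq_integrable_def)
    then have "ennreal ((norm (sphere_L2_of (\<lambda>x. g x - f k x)))\<^sup>2) \<le> ennreal (((1/2) ^ k)\<^sup>2)"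
      using le by (simp add: sphere_L2_of_norm nn_integral_eq_integral sphere_sq_integrable_def)
    then have "(norm (sphere_L2_of (\<lambda>x. g x - f k x)))\<^sup>2 \<le> ((1/2) ^ k)\<^sup>2"
      by simp
    then show ?le
      by (rule power2_le_imp_le) simp
  qed
  have g: "sphere_sq_integrable g"
    using sphere_sq_integrable_add[OF diff[of 0] f[of 0]] by simp
  have "(\<lambda>k. U (r k)) \<longlonglongrightarrow> sphere_L2_of g"
  proof (rule metric_tendsto_imp_tendsto)
    show "(\<lambda>k. (1/2::real) ^ k) \<longlonglongrightarrow> 0"
      by (simp add: LIMSEQ_power_zero)
    show "\<forall>\<^sub>F k in sequentially. dist (U (r k)) (sphere_L2_of g) \<le> dist ((1/2) ^ k) (0::real)"
    proof (intro always_eventually allI)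
      fix k
      have "dist (U (r k)) (sphere_L2_of g) = norm (sphere_L2_of (\<lambda>x. g x - f k x))"
        by (simp add: dist_norm Uf sphere_L2_of_diff f g norm_minus_commute)
      then show "dist (U (r k)) (sphere_L2_of g) \<le> dist ((1/2) ^ k) (0::real)"
        using diff_le[of k] by simp
    qed
  qed
  then show ?thesis
    using Cauchy_converges_subseq U r unfolding convergent_def comp_def by blast
qed

instance sphere_L2 :: (euclidean_space, euclidean_space) banach
  by standard (rule sphere_L2_complete)


subsection \<open>Functions that are smooth near the sphere\<close>

lemma Ck_on_cong:
  assumes "open U" "\<And>x. x \<in> U \<Longrightarrow> f x = g x"
  shows "Ck_on k f U \<longleftrightarrow> Ck_on k g U"
  using assms(2)
proof (induction k arbitrary: f g)
  case 0
  then show ?case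
    by (simp cong: continuous_on_cong)
next
  case (Suc k)
  have hd: "(f has_derivative D) (at x) \<longleftrightarrow> (g has_derivative D) (at x)" if "x \<in> U" for x D
    using that Suc.prems \<open>open U\<close>
    by (metis has_derivative_transform_within_open)
  then have "frechet_derivative f (at x) = frechet_derivative g (at x)" if "x \<in> U" for x
    using that by (simp add: frechet_derivative_def)
  moreover have "f differentiable_on U \<longleftrightarrow> g differentiable_on U"
    using hd by (simp add: differentiable_on_eq_differentiable_at[OF \<open>open U\<close>] differentiable_def)
  ultimately show ?case
    using Suc.IH[of "\<lambda>x. frechet_derivative f (at x) v" "\<lambda>x. frechet_derivative g (at x) v" for v]
    by simp
qed

lemma Ck_on_SucI:
  assumes U: "open U" and f: "\<And>x. x \<in> U \<Longrightarrow> (f has_derivative f' x) (at x)"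
    and k: "\<And>v. Ck_on k (\<lambda>x. f' x v) U"
  shows "Ck_on (Suc k) f U"
proof -
  have "f differentiable_on U"
    using f by (auto simp: differentiable_on_eq_differentiable_at[OF U] differentiable_def)
  moreover have "Ck_on k (\<lambda>x. frechet_derivative f (at x) v) U" for v
    using k[of v] frechet_derivative_at[OF f]
    by (subst Ck_on_cong[OF U, of _ "\<lambda>x. f' x v"]) simp_all
  ultimately show ?thesis
    by simp
qed

lemma Ck_on_SucD:
  assumes "open U" "Ck_on (Suc k) f U"
  shows "x \<in> U \<Longrightarrow> (f has_derivative frechet_derivative f (at x)) (at x)"
    and "Ck_on k (\<lambda>x. frechet_derivative f (at x) v) U"
  using assms by (simp_all add: differentiable_on_eq_differentiable_at flip: frechet_derivative_works)

lemma Ck_on_Suc_imp: "Ck_on (Suc k) f U \<Longrightarrow> Ck_on k f U"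
  by (induction k arbitrary: f) (auto simp: differentiable_imp_continuous_on)

lemma Ck_on_subset:
  assumes "Ck_on k f U" "V \<subseteq> U"
  shows "Ck_on k f V"
  using assms(1)
  by (induction k arbitrary: f)
    (use \<open>V \<subseteq> U\<close> in \<open>auto intro: continuous_on_subset differentiable_on_subset\<close>)

lemma Ck_on_const:
  assumes "open U"
  shows "Ck_on k (\<lambda>x. c) U"
proof (induction k arbitrary: c)
  case (Suc k)
  show ?case
    by (rule Ck_on_SucI[OF assms]) (auto intro: derivative_eq_intros Suc)
qed simp

lemma Ck_on_add:
  assumes "open U" "Ck_on k f U" "Ck_on k g U"
  shows "Ck_on k (\<lambda>x. f x + g x) U"
  using assms(2,3)
proof (induction k arbitrary: f g)
  case 0
  then show ?case
    by (simp add: continuous_on_add)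
next
  case (Suc k)
  note D = Ck_on_SucD[OF \<open>open U\<close> Suc.prems(1)] Ck_on_SucD[OF \<open>open U\<close> Suc.prems(2)]
  show ?case
    by (rule Ck_on_SucI[OF \<open>open U\<close> has_derivative_add[OF D(1,3)]]) (auto intro: Suc.IH D)
qed

lemma Ck_on_sum:
  assumes "open U" "finite I" "\<And>i. i \<in> I \<Longrightarrow> Ck_on k (f i) U"
  shows "Ck_on k (\<lambda>x. \<Sum>i\<in>I. f i x) U"
  using assms(2,3)
  by (induction I) (simp_all add: Ck_on_const Ck_on_add assms(1))

lemma Ck_on_bounded_linear:
  assumes T: "bounded_linear T" and U: "open U" and f: "Ck_on k f U"
  shows "Ck_on k (\<lambda>x. T (f x)) U"
  using f
proof (induction k arbitrary: f)
  case 0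
  then show ?case
    by (simp add: bounded_linear.continuous_on[OF T])
next
  case (Suc k)
  note D = Ck_on_SucD[OF U Suc.prems]
  show ?case
    by (rule Ck_on_SucI[OF U bounded_linear.has_derivative[OF T D(1)]]) (auto intro: Suc.IH D)
qed

text \<open>The coefficients of the vector fields are linear, and polynomials arise by iterated
  linear factors, so this special product rule suffices. The induction closes because the derivative
  is a sum of a term of the same shape and a constant multiple of \<open>f\<close>.\<close>

lemma Ck_on_linear_mult:
  assumes l: "bounded_linear l" and U: "open U" and f: "Ck_on k f U"
  shows "Ck_on k (\<lambda>x. l x *\<^sub>R f x) U"
  using f
proof (induction k arbitrary: f)
  case 0
  then show ?case
    by (simp add: continuous_on_scaleR linear_continuous_on[OF l])
next
  case (Suc k)
  note D = Ck_on_SucD[OF U Suc.prems]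
  have "((\<lambda>x. l x *\<^sub>R f x) has_derivative (\<lambda>h. l x *\<^sub>R frechet_derivative f (at x) h + l h *\<^sub>R f x)) (at x)"
    if "x \<in> U" for x
    using has_derivative_scaleR[OF bounded_linear_imp_has_derivative[OF l] D(1)[OF that]] by simp
  then show ?case
  proof (rule Ck_on_SucI[OF U])
    show "Ck_on k (\<lambda>x. l x *\<^sub>R frechet_derivative f (at x) v + l v *\<^sub>R f x) U" for v
      by (intro Ck_on_add[OF U] Suc.IH[OF D(2)] Ck_on_bounded_linear[OF bounded_linear_scaleR_right U]
          Ck_on_Suc_imp[OF Suc.prems])
  qed
qed

lemma Ck_on_compose_linear:
  fixes R :: "'a::real_normed_vector \<Rightarrow> 'b::real_normed_vector"
  assumes R: "bounded_linear R" and U: "open U" and f: "Ck_on k f U"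
  shows "Ck_on k (\<lambda>x. f (R x)) (R -` U)"
  using f
proof (induction k arbitrary: f)
  case 0
  then show ?case
    by (auto intro: continuous_on_compose2[of U f] linear_continuous_on[OF R])
next
  case (Suc k)
  note D = Ck_on_SucD[OF U Suc.prems]
  have op: "open (R -` U)"
    using U linear_continuous_on[OF R] by (rule open_vimage)
  have "((\<lambda>x. f (R x)) has_derivative (\<lambda>h. frechet_derivative f (at (R x)) (R h))) (at x)" if "x \<in> R -` U" for x
    using has_derivative_compose[OF bounded_linear_imp_has_derivative[OF R] D(1)] that by simp
  then show ?case
    by (rule Ck_on_SucI[OF op]) (assumption, rule Suc.IH[OF D(2)])
qed


subsection \<open>Derivatives along the sphere\<close>

lemma sphere_deriv_cong:
  assumes "\<And>y. y \<in> sphere 0 1 \<Longrightarrow> f y = g y" "x \<in> sphere 0 1"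
  shows "sphere_deriv f x = sphere_deriv g x"
proof -
  have "(f has_derivative D) (at x within sphere 0 1) \<longleftrightarrow> (g has_derivative D) (at x within sphere 0 1)" for D
    using assms by (metis has_derivative_transform)
  then show ?thesis
    by (simp add: sphere_deriv_def frechet_derivative_def fun_eq_iff)
qed

text \<open>Great circles show that a derivative within the sphere is unique on tangent vectors.\<close>

lemma has_derivative_sphere_unique:
  fixes x :: "'a::euclidean_space"
  assumes D: "(f has_derivative D) (at x within sphere 0 1)"
    and E: "(f has_derivative E) (at x within sphere 0 1)"
    and x: "x \<in> sphere 0 1" and v: "v \<bullet> x = 0"
  shows "D v = E v"
proof (cases "v = 0")
  case True
  then show ?thesis
    using D E by (simp add: has_derivative_bounded_linear linear_simps(3))
next
  case False
  define c where "c = norm v"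
  have c: "c \<noteq> 0"
    using False by (simp add: c_def)
  define g where "g s = cos (c * s) *\<^sub>R x + (sin (c * s) / c) *\<^sub>R v" for s
  have "norm (g s) = 1" for s
  proof -
    have "g s \<bullet> g s = (cos (c * s))\<^sup>2 * (x \<bullet> x) + (sin (c * s) / c)\<^sup>2 * (v \<bullet> v)"
      using v by (simp add: g_def inner_add_left inner_add_right inner_commute power2_eq_square)
    also have "\<dots> = 1"
      using x c by (simp add: dot_square_norm c_def[symmetric] power_divide)
    finally show ?thesis
      by (simp add: norm_eq_sqrt_inner)
  qed
  then have g: "range g \<subseteq> sphere 0 1"
    by auto
  have g0: "g 0 = x"
    by (simp add: g_def)
  have gd: "(g has_derivative (\<lambda>h. h *\<^sub>R v)) (at 0)"
    unfolding g_def using c by (auto intro!: derivative_eq_intros simp: fun_eq_iff)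
  have "((\<lambda>s. f (g s)) has_derivative (\<lambda>h. F (h *\<^sub>R v))) (at 0)"
    if "(f has_derivative F) (at x within sphere 0 1)" for F
    using has_derivative_in_compose[OF gd, of f F] has_derivative_subset[OF that g] g0 by simp
  from has_derivative_unique[OF this[OF D] this[OF E]]
  show ?thesis
    by (metis scaleR_one)
qed

lemma sphere_deriv_eq:
  fixes x :: "'a::euclidean_space"
  assumes D: "(f has_derivative D) (at x within sphere 0 1)" and x: "x \<in> sphere 0 1" and v: "v \<bullet> x = 0"
  shows "sphere_deriv f x v = D v"
proof -
  have "(f has_derivative sphere_deriv f x) (at x within sphere 0 1)"
    using D frechet_derivative_works[of f] by (auto simp: sphere_deriv_def[abs_def] differentiable_def)
  then show ?thesis
    using has_derivative_sphere_unique D x v by blast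
qed

lemma smooth_on_sphereE:
  assumes "smooth_on_sphere f"
  obtains U g where "open U" "sphere 0 1 \<subseteq> U" "\<And>k. Ck_on k g U" "\<And>x. x \<in> sphere 0 1 \<Longrightarrow> g x = f x"
    "\<And>x. x \<in> U \<Longrightarrow> (g has_derivative frechet_derivative g (at x)) (at x)"
    "\<And>x. x \<in> sphere 0 1 \<Longrightarrow> (f has_derivative frechet_derivative g (at x)) (at x within sphere 0 1)"
proof -
  obtain U g where Ug: "open U" "sphere 0 1 \<subseteq> U" "\<And>k. Ck_on k g U" "\<And>x. x \<in> sphere 0 1 \<Longrightarrow> g x = f x"
    using assms unfolding smooth_on_sphere_def by blast
  have d: "(g has_derivative frechet_derivative g (at x)) (at x)" if "x \<in> U" for x
    using Ck_on_SucD(1)[OF Ug(1) Ug(3)[of "Suc 0"] that] .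
  have "(f has_derivative frechet_derivative g (at x)) (at x within sphere 0 1)" if "x \<in> sphere 0 1" for x
    by (rule has_derivative_transform[OF that _ has_derivative_at_withinI[OF d]]) (use Ug(2,4) that in auto)
  with that[OF Ug d] show ?thesis
    by blast
qed

lemma smooth_has_sphere_deriv:
  assumes "smooth_on_sphere f" "x \<in> sphere 0 1"
  shows "(f has_derivative sphere_deriv f x) (at x within sphere 0 1)"
proof -
  have "f differentiable at x within sphere 0 1"
    unfolding differentiable_def
    by (rule smooth_on_sphereE[OF assms(1)]) (use assms(2) in blast)
  then have "(f has_derivative frechet_derivative f (at x within sphere 0 1)) (at x within sphere 0 1)"
    by (simp add: frechet_derivative_works)
  then show ?thesis
    by (simp add: sphere_deriv_def[abs_def])
qed

section \<open>Closure properties of the smooth functions on the sphere\<close>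

lemma smooth_continuous: "smooth_on_sphere f \<Longrightarrow> continuous_on (sphere 0 1) f"
  unfolding continuous_on_eq_continuous_within
  using has_derivative_continuous[OF smooth_has_sphere_deriv] by blast

lemma smooth_const: "smooth_on_sphere (\<lambda>x. c)"
  unfolding smooth_on_sphere_def by (intro exI[of _ UNIV] exI[of _ "\<lambda>x. c"]) (simp add: Ck_on_const)

lemma smooth_add:
  assumes "smooth_on_sphere f" "smooth_on_sphere g"
  shows "smooth_on_sphere (\<lambda>x. f x + g x)"
proof -
  obtain U f' where f: "open U" "sphere 0 1 \<subseteq> U" "\<And>k. Ck_on k f' U" "\<And>x. x \<in> sphere 0 1 \<Longrightarrow> f' x = f x"
    using assms(1) unfolding smooth_on_sphere_def by blast
  obtain V g' where g: "open V" "sphere 0 1 \<subseteq> V" "\<And>k. Ck_on k g' V" "\<And>x. x \<in> sphere 0 1 \<Longrightarrow> g' x = g x"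
    using assms(2) unfolding smooth_on_sphere_def by blast
  have "Ck_on k (\<lambda>x. f' x + g' x) (U \<inter> V)" for k
    using f(1) g(1) by (intro Ck_on_add Ck_on_subset[OF f(3)] Ck_on_subset[OF g(3)]) auto
  then show ?thesis
    unfolding smooth_on_sphere_def using f g
    by (intro exI[of _ "U \<inter> V"] exI[of _ "\<lambda>x. f' x + g' x"]) auto
qed

lemma smooth_bounded_linear:
  assumes "bounded_linear T" "smooth_on_sphere f"
  shows "smooth_on_sphere (\<lambda>x. T (f x))"
proof -
  obtain U g where g: "open U" "sphere 0 1 \<subseteq> U" "\<And>k. Ck_on k g U" "\<And>x. x \<in> sphere 0 1 \<Longrightarrow> g x = f x"
    using assms(2) unfolding smooth_on_sphere_def by blast
  then show ?thesis
    unfolding smooth_on_sphere_def using Ck_on_bounded_linear[OF assms(1) g(1,3)]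
    by (intro exI[of _ U] exI[of _ "\<lambda>x. T (g x)"]) simp
qed

lemma smooth_scaleR: "smooth_on_sphere f \<Longrightarrow> smooth_on_sphere (\<lambda>x. c *\<^sub>R f x)"
  by (rule smooth_bounded_linear[OF bounded_linear_scaleR_right])

lemma smooth_sum:
  "\<lbrakk>finite I; \<And>i. i \<in> I \<Longrightarrow> smooth_on_sphere (f i)\<rbrakk> \<Longrightarrow> smooth_on_sphere (\<lambda>x. \<Sum>i\<in>I. f i x)"
  by (induction I rule: finite_induct) (simp_all add: smooth_const smooth_add)

lemma smooth_linear_mult:
  assumes "bounded_linear l" "smooth_on_sphere f"
  shows "smooth_on_sphere (\<lambda>x. l x *\<^sub>R f x)"
proof -
  obtain U g where g: "open U" "sphere 0 1 \<subseteq> U" "\<And>k. Ck_on k g U" "\<And>x. x \<in> sphere 0 1 \<Longrightarrow> g x = f x"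
    using assms(2) unfolding smooth_on_sphere_def by blast
  then show ?thesis
    unfolding smooth_on_sphere_def using Ck_on_linear_mult[OF assms(1) g(1,3)]
    by (intro exI[of _ U] exI[of _ "\<lambda>x. l x *\<^sub>R g x"]) simp
qed

lemma smooth_polynomial_mult:
  fixes f :: "'a::euclidean_space \<Rightarrow> 'b::real_normed_vector"
  assumes "real_polynomial_function p" "smooth_on_sphere f"
  shows "smooth_on_sphere (\<lambda>x. p x *\<^sub>R f x)"
  using assms
proof (induction p arbitrary: f)
  case (linear p)
  then show ?case
    by (simp add: smooth_linear_mult)
next
  case (const c)
  then show ?case
    by (simp add: smooth_scaleR)
next
  case (add p q)
  then show ?case
    by (simp add: scaleR_add_left smooth_add)
next
  case (mult p q)
  then have "smooth_on_sphere (\<lambda>x. p x *\<^sub>R q x *\<^sub>R f x)"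
    by blast
  then show ?case
    by simp
qed

lemma smooth_compose_orthogonal:
  fixes R :: "'a::euclidean_space \<Rightarrow> 'a"
  assumes R: "orthogonal_transformation R" and f: "smooth_on_sphere f"
  shows "smooth_on_sphere (\<lambda>x. f (R x))"
proof -
  obtain U g where g: "open U" "sphere 0 1 \<subseteq> U" "\<And>k. Ck_on k g U" "\<And>x. x \<in> sphere 0 1 \<Longrightarrow> g x = f x"
    using f unfolding smooth_on_sphere_def by blast
  have lin: "bounded_linear R"
    using orthogonal_transformation_linear[OF R] by (simp add: linear_conv_bounded_linear)
  have "open (R -` U)"
    using g(1) linear_continuous_on[OF lin] by (rule open_vimage)
  moreover have "R x \<in> sphere 0 1" if "x \<in> sphere 0 1" for x
    using that by (simp add: orthogonal_transformation_norm[OF R])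
  ultimately show ?thesis
    unfolding smooth_on_sphere_def using g(2,4) Ck_on_compose_linear[OF lin g(1,3)]
    by (intro exI[of _ "R -` U"] exI[of _ "\<lambda>x. g (R x)"]) blast
qed


subsection \<open>Linear vector fields\<close>

text \<open>For linear \<open>A\<close> the second condition is skew-symmetry; by homogeneity it is
  no stronger than tangency at the points of the sphere.\<close>

definition tangent_field :: "('a::euclidean_space \<Rightarrow> 'a) \<Rightarrow> bool"
  where "tangent_field A \<longleftrightarrow> linear A \<and> (\<forall>x. A x \<bullet> x = 0)"

lemma vf_app_cong:
  "\<lbrakk>\<And>y. y \<in> sphere 0 1 \<Longrightarrow> f y = g y; x \<in> sphere 0 1\<rbrakk> \<Longrightarrow> vf_app A f x = vf_app A g x"
  unfolding vf_app_def by (simp only: sphere_deriv_cong[of f g x])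

lemma vf_app_eq:
  assumes "tangent_field A" "(f has_derivative D) (at x within sphere 0 1)" "x \<in> sphere 0 1"
  shows "vf_app A f x = D (A x)"
  unfolding vf_app_def using assms by (intro sphere_deriv_eq) (auto simp: tangent_field_def)

lemma smooth_vf_app:
  fixes f :: "'a::euclidean_space \<Rightarrow> 'b::real_normed_vector"
  assumes A: "tangent_field A" and f: "smooth_on_sphere f"
  shows "smooth_on_sphere (vf_app A f)"
proof -
  obtain U g where g: "open U" "sphere 0 1 \<subseteq> U" "\<And>k. Ck_on k g U" "\<And>x. x \<in> sphere 0 1 \<Longrightarrow> g x = f x"
      "\<And>x. x \<in> U \<Longrightarrow> (g has_derivative frechet_derivative g (at x)) (at x)"
      "\<And>x. x \<in> sphere 0 1 \<Longrightarrow> (f has_derivative frechet_derivative g (at x)) (at x within sphere 0 1)"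
    by (rule smooth_on_sphereE[OF f]) (rule that; assumption)
  have lin: "bounded_linear A"
    using A by (simp add: tangent_field_def linear_conv_bounded_linear)
  have "Ck_on k (\<lambda>x. frechet_derivative g (at x) b) U" for k b
    using g(3)[of "Suc k"] by simp
  \<comment> \<open>Smoothness needs an extension to a neighbourhood. The one used here expands
    \<open>A x\<close> in the standard basis and differentiates the extension \<open>g\<close>, so
    that only partial derivatives and linear coefficients occur.\<close>
  then have "Ck_on k (\<lambda>x. \<Sum>b\<in>Basis. (A x \<bullet> b) *\<^sub>R frechet_derivative g (at x) b) U" for k
    by (intro Ck_on_sum g Ck_on_linear_mult bounded_linear_compose[OF bounded_linear_inner_left lin]) auto
  moreover have "(\<Sum>b\<in>Basis. (A x \<bullet> b) *\<^sub>R frechet_derivative g (at x) b) = vf_app A f x" if x: "x \<in> sphere 0 1" for x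
  proof -
    have l: "linear (frechet_derivative g (at x))"
      using g(2) x by (intro has_derivative_linear[OF g(5)]) auto
    have "vf_app A f x = frechet_derivative g (at x) (\<Sum>b\<in>Basis. (A x \<bullet> b) *\<^sub>R b)"
      using vf_app_eq[OF A g(6)[OF x] x] by (simp add: euclidean_representation)
    then show ?thesis
      by (simp add: linear_sum[OF l] linear_scale[OF l])
  qed
  ultimately show ?thesis
    unfolding smooth_on_sphere_def using g(1,2) by blast
qed

lemma vf_app_const:
  "\<lbrakk>tangent_field A; x \<in> sphere 0 1\<rbrakk> \<Longrightarrow> vf_app A (\<lambda>_. c) x = 0"
  by (rule vf_app_eq[OF _ has_derivative_const])

lemma vf_app_add:
  assumes "tangent_field A" "smooth_on_sphere f" "smooth_on_sphere g" "x \<in> sphere 0 1"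
  shows "vf_app A (\<lambda>y. f y + g y) x = vf_app A f x + vf_app A g x"
  using vf_app_eq[OF assms(1) has_derivative_add[OF smooth_has_sphere_deriv[OF assms(2,4)]
      smooth_has_sphere_deriv[OF assms(3,4)]] assms(4)]
  by (simp add: vf_app_def)

lemma vf_app_bounded_linear:
  assumes "tangent_field A" "bounded_linear T" "smooth_on_sphere f" "x \<in> sphere 0 1"
  shows "vf_app A (\<lambda>y. T (f y)) x = T (vf_app A f x)"
  using vf_app_eq[OF assms(1) bounded_linear.has_derivative[OF assms(2) smooth_has_sphere_deriv[OF assms(3,4)]] assms(4)]
  by (simp add: vf_app_def)

lemma vf_app_linear_mult:
  assumes "tangent_field A" "bounded_linear l" "smooth_on_sphere f" "x \<in> sphere 0 1"
  shows "vf_app A (\<lambda>y. l y *\<^sub>R f y) x = l (A x) *\<^sub>R f x + l x *\<^sub>R vf_app A f x"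
  using vf_app_eq[OF assms(1) has_derivative_scaleR[OF bounded_linear_imp_has_derivative[OF assms(2)]
      smooth_has_sphere_deriv[OF assms(3,4)]] assms(4)]
  by (simp add: vf_app_def)


subsection \<open>Rotation fields are skew-symmetric\<close>

text \<open>The condition \<open>square\<close> gives the flow in closed form: the exponential of
  \<open>s\<close> times \<open>A\<close> is \<open>cos s\<close> times the identity plus
  \<open>sin s\<close> times \<open>A\<close>.\<close>

locale rotation_field =
  fixes A :: "real ^ 'n::{finite, wellorder} \<Rightarrow> real ^ 'n::{finite, wellorder}"
  assumes linear: "linear A" and skew: "A x \<bullet> y = - (x \<bullet> A y)" and square: "A (A x) = - x"
begin

definition rot :: "real \<Rightarrow> real ^ 'n::{finite, wellorder} \<Rightarrow> real ^ 'n::{finite, wellorder}"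
  where "rot s x = cos s *\<^sub>R x + sin s *\<^sub>R A x"

lemma A_add: "A (x + y) = A x + A y"
  and A_scaleR: "A (c *\<^sub>R x) = c *\<^sub>R A x"
  using linear by (simp_all add: linear_add linear_scale)

lemma tangent: "tangent_field A"
proof -
  have "A x \<bullet> x = 0" for x
    using skew[of x x] by (simp add: inner_commute)
  then show ?thesis
    using linear by (simp add: tangent_field_def)
qed

lemma rot_inner: "rot s x \<bullet> rot s y = x \<bullet> y"
proof -
  have "A x \<bullet> A y = x \<bullet> y"
    by (simp add: skew square)
  then have "rot s x \<bullet> rot s y = (cos s)\<^sup>2 * (x \<bullet> y) + (sin s)\<^sup>2 * (x \<bullet> y)"
    by (simp add: rot_def inner_add_left inner_add_right skew power2_eq_square algebra_simps)
  also have "\<dots> = x \<bullet> y"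
    by (simp flip: distrib_right)
  finally show ?thesis .
qed

lemma orthogonal_rot: "orthogonal_transformation (rot s)"
  unfolding orthogonal_transformation_def
  by (auto intro!: linearI simp: rot_inner) (simp_all add: rot_def A_add A_scaleR algebra_simps)

lemma norm_rot: "norm (rot s x) = norm x"
  by (rule orthogonal_transformation_norm[OF orthogonal_rot])

lemma rot_minus: "rot (- s) (rot s x) = x"
proof -
  have "rot (- s) (rot s x) = (cos s)\<^sup>2 *\<^sub>R x + (sin s)\<^sup>2 *\<^sub>R x"
    by (simp add: rot_def A_add A_scaleR square power2_eq_square algebra_simps)
  also have "\<dots> = x"
    by (simp flip: scaleR_add_left)
  finally show ?thesis .
qed

lemma has_derivative_rot: "((\<lambda>s. rot s x) has_derivative (\<lambda>h. h *\<^sub>R A (rot s x))) (at s)"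
  unfolding rot_def
  by (auto intro!: derivative_eq_intros simp: fun_eq_iff A_add A_scaleR square algebra_simps)

lemma has_vector_derivative_along_rot:
  fixes f :: "real ^ 'n::{finite, wellorder} \<Rightarrow> 'b::real_normed_vector"
  assumes f: "smooth_on_sphere f" and x: "x \<in> sphere 0 1"
  shows "((\<lambda>s. f (rot s x)) has_vector_derivative vf_app A f (rot s x)) (at s)"
proof -
  have r: "range (\<lambda>s. rot s x) \<subseteq> sphere 0 1"
    using x by (auto simp: norm_rot)
  have s: "rot s x \<in> sphere 0 1"
    using x by (simp add: norm_rot)
  have "((\<lambda>s. f (rot s x)) has_derivative (\<lambda>h. sphere_deriv f (rot s x) (h *\<^sub>R A (rot s x)))) (at s)"
    using has_derivative_in_compose[OF has_derivative_rot, of f] r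
      has_derivative_subset[OF smooth_has_sphere_deriv[OF f s] r] by blast
  moreover have "linear (sphere_deriv f (rot s x))"
    using smooth_has_sphere_deriv[OF f s] by (rule has_derivative_linear)
  ultimately show ?thesis
    by (simp add: has_vector_derivative_def vf_app_def linear_scale)
qed

text \<open>Dominated convergence: by the mean value inequality along the flow, the difference
  quotients are bounded by the maximum of the derivative over the compact sphere, uniformly in the
  step.\<close>

lemma difference_quotient_along_rot:
  fixes f :: "real ^ 'n::{finite, wellorder} \<Rightarrow> 'b::euclidean_space"
  assumes f: "smooth_on_sphere f" and h: "continuous_on (sphere 0 1) h"
    and s: "filterlim s (at 0) sequentially"
  shows "(\<lambda>n. \<integral>x. ((f (rot (s n) x) - f x) /\<^sub>R s n) \<bullet> h x \<partial>sphere_volume)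
    \<longlonglongrightarrow> (\<integral>x. vf_app A f x \<bullet> h x \<partial>sphere_volume)"
proof -
  have fc: "continuous_on (sphere 0 1) f" and dfc: "continuous_on (sphere 0 1) (vf_app A f)"
    using smooth_continuous f smooth_vf_app[OF tangent] by blast+
  obtain K where K: "0 \<le> K" "\<And>x. x \<in> sphere 0 1 \<Longrightarrow> norm (vf_app A f x) \<le> K"
    by (rule sphere_continuous_bounded[OF dfc]) (rule that; assumption)
  have bound: "norm ((f (rot r x) - f x) /\<^sub>R r) \<le> K" if x: "x \<in> sphere 0 1" for r x
  proof -
    have "norm (f (rot r x) - f (rot 0 x)) \<le> K * norm (r - 0)"
    proof (rule differentiable_bound)
      show "((\<lambda>s. f (rot s x)) has_derivative (\<lambda>h. h *\<^sub>R vf_app A f (rot t x))) (at t within UNIV)" for t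
        using has_vector_derivative_along_rot[OF f x, of t] by (simp add: has_vector_derivative_def)
      show "onorm (\<lambda>h. h *\<^sub>R vf_app A f (rot t x)) \<le> K" for t
        using K(2)[of "rot t x"] x
        by (simp add: onorm_scaleR_left[OF bounded_linear_ident] onorm_id norm_rot)
    qed auto
    then have "norm (f (rot r x) - f x) \<le> K * \<bar>r\<bar>"
      by (simp add: rot_def)
    then show ?thesis
      using K(1) by (cases "r = 0") (simp_all add: divide_simps mult.commute)
  qed
  have pointwise: "(\<lambda>n. (f (rot (s n) x) - f x) /\<^sub>R s n) \<longlonglongrightarrow> vf_app A f x" if x: "x \<in> sphere 0 1" for x
  proof -
    have x0: "rot 0 x = x"
      by (simp add: rot_def)
    have "((\<lambda>r. norm (f (rot r x) - f x - r *\<^sub>R vf_app A f x) / norm r) \<longlongrightarrow> 0) (at 0)"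
      using has_vector_derivative_along_rot[OF f x, of 0]
      by (simp add: has_vector_derivative_def has_derivative_iff_norm x0)
    moreover have "\<forall>\<^sub>F r in at 0. norm (f (rot r x) - f x - r *\<^sub>R vf_app A f x) / norm r =
        norm ((f (rot r x) - f x) /\<^sub>R r - vf_app A f x)"
    proof (rule eventually_at_filter[THEN iffD2], rule always_eventually, intro allI impI)
      fix r :: real assume r: "r \<noteq> 0"
      then have "(f (rot r x) - f x) /\<^sub>R r - vf_app A f x = (f (rot r x) - f x - r *\<^sub>R vf_app A f x) /\<^sub>R r"
        by (simp add: scaleR_diff_right)
      then show "norm (f (rot r x) - f x - r *\<^sub>R vf_app A f x) / norm r =
          norm ((f (rot r x) - f x) /\<^sub>R r - vf_app A f x)"
        by (simp add: divide_inverse mult.commute)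
    qed
    ultimately have "((\<lambda>r. norm ((f (rot r x) - f x) /\<^sub>R r - vf_app A f x)) \<longlongrightarrow> 0) (at 0)"
      by (rule Lim_transform_eventually)
    then have "((\<lambda>r. (f (rot r x) - f x) /\<^sub>R r) \<longlongrightarrow> vf_app A f x) (at 0)"
      by (simp only: tendsto_norm_zero_iff flip: LIM_zero_iff[of _ "vf_app A f x"])
    then show ?thesis
      using s by (rule filterlim_compose)
  qed
  have rotc: "continuous_on (sphere 0 1) (\<lambda>x. f (rot r x))" for r
    using smooth_compose_orthogonal[OF orthogonal_rot f] by (rule smooth_continuous)
  show ?thesis
  proof (rule integral_dominated_convergence)
    show "integrable sphere_volume (\<lambda>x. K * norm (h x))"
      by (intro sphere_integrable_continuous continuous_intros h)
    show "(\<lambda>x. vf_app A f x \<bullet> h x) \<in> borel_measurable sphere_volume"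
      by (intro sphere_measurable_continuous continuous_intros h dfc)
    show "(\<lambda>x. ((f (rot (s n) x) - f x) /\<^sub>R s n) \<bullet> h x) \<in> borel_measurable sphere_volume" for n
      by (intro sphere_measurable_continuous continuous_intros h fc rotc)
    show "AE x in sphere_volume. (\<lambda>n. ((f (rot (s n) x) - f x) /\<^sub>R s n) \<bullet> h x) \<longlonglongrightarrow> vf_app A f x \<bullet> h x"
      by (intro AE_I2 tendsto_intros pointwise) simp
    show "AE x in sphere_volume. norm (((f (rot (s n) x) - f x) /\<^sub>R s n) \<bullet> h x) \<le> K * norm (h x)" for n
    proof (rule AE_I2)
      fix x :: "real ^ 'n::{finite, wellorder}" assume "x \<in> space sphere_volume"
      then have "norm ((f (rot (s n) x) - f x) /\<^sub>R s n) * norm (h x) \<le> K * norm (h x)"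
        by (intro mult_right_mono bound) auto
      then show "norm (((f (rot (s n) x) - f x) /\<^sub>R s n) \<bullet> h x) \<le> K * norm (h x)"
        using Cauchy_Schwarz_ineq2[of "(f (rot (s n) x) - f x) /\<^sub>R s n" "h x"] by simp
    qed
  qed
qed

lemma integral_rot_swap:
  fixes f :: "real ^ 'n::{finite, wellorder} \<Rightarrow> 'b::euclidean_space"
  assumes "continuous_on (sphere 0 1) f" "continuous_on (sphere 0 1) h"
  shows "(\<integral>x. f (rot s x) \<bullet> h x \<partial>sphere_volume) = (\<integral>x. f x \<bullet> h (rot (- s) x) \<partial>sphere_volume)"
proof -
  have "continuous_on (sphere 0 1) (\<lambda>x. h (rot r x))" for r
    using assms(2)
  proof (rule continuous_on_compose2)
    show "continuous_on (sphere 0 1) (rot r)"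
      using orthogonal_transformation_linear[OF orthogonal_rot]
      by (simp add: linear_continuous_on linear_conv_bounded_linear)
  qed (auto simp: norm_rot)
  then have "(\<lambda>x. f x \<bullet> h (rot (- s) x)) \<in> borel_measurable sphere_volume"
    by (intro sphere_measurable_continuous continuous_intros assms(1))
  from sphere_integral_orthogonal[OF orthogonal_rot this, of s] show ?thesis
    by (simp add: rot_minus)
qed

text \<open>The reversed flow is again the flow of a rotation field, so a difference quotient moved
  onto the other factor is covered by the same limit theorem.\<close>

lemma rotation_field_minus: "rotation_field (\<lambda>x. - A x)"
  by (intro rotation_field.intro linearI)
    (simp_all add: A_add A_scaleR skew square linear_neg[OF linear])

lemma rot_field_minus: "rotation_field.rot (\<lambda>x. - A x) s x = rot (- s) x"
  by (simp add: rotation_field.rot_def[OF rotation_field_minus] rot_def)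

lemma vf_app_field_minus:
  assumes "smooth_on_sphere f" "x \<in> sphere 0 1"
  shows "vf_app (\<lambda>x. - A x) f x = - vf_app A f x"
  using has_derivative_linear[OF smooth_has_sphere_deriv[OF assms]]
  by (simp add: vf_app_def linear_neg)

text \<open>Integration by parts without a divergence theorem: volume invariance moves the rotation
  from \<open>f\<close> to \<open>h\<close> with reversed time, and both sides are then
  differentiated at time 0.\<close>

lemma vf_app_skew:
  fixes f h :: "real ^ 'n::{finite, wellorder} \<Rightarrow> 'b::euclidean_space"
  assumes f: "smooth_on_sphere f" and h: "smooth_on_sphere h"
  shows "(\<integral>x. vf_app A f x \<bullet> h x \<partial>sphere_volume) = - (\<integral>x. f x \<bullet> vf_app A h x \<partial>sphere_volume)"
proof -
  interpret neg: rotation_field "\<lambda>x. - A x"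
    by (rule rotation_field_minus)
  note fc = smooth_continuous[OF f] and hc = smooth_continuous[OF h]
  define s where "s n = 1 / real (Suc n)" for n
  have s: "filterlim s (at 0) sequentially"
    using lim_const_over_n[of "1::real", THEN LIMSEQ_Suc] by (auto simp: filterlim_at s_def[abs_def])
  have int: "integrable sphere_volume (\<lambda>x. f' x \<bullet> h' x)"
    if "continuous_on (sphere 0 1) f'" "continuous_on (sphere 0 1) h'" for f' h' :: "real ^ 'n::{finite, wellorder} \<Rightarrow> 'b"
    using that by (intro sphere_integrable_continuous continuous_intros)
  have rotc: "continuous_on (sphere 0 1) (\<lambda>x. f (rot r x))" "continuous_on (sphere 0 1) (\<lambda>x. h (rot r x))" for r
    using smooth_compose_orthogonal[OF orthogonal_rot] f h smooth_continuous by blast+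
  have eq: "(\<integral>x. ((f (rot r x) - f x) /\<^sub>R r) \<bullet> h x \<partial>sphere_volume) =
      (\<integral>x. ((h (neg.rot r x) - h x) /\<^sub>R r) \<bullet> f x \<partial>sphere_volume)" for r
    using integral_rot_swap[OF fc hc, of r] int[OF rotc(1) hc] int[OF fc hc] int[OF fc rotc(2)]
    by (simp add: rot_field_minus inner_diff_left inner_diff_right inner_commute[of "h _"])
  have "(\<integral>x. vf_app A f x \<bullet> h x \<partial>sphere_volume) = (\<integral>x. vf_app (\<lambda>x. - A x) h x \<bullet> f x \<partial>sphere_volume)"
    using difference_quotient_along_rot[OF f hc s] neg.difference_quotient_along_rot[OF h fc s]
    unfolding eq by (rule LIMSEQ_unique)
  also have "\<dots> = (\<integral>x. - (f x \<bullet> vf_app A h x) \<partial>sphere_volume)"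
    by (intro Bochner_Integration.integral_cong) (simp_all add: vf_app_field_minus[OF h] inner_commute)
  finally show ?thesis
    by simp
qed

end


subsection \<open>The Laplace--Beltrami operator in the frame\<close>

lemma rotation_field_X: "a \<in> {1..7} \<Longrightarrow> rotation_field (X a)"
  by (intro rotation_field.intro linear_X) (simp_all only: X_skew X_X)

lemma tangent_X: "a \<in> {1..7} \<Longrightarrow> tangent_field (X a)"
  by (rule rotation_field.tangent[OF rotation_field_X])

lemma tangent_expansion:
  assumes "norm x = 1" "v \<bullet> x = 0"
  shows "v = (\<Sum>a = 1..7. (v \<bullet> X a x) *\<^sub>R X a x)"
  using frame_expansion[OF assms(1), of v] assms(2) by simp

lemma X_inner_sum:
  assumes "a \<in> {1..7}" "norm x = 1"
  shows "(\<Sum>c = 1..7. k c *\<^sub>R X c x) \<bullet> X a x = k a"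
proof -
  have "(\<Sum>c = 1..7. k c *\<^sub>R X c x) \<bullet> X a x = (\<Sum>c = 1..7. if c = a then k a else 0)"
    unfolding inner_sum_left
    by (intro sum.cong refl) (use assms in \<open>simp add: X_inner_X dot_square_norm\<close>)
  then show ?thesis
    using assms by simp
qed

lemma sphere_grad_frame:
  assumes f: "smooth_on_sphere f" and x: "x \<in> sphere 0 1"
  shows "sphere_grad f x = (\<Sum>a = 1..7. vf_app (X a) f x *\<^sub>R X a x)"
proof -
  let ?g = "\<Sum>a = 1..7. vf_app (X a) f x *\<^sub>R X a x"
  have nx: "norm x = 1"
    using x by simp
  have lin: "linear (sphere_deriv f x)"
    using smooth_has_sphere_deriv[OF f x] by (rule has_derivative_linear)
  have g_tangent: "?g \<bullet> x = 0"
    unfolding inner_sum_left by (intro sum.neutral ballI) (simp add: X_tangent)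
  have g_inner: "?g \<bullet> v = sphere_deriv f x v" if v: "v \<bullet> x = 0" for v
  proof -
    have "sphere_deriv f x v = sphere_deriv f x (\<Sum>a = 1..7. (v \<bullet> X a x) *\<^sub>R X a x)"
      using tangent_expansion[OF nx v] by simp
    also have "\<dots> = ?g \<bullet> v"
      by (simp add: linear_sum[OF lin] linear_scale[OF lin] inner_sum_left inner_sum_right vf_app_def inner_commute mult.commute)
    finally show ?thesis
      by simp
  qed
  show ?thesis
    unfolding sphere_grad_def
  proof (rule the_equality)
    show "?g \<in> sphere_tangent x \<and> (\<forall>v\<in>sphere_tangent x. ?g \<bullet> v = sphere_deriv f x v)"
      using g_tangent g_inner by (simp add: sphere_tangent_def)
    fix g assume g: "g \<in> sphere_tangent x \<and> (\<forall>v\<in>sphere_tangent x. g \<bullet> v = sphere_deriv f x v)"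
    then have "(g - ?g) \<bullet> x = 0"
      using g_tangent by (simp add: sphere_tangent_def inner_diff_left)
    then have "g \<bullet> (g - ?g) = sphere_deriv f x (g - ?g)" "?g \<bullet> (g - ?g) = sphere_deriv f x (g - ?g)"
      using g g_inner by (simp_all add: sphere_tangent_def)
    then have "(g - ?g) \<bullet> (g - ?g) = 0"
      by (simp add: inner_diff_left)
    then show "g = ?g"
      by simp
  qed
qed

text \<open>The gradient is a combination of frame fields. When the trace is taken in the frame,
  derivatives of the coefficients give the sum of squares, and derivatives of the fields contribute
  nothing.\<close>

lemma sphere_div_grad:
  fixes f :: "real ^ 8 \<Rightarrow> real"
  assumes f: "smooth_on_sphere f" and x: "x \<in> sphere 0 1"
  shows "sphere_div (sphere_grad f) x = (\<Sum>a = 1..7. X_sq a f x)"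
proof -
  have nx: "norm x = 1"
    using x by simp
  define h where "h c = vf_app (X c) f" for c
  have h: "(h c has_derivative sphere_deriv (h c) x) (at x within sphere 0 1)" if "c \<in> {1..7}" for c
    unfolding h_def by (intro smooth_has_sphere_deriv smooth_vf_app tangent_X that f x)
  define D where "D v = (\<Sum>c = 1..7. h c x *\<^sub>R X c v + sphere_deriv (h c) x v *\<^sub>R X c x)" for v
  have "((\<lambda>y. \<Sum>c = 1..7. h c y *\<^sub>R X c y) has_derivative D) (at x within sphere 0 1)"
    unfolding D_def
    by (intro has_derivative_sum has_derivative_scaleR h linear_imp_has_derivative linear_X) auto
  then have D: "(sphere_grad f has_derivative D) (at x within sphere 0 1)"
    by (rule has_derivative_transform[OF x, rotated]) (simp add: sphere_grad_frame[OF f] h_def)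
  then have lin: "linear D"
    by (rule has_derivative_linear)
  have cov: "sphere_cov (sphere_grad f) x v = D v - (D v \<bullet> x) *\<^sub>R x" if "v \<bullet> x = 0" for v
    by (simp add: sphere_cov_def tangent_proj_def sphere_deriv_eq[OF D x that])
  have proj: "tangent_proj x b = (\<Sum>a = 1..7. (b \<bullet> X a x) *\<^sub>R X a x)" for b
    using frame_expansion[OF nx, of b] by (simp add: tangent_proj_def algebra_simps)
  have proj_tangent: "tangent_proj x b \<bullet> x = 0" for b
    using x by (simp add: tangent_proj_def inner_diff_left dot_square_norm)
  \<comment> \<open>On tangent vectors this is the covariant derivative of the gradient; being
    linear on the whole space, it lets the trace over \<open>Basis\<close> be rewritten as a trace
    over the frame.\<close>
  define T where "T v = D v - (D v \<bullet> x) *\<^sub>R x" for v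
  have T: "linear T"
    unfolding T_def using lin
    by (intro linearI) (simp_all add: linear_add linear_scale inner_add_left algebra_simps)
  have "sphere_div (sphere_grad f) x = (\<Sum>b\<in>Basis. T (tangent_proj x b) \<bullet> b)"
    by (simp add: sphere_div_def cov[OF proj_tangent] T_def)
  also have "\<dots> = (\<Sum>b\<in>Basis. \<Sum>a = 1..7. (X a x \<bullet> b) * (T (X a x) \<bullet> b))"
    by (simp add: proj linear_sum[OF T] linear_scale[OF T] inner_sum_left inner_sum_right inner_commute)
  also have "\<dots> = (\<Sum>a = 1..7. X a x \<bullet> T (X a x))"
    by (subst sum.swap) (intro sum.cong refl euclidean_inner[symmetric])
  also have "\<dots> = (\<Sum>a = 1..7. X_sq a f x)"
  proof (rule sum.cong[OF refl])
    fix a :: nat assume a: "a \<in> {1..7}"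
    \<comment> \<open>The frame fields are divergence free term by term: \<open>X c\<close> maps
      every vector to an orthogonal one.\<close>
    have "X c (X a x) \<bullet> X a x = 0" if "c \<in> {1..7}" for c
      by (rule X_tangent[OF that])
    then have "D (X a x) \<bullet> X a x = (\<Sum>c = 1..7. sphere_deriv (h c) x (X a x) *\<^sub>R X c x) \<bullet> X a x"
      by (simp add: D_def inner_sum_left inner_add_left)
    also have "\<dots> = sphere_deriv (h a) x (X a x)"
      by (rule X_inner_sum[OF a nx])
    finally have "D (X a x) \<bullet> X a x = X_sq a f x"
      by (simp add: X_sq_def vf_app_def h_def)
    moreover have "X a x \<bullet> T (X a x) = D (X a x) \<bullet> X a x"
      using X_tangent[OF a, of x] by (simp add: T_def inner_diff_right inner_commute[of "X a x"])
    ultimately show "X a x \<bullet> T (X a x) = X_sq a f x"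
      by simp
  qed
  finally show ?thesis .
qed

lemma smooth_X_sq: "\<lbrakk>a \<in> {1..7}; smooth_on_sphere f\<rbrakk> \<Longrightarrow> smooth_on_sphere (X_sq a f)"
  unfolding X_sq_def by (intro smooth_vf_app tangent_X)

lemma X_sq_bounded_linear:
  assumes "a \<in> {1..7}" "bounded_linear T" "smooth_on_sphere f" "x \<in> sphere 0 1"
  shows "X_sq a (\<lambda>y. T (f y)) x = T (X_sq a f x)"
proof -
  have "X_sq a (\<lambda>y. T (f y)) x = vf_app (X a) (\<lambda>y. T (vf_app (X a) f y)) x"
    unfolding X_sq_def using assms
    by (intro vf_app_cong vf_app_bounded_linear tangent_X) auto
  also have "\<dots> = T (X_sq a f x)"
    unfolding X_sq_def using assms by (intro vf_app_bounded_linear smooth_vf_app tangent_X)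
  finally show ?thesis .
qed

lemma laplace_beltrami_frame:
  fixes f :: "real ^ 8 \<Rightarrow> 'b::euclidean_space"
  assumes f: "smooth_on_sphere f" and x: "x \<in> sphere 0 1"
  shows "laplace_beltrami f x = (\<Sum>a = 1..7. X_sq a f x)"
proof -
  have "laplace_beltrami f x = (\<Sum>b\<in>Basis. ((\<Sum>a = 1..7. X_sq a f x) \<bullet> b) *\<^sub>R b)"
    unfolding laplace_beltrami_def
  proof (rule sum.cong[OF refl])
    fix b :: 'b assume "b \<in> Basis"
    have "smooth_on_sphere (\<lambda>y. f y \<bullet> b)"
      by (rule smooth_bounded_linear[OF bounded_linear_inner_left f])
    then have "sphere_div (sphere_grad (\<lambda>y. f y \<bullet> b)) x = (\<Sum>a = 1..7. X_sq a (\<lambda>y. f y \<bullet> b) x)"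
      using x by (rule sphere_div_grad)
    also have "\<dots> = (\<Sum>a = 1..7. X_sq a f x \<bullet> b)"
      by (intro sum.cong refl X_sq_bounded_linear[OF _ bounded_linear_inner_left f x])
    finally show "sphere_div (sphere_grad (\<lambda>y. f y \<bullet> b)) x *\<^sub>R b = ((\<Sum>a = 1..7. X_sq a f x) \<bullet> b) *\<^sub>R b"
      by (simp add: inner_sum_left)
  qed
  then show ?thesis
    by (simp add: euclidean_representation)
qed

lemma frame_sum_eq_sub_laplacian: "(\<Sum>a = 1..7. X_sq a f x) = sub_laplacian f x + X_sq 1 f x"
proof -
  have "{1..7::nat} = insert 1 {2..7}"
    by auto
  then show ?thesis
    by (simp add: sub_laplacian_def add.commute)
qed


subsection \<open>The Laplace--Beltrami operator commutes with rotations\<close>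

text \<open>A rotation need not map the frame at \<open>x\<close> to the frame at
  \<open>R x\<close>, but it maps it to another orthonormal basis of that tangent space. The two
  differ by an orthogonal matrix, which cancels in the sum over \<open>a\<close>.\<close>

lemma gradient_inner_orthogonal:
  fixes f h :: "real ^ 8 \<Rightarrow> 'b::euclidean_space"
  assumes R: "orthogonal_transformation R" and f: "smooth_on_sphere f" and h: "smooth_on_sphere h"
    and x: "x \<in> sphere 0 1"
  shows "(\<Sum>a = 1..7. vf_app (X a) (\<lambda>y. f (R y)) x \<bullet> vf_app (X a) (\<lambda>y. h (R y)) x) =
    (\<Sum>a = 1..7. vf_app (X a) f (R x) \<bullet> vf_app (X a) h (R x))"
proof -
  have nx: "norm x = 1" and nRx: "norm (R x) = 1" and Rx: "R x \<in> sphere 0 1"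
    using x by (simp_all add: orthogonal_transformation_norm[OF R])
  have Ri: "R v \<bullet> R w = v \<bullet> w" for v w
    using R by (simp add: orthogonal_transformation_def)
  have linR: "linear R"
    by (rule orthogonal_transformation_linear[OF R])
  have chain: "vf_app (X a) (\<lambda>y. k (R y)) x = (\<Sum>b = 1..7. (R (X a x) \<bullet> X b (R x)) *\<^sub>R vf_app (X b) k (R x))"
    if a: "a \<in> {1..7}" and k: "smooth_on_sphere k" for a and k :: "real ^ 8 \<Rightarrow> 'b"
  proof -
    have "R ` sphere 0 1 \<subseteq> sphere 0 1"
      by (auto simp: orthogonal_transformation_norm[OF R])
    then have "((\<lambda>y. k (R y)) has_derivative (\<lambda>v. sphere_deriv k (R x) (R v))) (at x within sphere 0 1)"
      using smooth_has_sphere_deriv[OF k Rx] linear_imp_has_derivative[OF linR]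
      by (blast intro: has_derivative_in_compose has_derivative_subset)
    from vf_app_eq[OF tangent_X[OF a] this x]
    have "vf_app (X a) (\<lambda>y. k (R y)) x = sphere_deriv k (R x) (R (X a x))" .
    moreover have "R (X a x) \<bullet> R x = 0"
      by (simp add: Ri X_tangent[OF a])
    then have "R (X a x) = (\<Sum>b = 1..7. (R (X a x) \<bullet> X b (R x)) *\<^sub>R X b (R x))"
      by (rule tangent_expansion[OF nRx])
    then have "sphere_deriv k (R x) (R (X a x)) =
        sphere_deriv k (R x) (\<Sum>b = 1..7. (R (X a x) \<bullet> X b (R x)) *\<^sub>R X b (R x))"
      by (rule arg_cong)
    moreover have lin: "linear (sphere_deriv k (R x))"
      using smooth_has_sphere_deriv[OF k Rx] by (rule has_derivative_linear)
    ultimately show ?thesis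
      by (simp only: linear_sum[OF lin] linear_scale[OF lin] vf_app_def)
  qed
  define M where "M a b = R (X a x) \<bullet> X b (R x)" for a b
  have orth: "(\<Sum>a = 1..7. M a b * M a c) = (if b = c then 1 else 0)" if b: "b \<in> {1..7}" and c: "c \<in> {1..7}" for b c
  proof -
    \<comment> \<open>Pulling the frame vectors at \<open>R x\<close> back by \<open>R\<close> turns
      column orthogonality of \<open>M\<close> into an expansion of \<open>y\<close> in the frame at
      \<open>x\<close>.\<close>
    obtain y z where yz: "X b (R x) = R y" "X c (R x) = R z"
      using orthogonal_transformation_surj[OF R] by (metis surjD)
    have "y \<bullet> x = 0"
      using X_tangent[OF b, of "R x"] yz Ri by simp
    then have "y = (\<Sum>a = 1..7. (y \<bullet> X a x) *\<^sub>R X a x)"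
      by (rule tangent_expansion[OF nx])
    then have "y \<bullet> z = (\<Sum>a = 1..7. (y \<bullet> X a x) *\<^sub>R X a x) \<bullet> z"
      by simp
    then have "(\<Sum>a = 1..7. M a b * M a c) = y \<bullet> z"
      by (simp add: M_def yz Ri inner_sum_left inner_sum_right inner_commute)
    also have "\<dots> = X b (R x) \<bullet> X c (R x)"
      by (simp add: yz Ri)
    also have "\<dots> = (if b = c then 1 else 0)"
      using b c nRx by (simp add: X_inner_X dot_square_norm)
    finally show ?thesis .
  qed
  let ?F = "\<lambda>b. vf_app (X b) f (R x)" and ?H = "\<lambda>b. vf_app (X b) h (R x)"
  have "(\<Sum>a = 1..7. vf_app (X a) (\<lambda>y. f (R y)) x \<bullet> vf_app (X a) (\<lambda>y. h (R y)) x) =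
      (\<Sum>a = 1..7. \<Sum>b = 1..7. \<Sum>c = 1..7. (M a b * M a c) * (?F b \<bullet> ?H c))"
  proof (rule sum.cong[OF refl])
    fix a :: nat assume a: "a \<in> {1..7}"
    have "vf_app (X a) (\<lambda>y. f (R y)) x \<bullet> vf_app (X a) (\<lambda>y. h (R y)) x =
        (\<Sum>b = 1..7. M a b *\<^sub>R ?F b) \<bullet> (\<Sum>c = 1..7. M a c *\<^sub>R ?H c)"
      by (simp only: chain[OF a f] chain[OF a h] M_def)
    also have "\<dots> = (\<Sum>b = 1..7. (M a b *\<^sub>R ?F b) \<bullet> (\<Sum>c = 1..7. M a c *\<^sub>R ?H c))"
      by (rule inner_sum_left)
    also have "\<dots> = (\<Sum>b = 1..7. \<Sum>c = 1..7. (M a b * M a c) * (?F b \<bullet> ?H c))"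
      by (intro sum.cong refl) (simp add: inner_sum_right mult_ac sum_distrib_left)
    finally show "vf_app (X a) (\<lambda>y. f (R y)) x \<bullet> vf_app (X a) (\<lambda>y. h (R y)) x =
        (\<Sum>b = 1..7. \<Sum>c = 1..7. (M a b * M a c) * (?F b \<bullet> ?H c))" .
  qed
  also have "\<dots> = (\<Sum>b = 1..7. \<Sum>a = 1..7. \<Sum>c = 1..7. (M a b * M a c) * (?F b \<bullet> ?H c))"
    by (rule sum.swap)
  also have "\<dots> = (\<Sum>b = 1..7. \<Sum>c = 1..7. \<Sum>a = 1..7. (M a b * M a c) * (?F b \<bullet> ?H c))"
    by (intro sum.cong refl sum.swap)
  also have "\<dots> = (\<Sum>b = 1..7. \<Sum>c = 1..7. (if b = c then 1 else 0) * (?F b \<bullet> ?H c))"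
    by (intro sum.cong refl) (simp only: orth flip: sum_distrib_right)
  also have "\<dots> = (\<Sum>b = 1..7. ?F b \<bullet> ?H b)"
    by (intro sum.cong refl) (simp add: if_distrib[of "\<lambda>t. t * _"] cong: if_cong)
  finally show ?thesis .
qed

lemma frame_laplacian_green:
  fixes f h :: "real ^ 8 \<Rightarrow> 'b::euclidean_space"
  assumes f: "smooth_on_sphere f" and h: "smooth_on_sphere h"
  shows "(\<integral>x. (\<Sum>a = 1..7. X_sq a f x) \<bullet> h x \<partial>sphere_volume) =
    - (\<integral>x. (\<Sum>a = 1..7. vf_app (X a) f x \<bullet> vf_app (X a) h x) \<partial>sphere_volume)"
proof -
  have int: "integrable sphere_volume (\<lambda>x. p x \<bullet> q x)"
    if "smooth_on_sphere p" "smooth_on_sphere q" for p q :: "real ^ 8 \<Rightarrow> 'b"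
    using that by (intro sphere_integrable_continuous continuous_intros smooth_continuous)
  have "(\<integral>x. (\<Sum>a = 1..7. X_sq a f x) \<bullet> h x \<partial>sphere_volume) =
      (\<Sum>a = 1..7. \<integral>x. X_sq a f x \<bullet> h x \<partial>sphere_volume)"
    unfolding inner_sum_left
    by (intro Bochner_Integration.integral_sum int smooth_X_sq f h)
  also have "\<dots> = (\<Sum>a = 1..7. - (\<integral>x. vf_app (X a) f x \<bullet> vf_app (X a) h x \<partial>sphere_volume))"
    unfolding X_sq_def
    by (intro sum.cong refl rotation_field.vf_app_skew rotation_field_X smooth_vf_app tangent_X f h)
  also have "\<dots> = - (\<integral>x. (\<Sum>a = 1..7. vf_app (X a) f x \<bullet> vf_app (X a) h x) \<partial>sphere_volume)"
    unfolding sum_negf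
    by (intro arg_cong[of _ _ uminus] Bochner_Integration.integral_sum[symmetric] int smooth_vf_app tangent_X f h)
  finally show ?thesis .
qed

lemma frame_laplacian_symmetric:
  fixes f h :: "real ^ 8 \<Rightarrow> 'b::euclidean_space"
  assumes "smooth_on_sphere f" "smooth_on_sphere h"
  shows "(\<integral>x. (\<Sum>a = 1..7. X_sq a f x) \<bullet> h x \<partial>sphere_volume) =
    (\<integral>x. f x \<bullet> (\<Sum>a = 1..7. X_sq a h x) \<partial>sphere_volume)"
  using frame_laplacian_green[OF assms] frame_laplacian_green[OF assms(2,1)]
  by (simp add: inner_commute)

text \<open>The Dirichlet form is invariant under the flow of a frame field; differentiating this
  invariance gives the commutation relation in weak form.\<close>

lemma frame_laplacian_commute:
  fixes f h :: "real ^ 8 \<Rightarrow> 'b::euclidean_space"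
  assumes c: "c \<in> {1..7}" and f: "smooth_on_sphere f" and h: "smooth_on_sphere h"
  shows "(\<integral>x. vf_app (X c) f x \<bullet> (\<Sum>a = 1..7. X_sq a h x) \<partial>sphere_volume) =
    - (\<integral>x. (\<Sum>a = 1..7. X_sq a f x) \<bullet> vf_app (X c) h x \<partial>sphere_volume)"
proof -
  interpret rotation_field "X c"
    by (rule rotation_field_X[OF c])
  interpret neg: rotation_field "\<lambda>x. - X c x"
    by (rule rotation_field_minus)
  let ?L = "\<lambda>f x. \<Sum>a = 1..7. X_sq a f x :: 'b"
  have L: "smooth_on_sphere (?L p)" if "smooth_on_sphere p" for p
    using that by (intro smooth_sum smooth_X_sq) auto
  have srot: "smooth_on_sphere (\<lambda>x. p (rot s x))" if "smooth_on_sphere p" for p :: "real ^ 8 \<Rightarrow> 'b" and s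
    using that by (rule smooth_compose_orthogonal[OF orthogonal_rot])
  have int: "integrable sphere_volume (\<lambda>x. p x \<bullet> q x)"
    if "smooth_on_sphere p" "smooth_on_sphere q" for p q :: "real ^ 8 \<Rightarrow> 'b"
    using that by (intro sphere_integrable_continuous continuous_intros smooth_continuous)
  have weak: "(\<integral>x. f (rot s x) \<bullet> ?L h x \<partial>sphere_volume) = (\<integral>x. ?L f x \<bullet> h (rot (- s) x) \<partial>sphere_volume)" for s
  proof -
    let ?k = "\<lambda>x. h (rot (- s) x)"
    have k: "smooth_on_sphere ?k"
      by (rule srot[OF h])
    have "(\<integral>x. f (rot s x) \<bullet> ?L h x \<partial>sphere_volume) = (\<integral>x. ?L (\<lambda>x. f (rot s x)) x \<bullet> h x \<partial>sphere_volume)"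
      by (rule frame_laplacian_symmetric[OF srot[OF f] h, symmetric])
    also have "\<dots> = - (\<integral>x. (\<Sum>a = 1..7. vf_app (X a) (\<lambda>x. f (rot s x)) x \<bullet> vf_app (X a) h x) \<partial>sphere_volume)"
      by (rule frame_laplacian_green[OF srot[OF f] h])
    \<comment> \<open>Since \<open>h\<close> is \<open>?k\<close> composed with
      \<open>rot s\<close>, both arguments of the Dirichlet form are now composed with the same
      rotation and invariance applies.\<close>
    also have "(\<integral>x. (\<Sum>a = 1..7. vf_app (X a) (\<lambda>x. f (rot s x)) x \<bullet> vf_app (X a) h x) \<partial>sphere_volume) =
        (\<integral>x. (\<Sum>a = 1..7. vf_app (X a) f (rot s x) \<bullet> vf_app (X a) ?k (rot s x)) \<partial>sphere_volume)"
      using gradient_inner_orthogonal[OF orthogonal_rot f k, of _ s]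
      by (intro Bochner_Integration.integral_cong) (simp_all add: rot_minus)
    also have "\<dots> = (\<integral>x. (\<Sum>a = 1..7. vf_app (X a) f x \<bullet> vf_app (X a) ?k x) \<partial>sphere_volume)"
      by (intro sphere_integral_orthogonal orthogonal_rot sphere_measurable_continuous continuous_intros
          smooth_continuous smooth_vf_app tangent_X f k)
    also have "- \<dots> = (\<integral>x. ?L f x \<bullet> ?k x \<partial>sphere_volume)"
      by (rule frame_laplacian_green[OF f k, symmetric])
    finally show ?thesis .
  qed
  define s where "s n = 1 / real (Suc n)" for n
  have s: "filterlim s (at 0) sequentially"
    using lim_const_over_n[of "1::real", THEN LIMSEQ_Suc] by (auto simp: filterlim_at s_def[abs_def])
  have eq: "(\<integral>x. ((f (rot r x) - f x) /\<^sub>R r) \<bullet> ?L h x \<partial>sphere_volume) =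
      (\<integral>x. ((h (neg.rot r x) - h x) /\<^sub>R r) \<bullet> ?L f x \<partial>sphere_volume)" for r
  proof -
    have "(\<integral>x. ((f (rot r x) - f x) /\<^sub>R r) \<bullet> ?L h x \<partial>sphere_volume) =
        ((\<integral>x. f (rot r x) \<bullet> ?L h x \<partial>sphere_volume) - (\<integral>x. f x \<bullet> ?L h x \<partial>sphere_volume)) / r"
      using int[OF srot[OF f] L[OF h]] int[OF f L[OF h]]
      by (simp only: inner_scaleR_left inner_diff_left Bochner_Integration.integral_mult_right_zero
          Bochner_Integration.integral_diff divide_inverse mult.commute)
    also have "\<dots> = ((\<integral>x. h (rot (- r) x) \<bullet> ?L f x \<partial>sphere_volume) - (\<integral>x. h x \<bullet> ?L f x \<partial>sphere_volume)) / r"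
      unfolding weak frame_laplacian_symmetric[OF f h, symmetric] by (simp only: inner_commute)
    also have "\<dots> = (\<integral>x. ((h (neg.rot r x) - h x) /\<^sub>R r) \<bullet> ?L f x \<partial>sphere_volume)"
      unfolding rot_field_minus
      using int[OF srot[OF h] L[OF f]] int[OF h L[OF f]]
      by (simp only: inner_scaleR_left inner_diff_left Bochner_Integration.integral_mult_right_zero
          Bochner_Integration.integral_diff divide_inverse mult.commute)
    finally show ?thesis .
  qed
  have "(\<integral>x. vf_app (X c) f x \<bullet> ?L h x \<partial>sphere_volume) = (\<integral>x. vf_app (\<lambda>x. - X c x) h x \<bullet> ?L f x \<partial>sphere_volume)"
    using difference_quotient_along_rot[OF f smooth_continuous[OF L[OF h]] s]
      neg.difference_quotient_along_rot[OF h smooth_continuous[OF L[OF f]] s]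
    unfolding eq by (rule LIMSEQ_unique)
  also have "\<dots> = (\<integral>x. - (?L f x \<bullet> vf_app (X c) h x) \<partial>sphere_volume)"
    by (intro Bochner_Integration.integral_cong) (simp_all add: vf_app_field_minus[OF h] inner_commute)
  finally show ?thesis
    by simp
qed


subsection \<open>Vector fields as operators on the Hilbert space\<close>

definition smooth_L2 :: "('a::euclidean_space, 'b::euclidean_space) sphere_L2 set"
  where "smooth_L2 = {sphere_L2_of f | f. smooth_on_sphere f}"

text \<open>A total function on L2 built from a chosen smooth representative; outside the classes of
  smooth functions its value is arbitrary.\<close>

definition field_op :: "('a::euclidean_space \<Rightarrow> 'a) \<Rightarrow> ('a, 'b::euclidean_space) sphere_L2 \<Rightarrow> ('a, 'b) sphere_L2"
  where "field_op A u = sphere_L2_of (vf_app A (SOME f. smooth_on_sphere f \<and> u = sphere_L2_of f))"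

lemma smooth_sq_integrable: "smooth_on_sphere f \<Longrightarrow> sphere_sq_integrable f"
  by (intro sphere_sq_integrable_continuous smooth_continuous)

lemma smooth_L2_I: "smooth_on_sphere f \<Longrightarrow> sphere_L2_of f \<in> smooth_L2"
  by (auto simp: smooth_L2_def)

lemma smooth_L2_E:
  assumes "u \<in> smooth_L2"
  obtains f where "smooth_on_sphere f" "u = sphere_L2_of f"
  using assms by (auto simp: smooth_L2_def)

lemma smooth_L2_total:
  fixes u :: "('a::euclidean_space, 'b::euclidean_space) sphere_L2"
  assumes "\<And>h. smooth_on_sphere h \<Longrightarrow> u \<bullet> sphere_L2_of h = 0"
  shows "u = 0"
  by (rule sphere_L2_eqI_polynomial) (intro assms smooth_polynomial_mult smooth_const)

lemma subspace_smooth_L2: "subspace smooth_L2"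
proof (rule subspaceI)
  show "0 \<in> smooth_L2"
    unfolding zero_sphere_L2_def by (intro smooth_L2_I smooth_const)
  show "u + v \<in> smooth_L2" if "u \<in> smooth_L2" "v \<in> smooth_L2" for u v :: "('a, 'b) sphere_L2"
    using that
    by (elim smooth_L2_E)
      (simp add: smooth_L2_I smooth_add smooth_sq_integrable flip: sphere_L2_of_add)
  show "c *\<^sub>R u \<in> smooth_L2" if "u \<in> smooth_L2" for c and u :: "('a, 'b) sphere_L2"
    using that
    by (elim smooth_L2_E)
      (simp add: smooth_L2_I smooth_scaleR smooth_sq_integrable flip: sphere_L2_of_scaleR)
qed

context rotation_field
begin

text \<open>Independence of the representative follows from skew-symmetry: paired with any smooth
  \<open>h\<close>, the result depends only on the class of \<open>f\<close>, and smooth functions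
  are total.\<close>

lemma field_op_of:
  fixes f :: "real ^ 'n::{finite, wellorder} \<Rightarrow> 'b::euclidean_space"
  assumes f: "smooth_on_sphere f"
  shows "field_op A (sphere_L2_of f) = sphere_L2_of (vf_app A f)"
proof -
  have weak: "sphere_L2_of (vf_app A g) \<bullet> sphere_L2_of h = - (sphere_L2_of g \<bullet> sphere_L2_of (vf_app A h))"
    if "smooth_on_sphere g" "smooth_on_sphere h" for g h :: "real ^ 'n::{finite, wellorder} \<Rightarrow> 'b"
    using that by (simp add: sphere_L2_of_inner smooth_sq_integrable smooth_vf_app tangent vf_app_skew)
  define g where "g = (SOME g. smooth_on_sphere g \<and> sphere_L2_of f = sphere_L2_of g)"
  have "smooth_on_sphere g \<and> sphere_L2_of f = sphere_L2_of g"
    unfolding g_def by (rule someI[of _ f]) (simp add: f)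
  then have g: "smooth_on_sphere g" "sphere_L2_of g = sphere_L2_of f"
    by simp_all
  have "sphere_L2_of (vf_app A g) - sphere_L2_of (vf_app A f) = 0"
    by (rule smooth_L2_total) (simp add: inner_diff_left weak f g)
  then show ?thesis
    by (simp add: field_op_def g_def)
qed

lemma field_op_smooth: "u \<in> smooth_L2 \<Longrightarrow> field_op A u \<in> smooth_L2"
  by (elim smooth_L2_E) (simp add: field_op_of smooth_L2_I smooth_vf_app tangent)

lemma field_op_add:
  fixes u v :: "(real ^ 'n::{finite, wellorder}, 'b::euclidean_space) sphere_L2"
  assumes "u \<in> smooth_L2" "v \<in> smooth_L2"
  shows "field_op A (u + v) = field_op A u + field_op A v"
proof -
  obtain f g where f: "smooth_on_sphere f" "u = sphere_L2_of f" and g: "smooth_on_sphere g" "v = sphere_L2_of g"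
    using assms by (elim smooth_L2_E)
  have "field_op A (u + v) = sphere_L2_of (vf_app A (\<lambda>x. f x + g x))"
    using f g by (simp add: field_op_of smooth_add smooth_sq_integrable flip: sphere_L2_of_add)
  also have "\<dots> = sphere_L2_of (\<lambda>x. vf_app A f x + vf_app A g x)"
    using f g by (intro sphere_L2_of_cong vf_app_add tangent smooth_sq_integrable smooth_add smooth_vf_app)
  also have "\<dots> = field_op A u + field_op A v"
    using f g by (simp add: field_op_of sphere_L2_of_add smooth_sq_integrable smooth_vf_app tangent)
  finally show ?thesis .
qed

lemma field_op_scaleR:
  fixes u :: "(real ^ 'n::{finite, wellorder}, 'b::euclidean_space) sphere_L2"
  assumes "u \<in> smooth_L2"
  shows "field_op A (c *\<^sub>R u) = c *\<^sub>R field_op A u"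
proof -
  obtain f where f: "smooth_on_sphere f" "u = sphere_L2_of f"
    using assms by (elim smooth_L2_E)
  have "field_op A (c *\<^sub>R u) = sphere_L2_of (vf_app A (\<lambda>x. c *\<^sub>R f x))"
    using f by (simp add: field_op_of smooth_scaleR smooth_sq_integrable flip: sphere_L2_of_scaleR)
  also have "\<dots> = sphere_L2_of (\<lambda>x. c *\<^sub>R vf_app A f x)"
    using f by (intro sphere_L2_of_cong vf_app_bounded_linear bounded_linear_scaleR_right tangent
        smooth_sq_integrable smooth_scaleR smooth_vf_app)
  also have "\<dots> = c *\<^sub>R field_op A u"
    using f by (simp add: field_op_of sphere_L2_of_scaleR smooth_sq_integrable smooth_vf_app tangent)
  finally show ?thesis .
qed

lemma field_op_skew:
  "\<lbrakk>u \<in> smooth_L2; v \<in> smooth_L2\<rbrakk> \<Longrightarrow> field_op A u \<bullet> v = - (u \<bullet> field_op A v)"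
  by (elim smooth_L2_E)
    (simp add: field_op_of sphere_L2_of_inner smooth_sq_integrable smooth_vf_app tangent vf_app_skew)

end


subsection \<open>Spaces of polynomials\<close>

lemma sphere_sq_integrable_inner_mult:
  fixes f :: "'a::euclidean_space \<Rightarrow> 'b::euclidean_space"
  assumes f: "sphere_sq_integrable f"
  shows "sphere_sq_integrable (\<lambda>x. (v \<bullet> x) *\<^sub>R f x)"
proof -
  have m: "(\<lambda>x. v \<bullet> x) \<in> borel_measurable sphere_volume"
    by (intro sphere_measurable_continuous continuous_intros)
  have fm: "f \<in> borel_measurable sphere_volume" and fi: "integrable sphere_volume (\<lambda>x. (norm (f x))\<^sup>2)"
    using f by (simp_all add: sphere_sq_integrable_def)
  have "(\<lambda>x. (v \<bullet> x) *\<^sub>R f x) \<in> borel_measurable sphere_volume"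
    using m fm by (rule borel_measurable_scaleR)
  moreover have "integrable sphere_volume (\<lambda>x. (norm ((v \<bullet> x) *\<^sub>R f x))\<^sup>2)"
  proof (rule Bochner_Integration.integrable_bound)
    show "integrable sphere_volume (\<lambda>x. (norm v)\<^sup>2 * (norm (f x))\<^sup>2)"
      using fi by simp
    show "(\<lambda>x. (norm ((v \<bullet> x) *\<^sub>R f x))\<^sup>2) \<in> borel_measurable sphere_volume"
      using borel_measurable_scaleR[OF m fm] by measurable
    show "AE x in sphere_volume. norm ((norm ((v \<bullet> x) *\<^sub>R f x))\<^sup>2) \<le> norm ((norm v)\<^sup>2 * (norm (f x))\<^sup>2)"
    proof (rule AE_I2)
      fix x :: 'a assume "x \<in> space sphere_volume"
      then have "\<bar>v \<bullet> x\<bar> \<le> norm v"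
        using Cauchy_Schwarz_ineq2[of v x] by simp
      then have "(\<bar>v \<bullet> x\<bar> * norm (f x))\<^sup>2 \<le> (norm v * norm (f x))\<^sup>2"
        by (intro power_mono mult_right_mono) auto
      then show "norm ((norm ((v \<bullet> x) *\<^sub>R f x))\<^sup>2) \<le> norm ((norm v)\<^sup>2 * (norm (f x))\<^sup>2)"
        by (simp add: power_mult_distrib)
    qed
  qed
  ultimately show ?thesis
    by (simp add: sphere_sq_integrable_def)
qed

text \<open>A linear functional is bounded on the sphere, so multiplication by it acts on all of L2;
  building polynomials through it avoids choosing representatives.\<close>

lift_definition inner_mult :: "'a::euclidean_space \<Rightarrow> ('a, 'b::euclidean_space) sphere_L2 \<Rightarrow> ('a, 'b) sphere_L2"
  is "\<lambda>v f x. (v \<bullet> x) *\<^sub>R f x"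
  by (auto simp: sphere_sq_integrable_inner_mult)

lemma inner_mult_of: "sphere_sq_integrable f \<Longrightarrow> inner_mult v (sphere_L2_of f) = sphere_L2_of (\<lambda>x. (v \<bullet> x) *\<^sub>R f x)"
  by (simp add: inner_mult.abs_eq)

lemma linear_inner_mult: "linear (inner_mult v)"
proof (rule linearI)
  show "inner_mult v (u + w) = inner_mult v u + inner_mult v w" for u w :: "('a, 'b) sphere_L2"
    by transfer (auto simp: scaleR_add_right sphere_sq_integrable_add sphere_sq_integrable_inner_mult)
  show "inner_mult v (c *\<^sub>R u) = c *\<^sub>R inner_mult v u" for c and u :: "('a, 'b) sphere_L2"
    by transfer (auto simp: mult.commute sphere_sq_integrable_scaleR[OF sphere_sq_integrable_inner_mult, simplified])
qed

lemma linear_inner_mult_left: "linear (\<lambda>v. inner_mult v u)"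
proof (rule linearI)
  show "inner_mult (v + w) u = inner_mult v u + inner_mult w u" for v w
    by transfer (auto simp: inner_add_left scaleR_add_left sphere_sq_integrable_add sphere_sq_integrable_inner_mult)
  show "inner_mult (c *\<^sub>R v) u = c *\<^sub>R inner_mult v u" for c v
    by transfer (auto simp: sphere_sq_integrable_scaleR[OF sphere_sq_integrable_inner_mult, simplified])
qed

lemma inner_mult_smooth: "u \<in> smooth_L2 \<Longrightarrow> inner_mult v u \<in> smooth_L2"
  by (elim smooth_L2_E)
    (simp add: inner_mult_of smooth_sq_integrable smooth_L2_I smooth_linear_mult[OF bounded_linear_inner_right])

text \<open>The span of \<open>monomials n\<close> consists of the restrictions of the polynomials of degree at most \<open>n\<close>.\<close>

primrec monomials :: "nat \<Rightarrow> ('a::euclidean_space, 'b::euclidean_space) sphere_L2 set"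
  where
    "monomials 0 = (\<lambda>b. sphere_L2_of (\<lambda>_. b)) ` Basis"
  | "monomials (Suc n) = monomials n \<union> (\<Union>i\<in>Basis. inner_mult i ` monomials n)"

lemma finite_monomials: "finite (monomials n)"
  by (induction n) simp_all

lemma monomials_smooth: "monomials n \<subseteq> smooth_L2"
  by (induction n) (auto simp: smooth_L2_I smooth_const inner_mult_smooth)

lemma span_monomials_smooth: "span (monomials n) \<subseteq> smooth_L2"
  by (intro span_minimal monomials_smooth subspace_smooth_L2)

lemma span_monomials_mono: "m \<le> n \<Longrightarrow> span (monomials m) \<subseteq> span (monomials n)"
  by (rule lift_Suc_mono_le[of "\<lambda>n. span (monomials n)"]) (auto intro!: span_mono)

lemma inner_mult_span_monomials:
  assumes u: "u \<in> span (monomials n)"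
  shows "inner_mult v u \<in> span (monomials (Suc n))"
proof -
  have "inner_mult i u \<in> span (monomials (Suc n))" if "i \<in> Basis" for i :: 'a
  proof -
    have "inner_mult i u \<in> span (inner_mult i ` monomials n)"
      using u linear_span_image[OF linear_inner_mult, of i "monomials n"] by blast
    moreover have "span (inner_mult i ` monomials n) \<subseteq> span (monomials (Suc n))"
      using that by (intro span_mono) auto
    ultimately show ?thesis
      by blast
  qed
  then have "(\<Sum>i\<in>Basis. (v \<bullet> i) *\<^sub>R inner_mult i u) \<in> span (monomials (Suc n))"
    by (intro span_sum span_scale)
  also have "(\<Sum>i\<in>Basis. (v \<bullet> i) *\<^sub>R inner_mult i u) = inner_mult (\<Sum>i\<in>Basis. (v \<bullet> i) *\<^sub>R i) u"
    by (simp only: linear_sum[OF linear_inner_mult_left] linear_scale[OF linear_inner_mult_left])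
  finally show ?thesis
    by (simp add: euclidean_representation)
qed

text \<open>With \<open>f\<close> kept general in the induction, a product of polynomials becomes
  two successive multiplications. Only the existence of a degree bound matters for density.\<close>

lemma polynomial_mult_span_monomials:
  assumes "real_polynomial_function p" "smooth_on_sphere f" "sphere_L2_of f \<in> span (monomials n)"
  shows "\<exists>m. sphere_L2_of (\<lambda>x. p x *\<^sub>R f x) \<in> span (monomials m)"
  using assms
proof (induction p arbitrary: f n)
  case (linear p)
  then have "linear p"
    by (simp add: bounded_linear.linear)
  define v where "v = (\<Sum>i\<in>Basis. p i *\<^sub>R i)"
  have "p x = v \<bullet> x" for x
  proof -
    have "p x = p (\<Sum>i\<in>Basis. (x \<bullet> i) *\<^sub>R i)"
      by (simp add: euclidean_representation)
    then show ?thesis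
      by (simp only: linear_sum[OF \<open>linear p\<close>] linear_scale[OF \<open>linear p\<close>])
        (simp add: v_def inner_sum_left inner_sum_right inner_commute mult.commute)
  qed
  then show ?case
    using inner_mult_span_monomials[OF linear.prems(2), of v] linear.prems(1)
    by (intro exI[of _ "Suc n"]) (simp add: inner_mult_of smooth_sq_integrable del: monomials.simps)
next
  case (const c)
  then show ?case
    using span_scale[OF const.prems(2), of c]
    by (intro exI[of _ n]) (simp add: sphere_L2_of_scaleR smooth_sq_integrable)
next
  case (add p q)
  obtain k m where "sphere_L2_of (\<lambda>x. p x *\<^sub>R f x) \<in> span (monomials k)"
      "sphere_L2_of (\<lambda>x. q x *\<^sub>R f x) \<in> span (monomials m)"
    using add.IH(1)[OF add.prems] add.IH(2)[OF add.prems] by blast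
  then have "sphere_L2_of (\<lambda>x. p x *\<^sub>R f x) + sphere_L2_of (\<lambda>x. q x *\<^sub>R f x) \<in> span (monomials (max k m))"
    using span_monomials_mono[of k "max k m"] span_monomials_mono[of m "max k m"]
    by (intro span_add) auto
  then show ?case
    using add.hyps add.prems(1)
    by (auto simp: scaleR_add_left sphere_L2_of_add smooth_sq_integrable smooth_polynomial_mult)
next
  case (mult p q)
  obtain m where "sphere_L2_of (\<lambda>x. q x *\<^sub>R f x) \<in> span (monomials m)"
    using mult.IH(2)[OF mult.prems] by blast
  then have "\<exists>k. sphere_L2_of (\<lambda>x. p x *\<^sub>R q x *\<^sub>R f x) \<in> span (monomials k)"
    by (rule mult.IH(1)[OF smooth_polynomial_mult[OF mult.hyps(2) mult.prems(1)]])
  then show ?case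
    by simp
qed

lemma span_monomials_total:
  fixes u :: "('a::euclidean_space, 'b::euclidean_space) sphere_L2"
  assumes "\<And>n v. v \<in> span (monomials n) \<Longrightarrow> u \<bullet> v = 0"
  shows "u = 0"
proof (rule sphere_L2_eqI_polynomial)
  fix p :: "'a \<Rightarrow> real" and b :: 'b
  assume p: "real_polynomial_function p" and b: "b \<in> Basis"
  have "sphere_L2_of (\<lambda>_. b) \<in> span (monomials 0 :: ('a, 'b) sphere_L2 set)"
    using b by (auto intro: span_base)
  then obtain m where "sphere_L2_of (\<lambda>x. p x *\<^sub>R b) \<in> span (monomials m :: ('a, 'b) sphere_L2 set)"
    using polynomial_mult_span_monomials[OF p smooth_const] by blast
  then show "u \<bullet> sphere_L2_of (\<lambda>x. p x *\<^sub>R b) = 0"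
    by (rule assms)
qed

lemma (in rotation_field) field_op_span_monomials:
  fixes u :: "(real ^ 'n::{finite, wellorder}, 'b::euclidean_space) sphere_L2"
  assumes "u \<in> span (monomials n)"
  shows "field_op A u \<in> span (monomials n)"
proof -
  have step: "field_op A v \<in> span (monomials n)" if "v \<in> monomials n" for n and v :: "(real ^ 'n::{finite, wellorder}, 'b) sphere_L2"
    using that
  proof (induction n arbitrary: v)
    case 0
    then obtain b :: 'b where "v = sphere_L2_of (\<lambda>_. b)"
      by auto
    then have "field_op A v = sphere_L2_of (\<lambda>_. 0)"
      by (simp add: field_op_of smooth_const)
        (intro sphere_L2_of_cong vf_app_const tangent sphere_sq_integrable_zero)
    then show ?case
      by (simp add: span_zero flip: zero_sphere_L2_def)
  next
    case (Suc n)
    show ?case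
    proof (cases "v \<in> monomials n")
      case True
      then show ?thesis
        using Suc.IH span_monomials_mono[of n "Suc n"] by auto
    next
      case False
      then obtain i w where w: "v = inner_mult i w" "w \<in> monomials n"
        using Suc.prems by auto
      then obtain f where f: "smooth_on_sphere f" "w = sphere_L2_of f"
        using monomials_smooth smooth_L2_E by blast
      have "field_op A v = sphere_L2_of (vf_app A (\<lambda>x. (i \<bullet> x) *\<^sub>R f x))"
        using f by (simp add: w inner_mult_of field_op_of smooth_sq_integrable
            smooth_linear_mult[OF bounded_linear_inner_right])
      \<comment> \<open>By the product rule and skew-symmetry, differentiating the linear factor
        gives the linear factor with vector \<open>- A i\<close>; thus the degree does not
        rise.\<close>
      also have "\<dots> = sphere_L2_of (\<lambda>x. (- A i \<bullet> x) *\<^sub>R f x + (i \<bullet> x) *\<^sub>R vf_app A f x)"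
      proof (rule sphere_L2_of_cong)
        show "vf_app A (\<lambda>x. (i \<bullet> x) *\<^sub>R f x) x = (- A i \<bullet> x) *\<^sub>R f x + (i \<bullet> x) *\<^sub>R vf_app A f x"
          if "x \<in> sphere 0 1" for x
          using vf_app_linear_mult[OF tangent bounded_linear_inner_right f(1) that, of i]
          by (simp add: skew)
        show "sphere_sq_integrable (\<lambda>x. (- A i \<bullet> x) *\<^sub>R f x + (i \<bullet> x) *\<^sub>R vf_app A f x)"
          using f by (intro smooth_sq_integrable smooth_add smooth_vf_app tangent
              smooth_linear_mult bounded_linear_inner_right)
      qed
      also have "\<dots> = inner_mult (- A i) w + inner_mult i (field_op A w)"
        using f by (simp add: field_op_of inner_mult_of smooth_sq_integrable smooth_vf_app tangent
            sphere_L2_of_add sphere_sq_integrable_inner_mult del: inner_minus_left)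
      also have "\<dots> \<in> span (monomials (Suc n))"
        using w Suc.IH by (intro span_add inner_mult_span_monomials) (auto intro: span_base)
      finally show ?thesis .
    qed
  qed
  \<comment> \<open>\<open>field_op A\<close> is linear only on smooth classes, so the passage from
    monomials to their span goes through a subspace that includes smoothness.\<close>
  define V where "V = {u \<in> smooth_L2. field_op A u \<in> (span (monomials n) :: (real ^ 'n::{finite, wellorder}, 'b) sphere_L2 set)}"
  have "subspace V"
    unfolding V_def
  proof (rule subspaceI)
    have "field_op A (0 *\<^sub>R 0 :: (real ^ 'n::{finite, wellorder}, 'b) sphere_L2) = 0 *\<^sub>R field_op A 0"
      by (intro field_op_scaleR subspace_0[OF subspace_smooth_L2])
    then show "0 \<in> {u \<in> smooth_L2. field_op A u \<in> (span (monomials n) :: (real ^ 'n::{finite, wellorder}, 'b) sphere_L2 set)}"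
      by (simp add: span_zero subspace_0[OF subspace_smooth_L2])
  qed (auto simp: field_op_add field_op_scaleR span_add span_scale
      subspace_add[OF subspace_smooth_L2] subspace_scale[OF subspace_smooth_L2])
  moreover have "monomials n \<subseteq> V"
    using step monomials_smooth by (auto simp: V_def)
  ultimately have "span (monomials n) \<subseteq> V"
    by (rule span_minimal[rotated])
  with assms show ?thesis
    by (auto simp: V_def)
qed


subsection \<open>Sums of squares of the frame fields\<close>

definition frame_op :: "nat set \<Rightarrow> (real ^ 8, 'b::euclidean_space) sphere_L2 \<Rightarrow> (real ^ 8, 'b) sphere_L2"
  where "frame_op I u = (\<Sum>a\<in>I. field_op (X a) (field_op (X a) u))"

lemma frame_op_of:
  assumes I: "I \<subseteq> {1..7}" and f: "smooth_on_sphere f"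
  shows "frame_op I (sphere_L2_of f) = sphere_L2_of (\<lambda>x. \<Sum>a\<in>I. X_sq a f x)"
proof -
  have "finite I"
    using I finite_subset by blast
  then show ?thesis
    using I
  proof (induction I)
    case empty
    then show ?case
      by (simp add: frame_op_def zero_sphere_L2_def)
  next
    case (insert a I)
    then have a: "a \<in> {1..7}" and I: "I \<subseteq> {1..7}"
      by auto
    interpret rotation_field "X a"
      by (rule rotation_field_X[OF a])
    have "field_op (X a) (field_op (X a) (sphere_L2_of f)) = sphere_L2_of (X_sq a f)"
      by (simp add: field_op_of smooth_vf_app tangent f X_sq_def)
    moreover have "smooth_on_sphere (\<lambda>x. \<Sum>a\<in>I. X_sq a f x)"
      using insert.hyps(1) I f by (intro smooth_sum smooth_X_sq) auto
    ultimately show ?case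
      using insert.IH[OF I] insert.hyps f
      by (simp add: frame_op_def sphere_L2_of_add smooth_sq_integrable smooth_X_sq[OF a])
  qed
qed

lemma symmetric_on_frame_op:
  assumes "I \<subseteq> {1..7}"
  shows "symmetric_on (smooth_L2 :: (real ^ 8, 'b::euclidean_space) sphere_L2 set) (frame_op I)"
proof -
  have rot: "rotation_field (X a)" if "a \<in> I" for a
    using assms that by (intro rotation_field_X) auto
  have smooth: "field_op (X a) u \<in> smooth_L2" if "a \<in> I" "u \<in> smooth_L2" for a and u :: "(real ^ 8, 'b) sphere_L2"
    using rot that by (intro rotation_field.field_op_smooth)
  show ?thesis
    unfolding symmetric_on_def
  proof (intro conjI ballI allI)
    fix u v :: "(real ^ 8, 'b) sphere_L2" and c :: real
    assume u: "u \<in> smooth_L2"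
    show "frame_op I u \<in> smooth_L2"
      unfolding frame_op_def by (intro subspace_sum[OF subspace_smooth_L2] smooth u)
    show "frame_op I (c *\<^sub>R u) = c *\<^sub>R frame_op I u"
      unfolding frame_op_def scaleR_sum_right
      by (intro sum.cong refl) (simp add: rotation_field.field_op_scaleR[OF rot] smooth u)
    assume v: "v \<in> smooth_L2"
    show "frame_op I (u + v) = frame_op I u + frame_op I v"
      unfolding frame_op_def sum.distrib[symmetric]
      by (intro sum.cong refl) (simp add: rotation_field.field_op_add[OF rot] smooth u v)
    show "frame_op I u \<bullet> v = u \<bullet> frame_op I v"
      unfolding frame_op_def inner_sum_left inner_sum_right
      by (intro sum.cong refl) (simp add: rotation_field.field_op_skew[OF rot] smooth u v)
  qed
qed

lemma symmetric_on_span_monomials: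
  assumes "I \<subseteq> {1..7}"
  shows "symmetric_on (span (monomials n)) (frame_op I)"
proof (rule symmetric_on_subset[OF symmetric_on_frame_op[OF assms] span_monomials_smooth])
  have "rotation_field (X a)" if "a \<in> I" for a
    using assms that by (intro rotation_field_X) auto
  then show "frame_op I u \<in> span (monomials n)" if "u \<in> span (monomials n)" for u :: "(real ^ 8, 'a) sphere_L2"
    unfolding frame_op_def using that by (intro span_sum rotation_field.field_op_span_monomials)
qed

text \<open>Moving one factor of each square across the inner product leaves minus a sum of squared
  norms; this fixes the sign of all eigenvalues.\<close>

lemma frame_op_inner_nonpos:
  assumes "I \<subseteq> {1..7}" "u \<in> smooth_L2"
  shows "frame_op I u \<bullet> u \<le> 0"
  unfolding frame_op_def inner_sum_left
proof (rule sum_nonpos)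
  fix a assume "a \<in> I"
  then have r: "rotation_field (X a)"
    using assms by (intro rotation_field_X) auto
  show "field_op (X a) (field_op (X a) u) \<bullet> u \<le> 0"
    using rotation_field.field_op_skew[OF r rotation_field.field_op_smooth[OF r assms(2)] assms(2)] by simp
qed

text \<open>The weak commutation relation is tested against every smooth \<open>h\<close>; totality
  of the smooth functions turns it into an identity of vectors.\<close>

lemma frame_op_commute:
  fixes u :: "(real ^ 8, 'b::euclidean_space) sphere_L2"
  assumes c: "c \<in> {1..7}" and u: "u \<in> smooth_L2"
  shows "frame_op {1..7} (field_op (X c) u) = field_op (X c) (frame_op {1..7} u)"
proof -
  interpret rotation_field "X c"
    by (rule rotation_field_X[OF c])
  have sym: "symmetric_on smooth_L2 (frame_op {1..7} :: (real ^ 8, 'b) sphere_L2 \<Rightarrow> _)"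
    by (rule symmetric_on_frame_op) simp
  have Lu: "frame_op {1..7} u \<in> smooth_L2"
    using sym u by (simp add: symmetric_on_def)
  have "frame_op {1..7} (field_op (X c) u) - field_op (X c) (frame_op {1..7} u) = 0"
  proof (rule smooth_L2_total)
    fix h :: "real ^ 8 \<Rightarrow> 'b"
    assume h: "smooth_on_sphere h"
    obtain f where f: "smooth_on_sphere f" "u = sphere_L2_of f"
      using u by (rule smooth_L2_E)
    have L: "smooth_on_sphere (\<lambda>x. \<Sum>a = 1..7. X_sq a p x)" if "smooth_on_sphere p" for p :: "real ^ 8 \<Rightarrow> 'b"
      using that by (intro smooth_sum smooth_X_sq) auto
    have "frame_op {1..7} (field_op (X c) u) \<bullet> sphere_L2_of h = field_op (X c) u \<bullet> frame_op {1..7} (sphere_L2_of h)"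
      using sym field_op_smooth[OF u] smooth_L2_I[OF h] by (simp add: symmetric_on_def)
    also have "\<dots> = (\<integral>x. vf_app (X c) f x \<bullet> (\<Sum>a = 1..7. X_sq a h x) \<partial>sphere_volume)"
      using f h by (simp add: frame_op_of field_op_of sphere_L2_of_inner smooth_sq_integrable
          smooth_vf_app tangent L del: One_nat_def)
    also have "\<dots> = - (\<integral>x. (\<Sum>a = 1..7. X_sq a f x) \<bullet> vf_app (X c) h x \<partial>sphere_volume)"
      by (rule frame_laplacian_commute[OF c f(1) h])
    also have "\<dots> = - (frame_op {1..7} u \<bullet> field_op (X c) (sphere_L2_of h))"
      using f h by (simp add: frame_op_of field_op_of sphere_L2_of_inner smooth_sq_integrable
          smooth_vf_app tangent L del: One_nat_def)
    also have "\<dots> = field_op (X c) (frame_op {1..7} u) \<bullet> sphere_L2_of h"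
      by (simp only: field_op_skew[OF Lu smooth_L2_I[OF h]])
    finally show "(frame_op {1..7} (field_op (X c) u) - field_op (X c) (frame_op {1..7} u)) \<bullet> sphere_L2_of h = 0"
      by (simp add: inner_diff_left)
  qed
  then show ?thesis
    by simp
qed

lemma frame_op_split: "frame_op {1..7} u = frame_op {1} u + frame_op {2..7} u"
proof -
  have "{1..7::nat} = insert 1 {2..7}"
    by auto
  then show ?thesis
    by (simp add: frame_op_def)
qed

text \<open>The full sum commutes with \<open>X 1\<close> and hence with its square. Splitting off
  that square, which commutes with itself, leaves the claim.\<close>

lemma frame_op_parts_commute:
  fixes u :: "(real ^ 8, 'b::euclidean_space) sphere_L2"
  assumes u: "u \<in> smooth_L2"
  shows "frame_op {1} (frame_op {2..7} u) = frame_op {2..7} (frame_op {1} u)"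
proof -
  have one: "1 \<in> {1..7::nat}"
    by simp
  interpret rotation_field "X 1"
    by (rule rotation_field_X[OF one])
  have sq: "frame_op {1} v = field_op (X 1) (field_op (X 1) v)" for v :: "(real ^ 8, 'b) sphere_L2"
    by (simp add: frame_op_def)
  have s1: "symmetric_on smooth_L2 (frame_op {1} :: (real ^ 8, 'b) sphere_L2 \<Rightarrow> _)"
    and s2: "symmetric_on smooth_L2 (frame_op {2..7} :: (real ^ 8, 'b) sphere_L2 \<Rightarrow> _)"
    by (auto intro!: symmetric_on_frame_op)
  have smooth: "frame_op {1} u \<in> smooth_L2" "frame_op {2..7} u \<in> smooth_L2"
    using s1 s2 u by (simp_all add: symmetric_on_def)
  have "frame_op {1..7} (frame_op {1} u) = frame_op {1} (frame_op {1..7} u)"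
    by (simp only: sq frame_op_commute[OF one field_op_smooth[OF u]] frame_op_commute[OF one u])
  also have "\<dots> = frame_op {1} (frame_op {1} u) + frame_op {1} (frame_op {2..7} u)"
    using s1 smooth by (simp add: frame_op_split symmetric_on_def del: One_nat_def)
  finally show ?thesis
    by (simp add: frame_op_split del: One_nat_def)
qed

text \<open>The operators may differ from the frame sums off the sphere, so agreement is assumed on
  the sphere only. In this form one statement serves the intrinsic Laplacian and the three operators
  given by frame fields.\<close>

lemma L2_closure_frame_op:
  fixes L :: "(real ^ 8 \<Rightarrow> 'b::euclidean_space) \<Rightarrow> real ^ 8 \<Rightarrow> 'b"
  assumes I: "I \<subseteq> {1..7}"
    and L: "\<And>f x. smooth_on_sphere f \<Longrightarrow> x \<in> sphere 0 1 \<Longrightarrow> L f x = (\<Sum>a\<in>I. X_sq a f x)"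
  shows "L2_closure L = closure ((\<lambda>u. (u, frame_op I u)) ` smooth_L2)"
proof -
  have eq: "sphere_L2_of (L f) = frame_op I (sphere_L2_of f)" if f: "smooth_on_sphere f" for f
  proof -
    have "finite I"
      using I finite_subset by blast
    then have "smooth_on_sphere (\<lambda>x. \<Sum>a\<in>I. X_sq a f x)"
      using I f by (intro smooth_sum smooth_X_sq) auto
    then have "sphere_L2_of (L f) = sphere_L2_of (\<lambda>x. \<Sum>a\<in>I. X_sq a f x)"
      by (intro sphere_L2_of_cong L f smooth_sq_integrable)
    then show ?thesis
      by (simp add: frame_op_of[OF I f])
  qed
  have "{(sphere_L2_of f, sphere_L2_of (L f)) | f. smooth_on_sphere f} = (\<lambda>u. (u, frame_op I u)) ` smooth_L2"
  proof (intro equalityI subsetI)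
    fix p assume "p \<in> {(sphere_L2_of f, sphere_L2_of (L f)) | f. smooth_on_sphere f}"
    then obtain f where "smooth_on_sphere f" "p = (sphere_L2_of f, sphere_L2_of (L f))"
      by blast
    then show "p \<in> (\<lambda>u. (u, frame_op I u)) ` smooth_L2"
      by (intro image_eqI[of _ _ "sphere_L2_of f"]) (simp_all add: eq smooth_L2_I)
  next
    fix p :: "(real ^ 8, 'b) sphere_L2 \<times> (real ^ 8, 'b) sphere_L2"
    assume "p \<in> (\<lambda>u. (u, frame_op I u)) ` smooth_L2"
    then obtain u where "u \<in> smooth_L2" "p = (u, frame_op I u)"
      by blast
    moreover from this obtain f :: "real ^ 8 \<Rightarrow> 'b" where "smooth_on_sphere f" "u = sphere_L2_of f"
      by (elim smooth_L2_E)
    ultimately have "smooth_on_sphere f \<and> p = (sphere_L2_of f, sphere_L2_of (L f))"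
      by (simp add: eq)
    then show "p \<in> {(sphere_L2_of f, sphere_L2_of (L f)) | f. smooth_on_sphere f}"
      by blast
  qed
  then show ?thesis
    by (simp add: L2_closure_def)
qed

lemma subspace_graph:
  assumes "subspace V" "symmetric_on V f"
  shows "subspace ((\<lambda>u. (u, f u)) ` V)"
proof (rule subspaceI)
  have "f (0 *\<^sub>R 0) = 0 *\<^sub>R f 0"
    using assms subspace_0 unfolding symmetric_on_def by blast
  then show "0 \<in> (\<lambda>u. (u, f u)) ` V"
    using subspace_0[OF assms(1)] by (auto simp: zero_prod_def image_iff)
qed (use assms in \<open>auto simp: symmetric_on_def image_iff subspace_add subspace_scale\<close>)

lemma frame_semigroup:
  fixes L :: "(real ^ 8 \<Rightarrow> 'b::euclidean_space) \<Rightarrow> real ^ 8 \<Rightarrow> 'b"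
  assumes I: "I \<subseteq> {1..7}"
    and L: "\<And>f x. smooth_on_sphere f \<Longrightarrow> x \<in> sphere 0 1 \<Longrightarrow> L f x = (\<Sum>a\<in>I. X_sq a f x)"
    and e: "total_orthonormal e" "\<And>k. e k \<in> smooth_L2" "\<And>k. frame_op I (e k) = c k *\<^sub>R e k"
  shows "generates_semigroup (L2_closure L) (generated_semigroup L)"
    and "0 \<le> t \<Longrightarrow> generated_semigroup L t u \<bullet> e k = exp (c k * t) * (u \<bullet> e k)"
proof -
  interpret total_orthonormal e
    by (rule e)
  \<comment> \<open>Where \<open>e k = 0\<close> the eigenvalue \<open>c k\<close> is unconstrained
    and could have the wrong sign; it is replaced by 0 to keep \<open>l\<close> nonnegative.\<close>
  define l where "l k = (if e k = 0 then 0 else - c k)" for k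
  have l: "frame_op I (e k) = - l k *\<^sub>R e k" for k
    using e(3)[of k] by (simp add: l_def)
  have "0 \<le> l k" for k
  proof (cases "e k = 0")
    case False
    then have "e k \<bullet> e k = 1"
      using normalized[of k] by (simp add: dot_square_norm)
    then show ?thesis
      using frame_op_inner_nonpos[OF I e(2)[of k]] by (simp add: l)
  qed (simp add: l_def)
  then interpret diagonal_generator e l
    by unfold_locales auto
  have sym: "symmetric_on smooth_L2 (frame_op I :: (real ^ 8, 'b) sphere_L2 \<Rightarrow> _)"
    by (rule symmetric_on_frame_op[OF I])
  have "closure ((\<lambda>u. (u, frame_op I u)) ` smooth_L2) = gen"
  proof (rule closure_eq_gen)
    show "subspace ((\<lambda>u. (u, frame_op I u)) ` (smooth_L2 :: (real ^ 8, 'b) sphere_L2 set))"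
      by (rule subspace_graph[OF subspace_smooth_L2 sym])
    show "(e k, - l k *\<^sub>R e k) \<in> (\<lambda>u. (u, frame_op I u)) ` smooth_L2" for k
      using e(2)[of k] l[of k] by (metis image_eqI)
    show "(\<lambda>u. (u, frame_op I u)) ` smooth_L2 \<subseteq> gen"
    proof clarify
      fix u :: "(real ^ 8, 'b) sphere_L2" assume "u \<in> smooth_L2"
      then have "frame_op I u \<bullet> e k = u \<bullet> frame_op I (e k)" for k
        using sym e(2) by (simp add: symmetric_on_def)
      then show "(u, frame_op I u) \<in> gen"
        by (simp add: gen_def l)
    qed
  qed
  then have cl: "L2_closure L = gen"
    using L2_closure_frame_op[OF I L] by simp
  have sg: "generated_semigroup L = semigroup_of gen"
    by (simp add: generated_semigroup_def fun_eq_iff cl)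
  show "generates_semigroup (L2_closure L) (generated_semigroup L)"
    unfolding cl sg by (rule generates_semigroup_of)
  show "generated_semigroup L t u \<bullet> e k = exp (c k * t) * (u \<bullet> e k)" if "0 \<le> t"
    using that by (cases "e k = 0") (simp_all add: sg semigroup_of_gen sg_coeff l_def)
qed

text \<open>The first conjunct guarantees that each \<open>generated_semigroup\<close> really is a
  semigroup with the required generator and not an unspecified value of a description. The type
  \<open>'k\<close> covers real and complex scalars; the Hilbert space is treated as a real one
  throughout.\<close>

theorem corollary3:
  fixes t :: real
  assumes "0 \<le> t"
  shows
    "(\<forall>L \<in> {laplace_beltrami, (\<lambda>f x. sub_laplacian f x + X_sq 1 f x), sub_laplacian, X_sq 1 ::
          (real ^ 8 \<Rightarrow> 'k::{real_normed_field, euclidean_space}) \<Rightarrow> real ^ 8 \<Rightarrow> 'k}.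
        generates_semigroup (L2_closure L) (generated_semigroup L)) \<and>
     generated_semigroup laplace_beltrami t =
       (generated_semigroup (\<lambda>f x. sub_laplacian f x + X_sq 1 f x) t ::
         (real ^ 8, 'k) sphere_L2 \<Rightarrow> (real ^ 8, 'k) sphere_L2) \<and>
     generated_semigroup (\<lambda>f x. sub_laplacian f x + X_sq 1 f x) t =
       (generated_semigroup sub_laplacian t \<circ> generated_semigroup (X_sq 1) t ::
         (real ^ 8, 'k) sphere_L2 \<Rightarrow> (real ^ 8, 'k) sphere_L2)"
proof -
  let ?V = "\<lambda>n. span (monomials n) :: (real ^ 8, 'k) sphere_L2 set"
  have sub: "{1} \<subseteq> {1..7::nat}" "{2..7} \<subseteq> {1..7::nat}" "{1..7} \<subseteq> {1..7::nat}"
    by auto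
  have comm: "frame_op {1} (frame_op {2..7} u) = frame_op {2..7} (frame_op {1} u)" if "u \<in> ?V n" for u n
    using that span_monomials_smooth by (intro frame_op_parts_commute) blast
  obtain e :: "nat \<Rightarrow> (real ^ 8, 'k) sphere_L2" and c1 c2 where e: "total_orthonormal e"
    "\<And>k. e k \<in> (\<Union>n. ?V n)"
    "\<And>k. frame_op {1} (e k) = c1 k *\<^sub>R e k" "\<And>k. frame_op {2..7} (e k) = c2 k *\<^sub>R e k"
  proof (rule joint_eigenbasis[of ?V monomials "frame_op {1}" "frame_op {2..7}"])
    show "?V n \<subseteq> ?V (Suc n)" for n
      by (rule span_monomials_mono) simp
    show "u = 0" if "\<And>n v. v \<in> ?V n \<Longrightarrow> u \<bullet> v = 0" for u :: "(real ^ 8, 'k) sphere_L2"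
      using that by (rule span_monomials_total)
    show "symmetric_on (?V n) (frame_op {1})" "symmetric_on (?V n) (frame_op {2..7})" for n
      by (intro symmetric_on_span_monomials sub)+
    show "frame_op {1} (frame_op {2..7} u) = frame_op {2..7} (frame_op {1} u)" if "u \<in> ?V n" for n u
      using that by (rule comm)
  qed (rule subspace_span finite_monomials order_refl that; assumption)+
  have smooth: "e k \<in> smooth_L2" for k
    using e(2)[of k] span_monomials_smooth by blast
  \<comment> \<open>On joint eigenvectors the eigenvalues of the two commuting parts add up, so
    their exponentials multiply.\<close>
  have e3: "frame_op {1..7} (e k) = (c1 k + c2 k) *\<^sub>R e k" for k
    unfolding frame_op_split e(3,4) by (rule scaleR_add_left[symmetric])
  have LB: "generates_semigroup (L2_closure laplace_beltrami)
        (generated_semigroup laplace_beltrami :: real \<Rightarrow> (real ^ 8, 'k) sphere_L2 \<Rightarrow> (real ^ 8, 'k) sphere_L2)"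
    "generated_semigroup laplace_beltrami t u \<bullet> e k = exp ((c1 k + c2 k) * t) * (u \<bullet> e k)" for u k
    using assms by (auto intro!: frame_semigroup[OF sub(3) laplace_beltrami_frame e(1) smooth e3])
  note LS = frame_semigroup[where L = "\<lambda>f x. sub_laplacian f x + X_sq 1 f x",
      OF sub(3) frame_sum_eq_sub_laplacian[symmetric] e(1) smooth e3]
  note LH = frame_semigroup[where L = sub_laplacian, OF sub(2) sub_laplacian_def e(1) smooth e(4)]
  have "X_sq 1 f x = (\<Sum>a\<in>{1}. X_sq a f x)" for f :: "real ^ 8 \<Rightarrow> 'k" and x
    by simp
  note LV = frame_semigroup[where L = "X_sq 1", OF sub(1) this e(1) smooth e(3)]
  interpret total_orthonormal e
    by (rule e)
  have "generated_semigroup laplace_beltrami t =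
       (generated_semigroup (\<lambda>f x. sub_laplacian f x + X_sq 1 f x) t ::
         (real ^ 8, 'k) sphere_L2 \<Rightarrow> (real ^ 8, 'k) sphere_L2)"
    by (intro ext coeffs_eqI) (simp only: LB(2) LS(2)[OF assms])
  moreover have "generated_semigroup (\<lambda>f x. sub_laplacian f x + X_sq 1 f x) t =
       (generated_semigroup sub_laplacian t \<circ> generated_semigroup (X_sq 1) t ::
         (real ^ 8, 'k) sphere_L2 \<Rightarrow> (real ^ 8, 'k) sphere_L2)"
    by (intro ext coeffs_eqI)
      (simp only: comp_apply LS(2)[OF assms] LH(2)[OF assms] LV(2)[OF assms],
        simp add: exp_add distrib_right)
  ultimately show ?thesis
    using LB(1) LS(1) LH(1) LV(1) by blast
qed

end
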